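(* Let $K$ be a field, let $\mathcal{O}\subset\mathbb{T}^n$ be a (nonempty) order ideal of monomials, let $\sigma$ be a term ordering on $\mathbb{T}^n$, and let $\mathbf{o}$ be the origin in the affine space $\mathbb{A}_K^{s(c\mathcal{O},\sigma)}$ with coordinate ring $K[S_{c\mathcal{O},\sigma}]$. Then: a) The point $\mathbf{o}$ belongs to $\mathbb{G}_{\mathcal{O},\sigma}$. b) The following conditions are equivalent: 1) the scheme $\mathbb{G}_{\mathcal{O},\sigma}$ is isomorphic (over $K$) to an affine space; 2) the point $\mathbf{o}$ is a smooth point of $\mathbb{G}_{\mathcal{O},\sigma}$.
   Context: Notation: $\mathbb{T}^n=\{x_1^{\alpha_1}\cdots x_n^{\alpha_n}\mid\alpha_i\ge0\}$. An order ideal is a finite set $\mathcal{O}=\{t_1,\dots,t_\mu\}\subset\mathbb{T}^n$ (here nonempty) closed under taking divisors. Its border is $\partial\mathcal{O}=(x_1\mathcal{O}\cup\dots\cup x_n\mathcal{O})\setminus\mathcal{O}=\{b_1,\dots,b_\nu\}$. The corners $c\mathcal{O}\subseteq\partial\mathcal{O}$ are the minimal generators of the monoid ideal $\mathbb{T}^n\setminus\mathcal{O}$; the labelling is chosen so that $c\mathcal{O}=\{b_1,\dots,b_\eta\}$, $\eta\le\nu$. Let $\mathbf{c}=\{c_{ij}\mid 1\le i\le\mu,1\le j\le\nu\}$ be indeterminates. For $k=1,\dots,n$ the generic multiplication matrix $\mathcal{A}_k\in\mathrm{Mat}_\mu(K[\mathbf{c}])$ has $(i,j)$ entry $\delta_{im}$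 if $x_kt_j=t_m\in\mathcal{O}$, and $c_{im}$ if $x_kt_j=b_m\in\partial\mathcal{O}$. $I(\mathbb{B}_{\mathcal{O}})\subseteq K[\mathbf{c}]$ is the ideal generated by all entries of all $\mathcal{A}_k\mathcal{A}_\ell-\mathcal{A}_\ell\mathcal{A}_k$, $1\le k<\ell\le n$. $S_{\mathcal{O},\sigma}=\{c_{ij}\mid b_j>_\sigma t_i\}$; $L_{\mathcal{O},\sigma}$ is the ideal of $K[\mathbf{c}]$ generated by the $c_{ij}\notin S_{\mathcal{O},\sigma}$; $S_{c\mathcal{O},\sigma}=\{c_{ij}\in S_{\mathcal{O},\sigma}\mid j\le\eta\}$, and $s(c\mathcal{O},\sigma)$ is its cardinality. $I(\mathbb{G}_{\mathcal{O},\sigma})=(L_{\mathcal{O},\sigma}+I(\mathbb{B}_{\mathcal{O}}))\cap K[S_{c\mathcal{O},\sigma}]$, and $\mathbb{G}_{\mathcal{O},\sigma}=\mathrm{Spec}(K[S_{c\mathcal{O},\sigma}]/I(\mathbb{G}_{\mathcal{O},\sigma}))\subseteq\mathbb{A}_K^{s(c\mathcal{O},\sigma)}$ is the $(\mathcal{O},\sigma)$-Gröbner basis scheme. *)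

theory Defs
  imports
    "HOL-Library.Poly_Mapping"
    "HOL-Library.Extended_Nat"
    "HOL-Algebra.QuotRing"
    "HOL-Algebra.Ring_Divisibility"
    "HOL-Analysis.Abstract_Topology"
    "Jordan_Normal_Form.Matrix"
begin

text \<open>The monomial with exponents \<open>\<alpha>\<close> is represented by \<open>\<alpha>\<close> itself, so that
  the product of monomials is written \<open>+\<close> and the monomial 1 is \<open>0\<close>.
  The indeterminates are numbered from 0.\<close>

type_synonym mon = "nat \<Rightarrow>\<^sub>0 nat"

definition terms :: "nat \<Rightarrow> mon set" where
  "terms n = {t. Poly_Mapping.keys t \<subseteq> {..<n}}"

definition ind :: "nat \<Rightarrow> mon" where
  "ind k = Poly_Mapping.single k 1"

definition mon_dvd :: "mon \<Rightarrow> mon \<Rightarrow> bool" where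
  "mon_dvd s t \<longleftrightarrow> (\<exists>u. t = s + u)"

definition order_ideal :: "nat \<Rightarrow> mon set \<Rightarrow> bool" where
  "order_ideal n Os \<longleftrightarrow> finite Os \<and> Os \<noteq> {} \<and> Os \<subseteq> terms n \<and>
     (\<forall>t\<in>Os. \<forall>s. mon_dvd s t \<longrightarrow> s \<in> Os)"

definition border :: "nat \<Rightarrow> mon set \<Rightarrow> mon set" where
  "border n Os = (\<Union>k<n. (\<lambda>t. ind k + t) ` Os) - Os"

text \<open>The minimal generators of a monoid ideal are its elements that are minimal
  with respect to divisibility.\<close>

definition corners :: "nat \<Rightarrow> mon set \<Rightarrow> mon set" where
  "corners n Os = {t \<in> terms n - Os. \<forall>s \<in> terms n - Os. mon_dvd s t \<longrightarrow> s = t}"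

text \<open>\<open>(s, t) \<in> \<sigma>\<close> means \<open>s \<le>\<^sub>\<sigma> t\<close>.\<close>

definition term_ordering :: "nat \<Rightarrow> mon rel \<Rightarrow> bool" where
  "term_ordering n \<sigma> \<longleftrightarrow> linear_order_on (terms n) \<sigma> \<and>
     (\<forall>t \<in> terms n. (0, t) \<in> \<sigma>) \<and>
     (\<forall>s t u. (s, t) \<in> \<sigma> \<longrightarrow> u \<in> terms n \<longrightarrow> (s + u, t + u) \<in> \<sigma>)"

text \<open>A labelling of \<open>Os = {t\<^sub>0, \<dots>}\<close> and of its border \<open>{b\<^sub>0, \<dots>}\<close> in which the
  first \<open>\<eta>\<close> border terms are the corners.\<close>

definition labelling :: "nat \<Rightarrow> mon set \<Rightarrow> mon list \<Rightarrow> mon list \<Rightarrow> nat \<Rightarrow> bool" where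
  "labelling n Os ts bs \<eta> \<longleftrightarrow> distinct ts \<and> set ts = Os \<and>
     distinct bs \<and> set bs = border n Os \<and>
     \<eta> \<le> length bs \<and> set (take \<eta> bs) = corners n Os"

text \<open>Polynomials over \<open>'k\<close> in indeterminates of type \<open>'v\<close>; for \<open>V :: 'v set\<close> the ring
  \<open>poly_ring V\<close> is the subring of those polynomials in which only indeterminates from
  \<open>V\<close> occur.\<close>

type_synonym ('v, 'k) mpoly = "('v \<Rightarrow>\<^sub>0 nat) \<Rightarrow>\<^sub>0 'k"

definition vars :: "('v, 'k::zero) mpoly \<Rightarrow> 'v set" where
  "vars f = (\<Union>t \<in> Poly_Mapping.keys f. Poly_Mapping.keys t)"

definition Var :: "'v \<Rightarrow> ('v, 'k::zero_neq_one) mpoly" where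
  "Var v = Poly_Mapping.single (Poly_Mapping.single v 1) 1"

definition Const :: "'k \<Rightarrow> ('v, 'k::zero) mpoly" where
  "Const a = Poly_Mapping.single 0 a"

definition poly_ring :: "'v set \<Rightarrow> ('v, 'k::field) mpoly ring" where
  "poly_ring V = \<lparr>carrier = {f. vars f \<subseteq> V}, mult = (*), one = 1, zero = 0, add = (+)\<rparr>"

definition origin :: "'v set \<Rightarrow> ('v, 'k::field) mpoly set" where
  "origin V = Idl\<^bsub>poly_ring V\<^esub> (Var ` V)"

text \<open>The fraction \<open>a/s\<close> as an equivalence class of pairs, for \<open>s\<close> outside the prime
  ideal \<open>p\<close>.\<close>

definition frac :: "('a, 'm) ring_scheme \<Rightarrow> 'a set \<Rightarrow> 'a \<Rightarrow> 'a \<Rightarrow> ('a \<times> 'a) set" where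
  "frac A p a s = {(b, t). b \<in> carrier A \<and> t \<in> carrier A - p \<and>
     (\<exists>u \<in> carrier A - p. u \<otimes>\<^bsub>A\<^esub> (a \<otimes>\<^bsub>A\<^esub> t) = u \<otimes>\<^bsub>A\<^esub> (b \<otimes>\<^bsub>A\<^esub> s))}"

definition localization :: "('a, 'm) ring_scheme \<Rightarrow> 'a set \<Rightarrow> ('a \<times> 'a) set ring" where
  "localization A p = \<lparr>
     carrier = {frac A p a s | a s. a \<in> carrier A \<and> s \<in> carrier A - p},
     mult = (\<lambda>X Y. \<Union>(a, s) \<in> X. \<Union>(b, t) \<in> Y. frac A p (a \<otimes>\<^bsub>A\<^esub> b) (s \<otimes>\<^bsub>A\<^esub> t)),
     one = frac A p \<one>\<^bsub>A\<^esub> \<one>\<^bsub>A\<^esub>,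
     zero = frac A p \<zero>\<^bsub>A\<^esub> \<one>\<^bsub>A\<^esub>,
     add = (\<lambda>X Y. \<Union>(a, s) \<in> X. \<Union>(b, t) \<in> Y.
       frac A p (a \<otimes>\<^bsub>A\<^esub> t \<oplus>\<^bsub>A\<^esub> b \<otimes>\<^bsub>A\<^esub> s) (s \<otimes>\<^bsub>A\<^esub> t))\<rparr>"

definition krull_dim :: "('a, 'm) ring_scheme \<Rightarrow> enat" where
  "krull_dim A = Sup {enat d | d. \<exists>P :: nat \<Rightarrow> 'a set.
     (\<forall>i\<le>d. primeideal (P i) A) \<and> (\<forall>i<d. P i \<subset> P (Suc i))}"

text \<open>A Noetherian local ring is regular if its maximal ideal can be generated by as
  many elements as the Krull dimension of the ring.\<close>

definition regular_local_ring :: "('a, 'm) ring_scheme \<Rightarrow> bool" where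
  "regular_local_ring A \<longleftrightarrow> cring A \<and> noetherian_ring A \<and>
     (\<exists>M. {J. maximalideal J A} = {M} \<and>
       (\<exists>G \<subseteq> carrier A. finite G \<and> M = Idl\<^bsub>A\<^esub> G \<and> enat (card G) = krull_dim A))"

definition prime_spectrum :: "('a, 'm) ring_scheme \<Rightarrow> 'a set set" where
  "prime_spectrum A = {p. primeideal p A}"

definition zariski_open :: "('a, 'm) ring_scheme \<Rightarrow> 'a set set \<Rightarrow> bool" where
  "zariski_open A U \<longleftrightarrow>
     (\<exists>E \<subseteq> carrier A. U = {p \<in> prime_spectrum A. \<not> E \<subseteq> p})"

definition zariski :: "('a, 'm) ring_scheme \<Rightarrow> 'a set topology" where
  "zariski A = topology (zariski_open A)"

lemma istopology_zariski_open: "istopology (zariski_open A)"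
  unfolding istopology_def
proof (intro conjI allI impI)
  fix U V assume "zariski_open A U" "zariski_open A V"
  then obtain E F where E: "E \<subseteq> carrier A" "U = {p \<in> prime_spectrum A. \<not> E \<subseteq> p}"
    and F: "F \<subseteq> carrier A" "V = {p \<in> prime_spectrum A. \<not> F \<subseteq> p}"
    by (auto simp: zariski_open_def)
  let ?G = "{x \<otimes>\<^bsub>A\<^esub> y | x y. x \<in> E \<and> y \<in> F} \<inter> carrier A"
  have "\<not> ?G \<subseteq> p \<longleftrightarrow> \<not> E \<subseteq> p \<and> \<not> F \<subseteq> p" if p: "primeideal p A" for p
  proof -
    interpret primeideal p A by fact
    show ?thesis
    proof
      assume "\<not> ?G \<subseteq> p"
      then obtain x y where "x \<in> E" "y \<in> F" "x \<otimes>\<^bsub>A\<^esub> y \<notin> p" by auto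
      then show "\<not> E \<subseteq> p \<and> \<not> F \<subseteq> p"
        using E F I_l_closed I_r_closed by blast
    next
      assume "\<not> E \<subseteq> p \<and> \<not> F \<subseteq> p"
      then obtain x y where xy: "x \<in> E" "y \<in> F" "x \<notin> p" "y \<notin> p" by auto
      then have "x \<in> carrier A" "y \<in> carrier A" using E F by auto
      then have "x \<otimes>\<^bsub>A\<^esub> y \<notin> p" "x \<otimes>\<^bsub>A\<^esub> y \<in> carrier A" using I_prime xy by auto
      then show "\<not> ?G \<subseteq> p" using xy by auto
    qed
  qed
  then have "p \<in> U \<inter> V \<longleftrightarrow> p \<in> {p \<in> prime_spectrum A. \<not> ?G \<subseteq> p}" for p
    unfolding E F by (simp only: prime_spectrum_def mem_Collect_eq Int_iff) blast
  then have "U \<inter> V = {p \<in> prime_spectrum A. \<not> ?G \<subseteq> p}" by blast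
  then show "zariski_open A (U \<inter> V)" unfolding zariski_open_def by blast
next
  fix \<U> assume "\<forall>U\<in>\<U>. zariski_open A U"
  then obtain E where E: "\<And>U. U \<in> \<U> \<Longrightarrow> E U \<subseteq> carrier A \<and>
      U = {p \<in> prime_spectrum A. \<not> E U \<subseteq> p}"
    unfolding zariski_open_def by metis
  have "p \<in> \<Union>\<U> \<longleftrightarrow> p \<in> prime_spectrum A \<and> \<not> (\<Union>U\<in>\<U>. E U) \<subseteq> p" for p
    using E by blast
  then have "\<Union>\<U> = {p \<in> prime_spectrum A. \<not> (\<Union>U\<in>\<U>. E U) \<subseteq> p}" by blast
  moreover have "(\<Union>U\<in>\<U>. E U) \<subseteq> carrier A" using E by blast
  ultimately show "zariski_open A (\<Union>\<U>)" unfolding zariski_open_def by blast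
qed

lemma openin_zariski: "openin (zariski A) = zariski_open A"
  by (simp add: zariski_def istopology_zariski_open)

text \<open>A space with a sheaf of \<open>'k\<close>-algebras. The structure morphism to the spectrum of
  \<open>'k\<close> is encoded by the maps \<open>scalar U\<close> from \<open>'k\<close> to the sections over \<open>U\<close>.\<close>

record ('p, 's, 'k) k_scheme =
  space :: "'p topology"
  sections :: "'p set \<Rightarrow> 's ring"
  restr :: "'p set \<Rightarrow> 's \<Rightarrow> 's"
  scalar :: "'p set \<Rightarrow> 'k \<Rightarrow> 's"

text \<open>The sections over \<open>U\<close> of the structure sheaf of the spectrum: families of elements
  of the localizations at the points of \<open>U\<close> which are locally given by one fraction.\<close>

definition Spec_sections ::
    "('a, 'm) ring_scheme \<Rightarrow> 'a set set \<Rightarrow> ('a set \<Rightarrow> ('a \<times> 'a) set) ring" where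
  "Spec_sections A U = \<lparr>
     carrier = {s \<in> (\<Pi>\<^sub>E p\<in>U. carrier (localization A p)).
       \<forall>p\<in>U. \<exists>V. openin (zariski A) V \<and> p \<in> V \<and> V \<subseteq> U \<and>
         (\<exists>a \<in> carrier A. \<exists>f \<in> carrier A. \<forall>q\<in>V. f \<notin> q \<and> s q = frac A q a f)},
     mult = (\<lambda>s t. \<lambda>p\<in>U. s p \<otimes>\<^bsub>localization A p\<^esub> t p),
     one = (\<lambda>p\<in>U. \<one>\<^bsub>localization A p\<^esub>),
     zero = (\<lambda>p\<in>U. \<zero>\<^bsub>localization A p\<^esub>),
     add = (\<lambda>s t. \<lambda>p\<in>U. s p \<oplus>\<^bsub>localization A p\<^esub> t p)\<rparr>"

definition Spec :: "('k \<Rightarrow> 'a) \<Rightarrow> ('a, 'm) ring_scheme \<Rightarrow>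
    ('a set, 'a set \<Rightarrow> ('a \<times> 'a) set, 'k) k_scheme" where
  "Spec \<alpha> A = \<lparr>
     space = zariski A,
     sections = Spec_sections A,
     restr = (\<lambda>V s. restrict s V),
     scalar = (\<lambda>U a. \<lambda>p\<in>U. frac A p (\<alpha> a) \<one>\<^bsub>A\<^esub>)\<rparr>"

text \<open>An isomorphism consists of a homeomorphism \<open>\<phi>\<close> and an isomorphism \<open>\<psi>\<close> of sheaves of
  \<open>'k\<close>-algebras from the structure sheaf of \<open>Y\<close> to the direct image of that of \<open>X\<close>. Such
  a pair automatically induces local homomorphisms on the stalks, so there is no separate
  condition on these.\<close>

definition isomorphic_over ::
    "('p, 's, 'k) k_scheme \<Rightarrow> ('q, 't, 'k) k_scheme \<Rightarrow> bool" where
  "isomorphic_over X Y \<longleftrightarrow>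
     (\<exists>\<phi> :: 'p \<Rightarrow> 'q. \<exists>\<psi> :: 'q set \<Rightarrow> 't \<Rightarrow> 's.
        homeomorphic_map (space X) (space Y) \<phi> \<and>
        (let pre = (\<lambda>V. {x \<in> topspace (space X). \<phi> x \<in> V}) in
          (\<forall>V. openin (space Y) V \<longrightarrow>
             \<psi> V \<in> ring_iso (sections Y V) (sections X (pre V)) \<and>
             (\<forall>a. \<psi> V (scalar Y V a) = scalar X (pre V) a)) \<and>
          (\<forall>V W. openin (space Y) V \<longrightarrow> openin (space Y) W \<longrightarrow> W \<subseteq> V \<longrightarrow>
             (\<forall>s \<in> carrier (sections Y V).
                \<psi> W (restr Y W s) = restr X (pre W) (\<psi> V s)))))"

definition affine_space :: "'v set \<Rightarrow>
    (('v, 'k::field) mpoly set, ('v, 'k) mpoly set \<Rightarrow> (('v, 'k) mpoly \<times> ('v, 'k) mpoly) set, 'k) k_scheme"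
  where "affine_space V = Spec Const (poly_ring V)"

text \<open>The closed immersion of the spectrum of \<open>A\<close> modulo \<open>I\<close> into the spectrum of \<open>A\<close>,
  on points.\<close>

definition closed_immersion :: "('a, 'm) ring_scheme \<Rightarrow> 'a set \<Rightarrow> 'a set set \<Rightarrow> 'a set" where
  "closed_immersion A I q = {a \<in> carrier A. I +>\<^bsub>A\<^esub> a \<in> q}"

text \<open>The localization at \<open>p\<close> is the local ring of the spectrum of \<open>A\<close> at the point \<open>p\<close>.\<close>

definition smooth_point :: "('a, 'm) ring_scheme \<Rightarrow> 'a set \<Rightarrow> bool" where
  "smooth_point A p \<longleftrightarrow> p \<in> prime_spectrum A \<and> regular_local_ring (localization A p)"

text \<open>\<open>Var (i, j)\<close> is the indeterminate \<open>c\<^sub>i\<^sub>j\<close> attached to \<open>t\<^sub>i\<close> and \<open>b\<^sub>j\<close>.\<close>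

definition c_index :: "mon list \<Rightarrow> mon list \<Rightarrow> (nat \<times> nat) set" where
  "c_index ts bs = {..<length ts} \<times> {..<length bs}"

definition generic_mult_mat ::
    "mon list \<Rightarrow> mon list \<Rightarrow> nat \<Rightarrow> (nat \<times> nat, 'k::field) mpoly mat" where
  "generic_mult_mat ts bs k = mat (length ts) (length ts) (\<lambda>(i, j).
     let t = ind k + ts ! j in
     if t \<in> set ts then (if ts ! i = t then 1 else 0)
     else Var (i, THE m. m < length bs \<and> bs ! m = t))"

definition border_ideal ::
    "nat \<Rightarrow> mon list \<Rightarrow> mon list \<Rightarrow> (nat \<times> nat, 'k::field) mpoly set" where
  "border_ideal n ts bs = Idl\<^bsub>poly_ring (c_index ts bs)\<^esub>
     {(generic_mult_mat ts bs k * generic_mult_mat ts bs l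
        - generic_mult_mat ts bs l * generic_mult_mat ts bs k) $$ (i, j) | i j k l.
      i < length ts \<and> j < length ts \<and> k < l \<and> l < n}"

definition S_all :: "mon list \<Rightarrow> mon list \<Rightarrow> mon rel \<Rightarrow> (nat \<times> nat) set" where
  "S_all ts bs \<sigma> = {(i, j) \<in> c_index ts bs. (ts ! i, bs ! j) \<in> \<sigma> \<and> ts ! i \<noteq> bs ! j}"

definition S_corners :: "mon list \<Rightarrow> mon list \<Rightarrow> nat \<Rightarrow> mon rel \<Rightarrow> (nat \<times> nat) set" where
  "S_corners ts bs \<eta> \<sigma> = {(i, j) \<in> S_all ts bs \<sigma>. j < \<eta>}"

definition L_ideal ::
    "mon list \<Rightarrow> mon list \<Rightarrow> mon rel \<Rightarrow> (nat \<times> nat, 'k::field) mpoly set" where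
  "L_ideal ts bs \<sigma> = Idl\<^bsub>poly_ring (c_index ts bs)\<^esub> (Var ` (c_index ts bs - S_all ts bs \<sigma>))"

definition groebner_ideal ::
    "nat \<Rightarrow> mon list \<Rightarrow> mon list \<Rightarrow> nat \<Rightarrow> mon rel \<Rightarrow> (nat \<times> nat, 'k::field) mpoly set" where
  "groebner_ideal n ts bs \<eta> \<sigma> =
     (L_ideal ts bs \<sigma> <+>\<^bsub>poly_ring (c_index ts bs)\<^esub> border_ideal n ts bs)
       \<inter> carrier (poly_ring (S_corners ts bs \<eta> \<sigma>))"

definition groebner_ring ::
    "nat \<Rightarrow> mon list \<Rightarrow> mon list \<Rightarrow> nat \<Rightarrow> mon rel \<Rightarrow> (nat \<times> nat, 'k::field) mpoly set ring" where
  "groebner_ring n ts bs \<eta> \<sigma> =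
     poly_ring (S_corners ts bs \<eta> \<sigma>) Quot groebner_ideal n ts bs \<eta> \<sigma>"

definition groebner_scheme ::
    "nat \<Rightarrow> mon list \<Rightarrow> mon list \<Rightarrow> nat \<Rightarrow> mon rel \<Rightarrow>
      ((nat \<times> nat, 'k::field) mpoly set set,
       (nat \<times> nat, 'k) mpoly set set \<Rightarrow> ((nat \<times> nat, 'k) mpoly set \<times> (nat \<times> nat, 'k) mpoly set) set,
       'k) k_scheme" where
  "groebner_scheme n ts bs \<eta> \<sigma> =
     Spec (\<lambda>a. groebner_ideal n ts bs \<eta> \<sigma> +>\<^bsub>poly_ring (S_corners ts bs \<eta> \<sigma>)\<^esub> Const a)
       (groebner_ring n ts bs \<eta> \<sigma>)"

definition groebner_immersion ::
    "nat \<Rightarrow> mon list \<Rightarrow> mon list \<Rightarrow> nat \<Rightarrow> mon rel \<Rightarrow>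
      (nat \<times> nat, 'k::field) mpoly set set \<Rightarrow> (nat \<times> nat, 'k) mpoly set" where
  "groebner_immersion n ts bs \<eta> \<sigma> =
     closed_immersion (poly_ring (S_corners ts bs \<eta> \<sigma>)) (groebner_ideal n ts bs \<eta> \<sigma>)"

end

theory Submission
  imports Defs
begin

text \<open>
  Let \<open>P\<close> be the polynomial ring over \<open>K\<close> in the indeterminates of \<open>S_corners\<close>, let \<open>I\<close> be
  the Groebner ideal, \<open>A = P/I\<close>, and let \<open>m\<close> be the ideal of the origin.

  Everything rests on a grading in which \<open>I\<close> is homogeneous and all indeterminates are
  positive. Give \<open>c\<^sub>i\<^sub>j\<close> the degree \<open>b\<^sub>j - t\<^sub>i\<close> in the group of integer exponent vectors. The
  entry \<open>(i, j)\<close> of the \<open>k\<close>-th multiplication matrix then has the degree of \<open>x\<^sub>k t\<^sub>j / t\<^sub>i\<close>,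
  so the entries of the commutators are homogeneous (\<open>homogeneous_commutator_entry\<close>). For the
  indeterminates of \<open>S_corners\<close> the degree lies in the cone of \<open>\<sigma>\<close>-positive vectors, which is
  closed under addition and misses 0 (\<open>positive_cone_add\<close>), as positive numbers would.
  If all \<open>c\<^sub>i\<^sub>j\<close> vanish, the matrices describe multiplication modulo a monomial ideal and
  commute (\<open>lookup_commutator_entry_0\<close>). Hence \<open>I \<subseteq> m\<close>, which is part a).

  Suppose that the local ring at the origin is regular of dimension \<open>d\<close>. Its maximal ideal has
  \<open>d\<close> generators, so \<open>m/(m\<^sup>2 + I)\<close> is spanned by \<open>d\<close> vectors, and a set \<open>D\<close> of at most \<open>d\<close>
  indeterminates is a basis of it (\<open>cotangent_space_spanned\<close>, \<open>linear_parts_basis\<close>). By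
  induction along the grading, as in the graded Nakayama lemma, \<open>D\<close> generates \<open>A\<close> as an
  algebra (\<open>graded_generation\<close>). Thus \<open>K[D] \<rightarrow> A\<close> is onto. A chain of \<open>d + 1\<close> prime ideals of
  \<open>A\<close> pulls back to \<open>K[D]\<close>; if the kernel were not zero, the zero ideal would prolong it,
  against the bound on the dimension of \<open>K[D]\<close> (\<open>prime_chain_poly_ring_le\<close>). So \<open>A\<close> is a
  polynomial ring, and isomorphic rings have isomorphic spectra (\<open>isomorphic_Spec\<close>).

  Conversely, an isomorphism of schemes induces an isomorphism of the rings of global
  sections, which are \<open>A\<close> and a polynomial ring (\<open>global_section_iso\<close>). The origin becomes a
  point \<open>a\<close> with coordinates in \<open>K\<close>. The differences \<open>Y\<^sub>i - a\<^sub>i\<close> generate its ideal, the ideals of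
  the subspaces \<open>Y\<^sub>0 = a\<^sub>0, \<dots>, Y\<^sub>i = a\<^sub>i\<close> form a chain of the right length, and polynomial rings
  are Noetherian of the expected dimension (\<open>regular_at_rational_point\<close>).
\<close>

section \<open>Localization at a prime ideal\<close>

text \<open>The operations of \<open>localization\<close> are unions over all representatives of the two classes; such
  a union collapses once the result does not depend on the representatives.\<close>

lemma UN_pair_const:
  assumes "x \<in> X" "y \<in> Y" "\<And>a s b t. (a, s) \<in> X \<Longrightarrow> (b, t) \<in> Y \<Longrightarrow> f a s b t = c"
  shows "(\<Union>(a, s)\<in>X. \<Union>(b, t)\<in>Y. f a s b t) = c"
proof -
  have "(\<Union>(b, t)\<in>Y. f a s b t) = c" if "(a, s) \<in> X" for a s
    using assms(2,3) that by (auto split: prod.splits)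
  then have "(case z of (a, s) \<Rightarrow> \<Union>(b, t)\<in>Y. f a s b t) = c" if "z \<in> X" for z
    using that by (cases z) simp
  then show ?thesis using assms(1) by auto
qed

context primeideal
begin

abbreviation Loc :: "('a \<times> 'a) set ring" where
  "Loc \<equiv> localization R I"

lemma compl_closed: "s \<in> carrier R - I \<Longrightarrow> t \<in> carrier R - I \<Longrightarrow> s \<otimes> t \<in> carrier R - I"
  using I_prime by auto

lemma one_compl: "\<one> \<in> carrier R - I"
  using I_notcarr one_imp_carrier by auto

lemma self_in_frac:
  assumes "a \<in> carrier R" "s \<in> carrier R - I"
  shows "(a, s) \<in> frac R I a s"
  using assms one_compl by (auto simp: frac_def)

text \<open>Transitivity of the equality of fractions: the two factors that witness the given equalities,
  multiplied by the denominator in the middle, witness the new one.\<close>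

lemma in_frac_eq:
  assumes a: "a \<in> carrier R" and s: "s \<in> carrier R - I" and m: "(b, t) \<in> frac R I a s"
  shows "frac R I b t = frac R I a s"
proof -
  obtain u where b: "b \<in> carrier R" and t: "t \<in> carrier R - I"
    and u: "u \<in> carrier R - I" "u \<otimes> (a \<otimes> t) = u \<otimes> (b \<otimes> s)"
    using m by (auto simp: frac_def)
  have "(c, r) \<in> frac R I b t \<longleftrightarrow> (c, r) \<in> frac R I a s" if c: "c \<in> carrier R" and r: "r \<in> carrier R - I" for c r
  proof
    assume "(c, r) \<in> frac R I b t"
    then obtain v where v: "v \<in> carrier R - I" "v \<otimes> (b \<otimes> r) = v \<otimes> (c \<otimes> t)"
      by (auto simp: frac_def)
    have "(u \<otimes> v \<otimes> t) \<otimes> (a \<otimes> r) = v \<otimes> r \<otimes> (u \<otimes> (a \<otimes> t))"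
      using a b c s t r u(1) v(1) by (simp add: m_ac)
    also have "\<dots> = u \<otimes> s \<otimes> (v \<otimes> (b \<otimes> r))"
      unfolding u(2) using a b c s t r u(1) v(1) by (simp add: m_ac)
    also have "\<dots> = (u \<otimes> v \<otimes> t) \<otimes> (c \<otimes> s)"
      unfolding v(2) using a b c s t r u(1) v(1) by (simp add: m_ac)
    finally show "(c, r) \<in> frac R I a s"
      using c r compl_closed[OF compl_closed[OF u(1) v(1)] t] by (auto simp: frac_def)
  next
    assume "(c, r) \<in> frac R I a s"
    then obtain v where v: "v \<in> carrier R - I" "v \<otimes> (a \<otimes> r) = v \<otimes> (c \<otimes> s)"
      by (auto simp: frac_def)
    have "(u \<otimes> v \<otimes> s) \<otimes> (b \<otimes> r) = v \<otimes> r \<otimes> (u \<otimes> (b \<otimes> s))"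
      using a b c s t r u(1) v(1) by (simp add: m_ac)
    also have "\<dots> = u \<otimes> t \<otimes> (v \<otimes> (a \<otimes> r))"
      unfolding u(2)[symmetric] using a b c s t r u(1) v(1) by (simp add: m_ac)
    also have "\<dots> = (u \<otimes> v \<otimes> s) \<otimes> (c \<otimes> t)"
      unfolding v(2) using a b c s t r u(1) v(1) by (simp add: m_ac)
    finally show "(c, r) \<in> frac R I b t"
      using c r compl_closed[OF compl_closed[OF u(1) v(1)] s] by (auto simp: frac_def)
  qed
  then show ?thesis by (auto simp: frac_def)
qed

lemma frac_eq_iff:
  assumes "a \<in> carrier R" "s \<in> carrier R - I" "b \<in> carrier R" "t \<in> carrier R - I"
  shows "frac R I a s = frac R I b t \<longleftrightarrow> (\<exists>u \<in> carrier R - I. u \<otimes> (a \<otimes> t) = u \<otimes> (b \<otimes> s))"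
proof
  assume "frac R I a s = frac R I b t"
  then have "(b, t) \<in> frac R I a s" using self_in_frac assms by blast
  then show "\<exists>u \<in> carrier R - I. u \<otimes> (a \<otimes> t) = u \<otimes> (b \<otimes> s)" by (simp add: frac_def)
next
  assume "\<exists>u \<in> carrier R - I. u \<otimes> (a \<otimes> t) = u \<otimes> (b \<otimes> s)"
  then have "(b, t) \<in> frac R I a s" using assms by (simp add: frac_def)
  then show "frac R I a s = frac R I b t" using in_frac_eq assms by blast
qed

lemma frac_eqI:
  assumes "a \<in> carrier R" "s \<in> carrier R - I" "b \<in> carrier R" "t \<in> carrier R - I"
    and "a \<otimes> t = b \<otimes> s"
  shows "frac R I a s = frac R I b t"
  using assms one_compl by (subst frac_eq_iff) auto

lemma frac_cancel:
  assumes "a \<in> carrier R" "s \<in> carrier R - I" "t \<in> carrier R - I"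
  shows "frac R I (a \<otimes> t) (s \<otimes> t) = frac R I a s"
  using assms compl_closed by (intro frac_eqI) (auto simp: m_ac)

lemma frac_carrier:
  assumes "a \<in> carrier R" "s \<in> carrier R - I"
  shows "frac R I a s \<in> carrier Loc"
  using assms by (auto simp: localization_def)

lemma localization_cases:
  assumes "x \<in> carrier Loc"
  obtains a s where "a \<in> carrier R" "s \<in> carrier R - I" "x = frac R I a s"
  using assms by (auto simp: localization_def)

lemma in_frac_carrier: "(b, t) \<in> frac R I a s \<Longrightarrow> b \<in> carrier R \<and> t \<in> carrier R - I"
  by (auto simp: frac_def)

text \<open>Here and for the sum, the product of the two factors that relate the representatives relates
  the results.\<close>

lemma mult_frac:
  assumes a: "a \<in> carrier R" "s \<in> carrier R - I" and b: "b \<in> carrier R" "t \<in> carrier R - I"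
  shows "frac R I a s \<otimes>\<^bsub>Loc\<^esub> frac R I b t = frac R I (a \<otimes> b) (s \<otimes> t)"
proof -
  have *: "frac R I (a' \<otimes> b') (s' \<otimes> t') = frac R I (a \<otimes> b) (s \<otimes> t)"
    if 1: "(a', s') \<in> frac R I a s" and 2: "(b', t') \<in> frac R I b t" for a' s' b' t'
  proof -
    have c: "a' \<in> carrier R" "s' \<in> carrier R - I" "b' \<in> carrier R" "t' \<in> carrier R - I"
      using in_frac_carrier 1 2 by auto
    obtain u v where u: "u \<in> carrier R - I" "u \<otimes> (a \<otimes> s') = u \<otimes> (a' \<otimes> s)"
      and v: "v \<in> carrier R - I" "v \<otimes> (b \<otimes> t') = v \<otimes> (b' \<otimes> t)"
      using 1 2 by (auto simp: frac_def)
    have "(u \<otimes> v) \<otimes> ((a' \<otimes> b') \<otimes> (s \<otimes> t)) = (u \<otimes> (a' \<otimes> s)) \<otimes> (v \<otimes> (b' \<otimes> t))"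
      using a b c u(1) v(1) by (simp add: m_ac)
    also have "\<dots> = (u \<otimes> v) \<otimes> ((a \<otimes> b) \<otimes> (s' \<otimes> t'))"
      unfolding u(2)[symmetric] v(2)[symmetric] using a b c u(1) v(1) by (simp add: m_ac)
    finally show ?thesis
      using a b c compl_closed u(1) v(1) by (subst frac_eq_iff) auto
  qed
  have "frac R I a s \<otimes>\<^bsub>Loc\<^esub> frac R I b t =
    (\<Union>(a, s)\<in>frac R I a s. \<Union>(b, t)\<in>frac R I b t. frac R I (a \<otimes> b) (s \<otimes> t))"
    by (simp add: localization_def)
  also have "\<dots> = frac R I (a \<otimes> b) (s \<otimes> t)"
    by (rule UN_pair_const[OF self_in_frac[OF a] self_in_frac[OF b]]) (rule *)
  finally show ?thesis .
qed

lemma add_frac: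
  assumes a: "a \<in> carrier R" "s \<in> carrier R - I" and b: "b \<in> carrier R" "t \<in> carrier R - I"
  shows "frac R I a s \<oplus>\<^bsub>Loc\<^esub> frac R I b t = frac R I (a \<otimes> t \<oplus> b \<otimes> s) (s \<otimes> t)"
proof -
  have *: "frac R I (a' \<otimes> t' \<oplus> b' \<otimes> s') (s' \<otimes> t') = frac R I (a \<otimes> t \<oplus> b \<otimes> s) (s \<otimes> t)"
    if 1: "(a', s') \<in> frac R I a s" and 2: "(b', t') \<in> frac R I b t" for a' s' b' t'
  proof -
    have c: "a' \<in> carrier R" "s' \<in> carrier R - I" "b' \<in> carrier R" "t' \<in> carrier R - I"
      using in_frac_carrier 1 2 by auto
    obtain u v where u: "u \<in> carrier R - I" "u \<otimes> (a \<otimes> s') = u \<otimes> (a' \<otimes> s)"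
      and v: "v \<in> carrier R - I" "v \<otimes> (b \<otimes> t') = v \<otimes> (b' \<otimes> t)"
      using 1 2 by (auto simp: frac_def)
    have "(u \<otimes> v) \<otimes> ((a' \<otimes> t' \<oplus> b' \<otimes> s') \<otimes> (s \<otimes> t)) =
        (u \<otimes> (a' \<otimes> s)) \<otimes> (v \<otimes> t' \<otimes> t) \<oplus> (v \<otimes> (b' \<otimes> t)) \<otimes> (u \<otimes> s' \<otimes> s)"
      using a b c u(1) v(1) by (simp add: m_ac r_distr l_distr)
    also have "\<dots> = (u \<otimes> v) \<otimes> ((a \<otimes> t \<oplus> b \<otimes> s) \<otimes> (s' \<otimes> t'))"
      unfolding u(2)[symmetric] v(2)[symmetric] using a b c u(1) v(1)
      by (simp add: m_ac r_distr l_distr)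
    finally show ?thesis
      using a b c compl_closed u(1) v(1) by (subst frac_eq_iff) auto
  qed
  have "frac R I a s \<oplus>\<^bsub>Loc\<^esub> frac R I b t =
    (\<Union>(a, s)\<in>frac R I a s. \<Union>(b, t)\<in>frac R I b t. frac R I (a \<otimes> t \<oplus> b \<otimes> s) (s \<otimes> t))"
    by (simp add: localization_def)
  also have "\<dots> = frac R I (a \<otimes> t \<oplus> b \<otimes> s) (s \<otimes> t)"
    by (rule UN_pair_const[OF self_in_frac[OF a] self_in_frac[OF b]]) (rule *)
  finally show ?thesis .
qed

lemma one_localization: "\<one>\<^bsub>Loc\<^esub> = frac R I \<one> \<one>"
  and zero_localization: "\<zero>\<^bsub>Loc\<^esub> = frac R I \<zero> \<one>"
  by (simp_all add: localization_def)

lemma neg_frac: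
  assumes a: "a \<in> carrier R" "s \<in> carrier R - I"
  shows "frac R I (\<ominus> a) s \<oplus>\<^bsub>Loc\<^esub> frac R I a s = \<zero>\<^bsub>Loc\<^esub>"
proof -
  have "frac R I (\<ominus> a \<otimes> s \<oplus> a \<otimes> s) (s \<otimes> s) = frac R I \<zero> \<one>"
    using a compl_closed[OF a(2) a(2)] one_compl by (intro frac_eqI) (auto simp: l_minus l_neg)
  then show ?thesis using a by (simp add: add_frac zero_localization)
qed

lemma cring_localization: "cring Loc"
proof (rule cringI)
  show "abelian_group Loc"
  proof (rule abelian_groupI)
    fix x y assume "x \<in> carrier Loc" "y \<in> carrier Loc"
    then show "x \<oplus>\<^bsub>Loc\<^esub> y \<in> carrier Loc"
      by (elim localization_cases) (use compl_closed in \<open>auto simp: add_frac intro!: frac_carrier\<close>)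
  next
    show "\<zero>\<^bsub>Loc\<^esub> \<in> carrier Loc"
      using one_compl by (auto simp: zero_localization intro!: frac_carrier)
  next
    fix x y z
    assume "x \<in> carrier Loc" "y \<in> carrier Loc"
      "z \<in> carrier Loc"
    then obtain a s b t c u where
      c: "a \<in> carrier R" "s \<in> carrier R - I" "b \<in> carrier R" "t \<in> carrier R - I"
      "c \<in> carrier R" "u \<in> carrier R - I" and
      e: "x = frac R I a s" "y = frac R I b t" "z = frac R I c u"
      by (metis localization_cases)
    have c': "s \<otimes> t \<in> carrier R - I" "t \<otimes> u \<in> carrier R - I" "s \<otimes> (t \<otimes> u) \<in> carrier R - I"
      "s \<otimes> t \<otimes> u \<in> carrier R - I"
      using c compl_closed by auto
    show "x \<oplus>\<^bsub>Loc\<^esub> y \<oplus>\<^bsub>Loc\<^esub> z =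
      x \<oplus>\<^bsub>Loc\<^esub> (y \<oplus>\<^bsub>Loc\<^esub> z)"
      unfolding e using c c' by (simp add: add_frac m_ac r_distr l_distr a_ac)
  next
    fix x y assume "x \<in> carrier Loc" "y \<in> carrier Loc"
    then obtain a s b t where
      c: "a \<in> carrier R" "s \<in> carrier R - I" "b \<in> carrier R" "t \<in> carrier R - I" and
      e: "x = frac R I a s" "y = frac R I b t"
      by (metis localization_cases)
    show "x \<oplus>\<^bsub>Loc\<^esub> y = y \<oplus>\<^bsub>Loc\<^esub> x"
      unfolding e using c by (simp add: add_frac m_ac a_ac)
  next
    fix x assume "x \<in> carrier Loc"
    then obtain a s where c: "a \<in> carrier R" "s \<in> carrier R - I" and e: "x = frac R I a s"
      by (metis localization_cases)
    show "\<zero>\<^bsub>Loc\<^esub> \<oplus>\<^bsub>Loc\<^esub> x = x"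
      unfolding e zero_localization using c one_compl by (simp add: add_frac)
    have "frac R I (\<ominus> a) s \<oplus>\<^bsub>Loc\<^esub> x = frac R I \<zero> \<one>"
      unfolding e zero_localization[symmetric] by (rule neg_frac[OF c])
    then show "\<exists>y\<in>carrier Loc. y \<oplus>\<^bsub>Loc\<^esub> x = \<zero>\<^bsub>Loc\<^esub>"
      unfolding zero_localization by (rule bexI) (use c in \<open>auto intro: frac_carrier\<close>)
  qed
next
  show "Group.comm_monoid Loc"
  proof (rule comm_monoidI)
    fix x y assume "x \<in> carrier Loc" "y \<in> carrier Loc"
    then obtain a s b t where
      c: "a \<in> carrier R" "s \<in> carrier R - I" "b \<in> carrier R" "t \<in> carrier R - I" and
      e: "x = frac R I a s" "y = frac R I b t"
      by (metis localization_cases)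
    show "x \<otimes>\<^bsub>Loc\<^esub> y \<in> carrier Loc"
      unfolding e using c compl_closed by (auto simp: mult_frac intro!: frac_carrier)
    show "x \<otimes>\<^bsub>Loc\<^esub> y = y \<otimes>\<^bsub>Loc\<^esub> x"
      unfolding e using c by (simp add: mult_frac m_ac)
  next
    show "\<one>\<^bsub>Loc\<^esub> \<in> carrier Loc"
      using one_compl by (auto simp: one_localization intro!: frac_carrier)
  next
    fix x y z
    assume "x \<in> carrier Loc" "y \<in> carrier Loc"
      "z \<in> carrier Loc"
    then obtain a s b t c u where
      c: "a \<in> carrier R" "s \<in> carrier R - I" "b \<in> carrier R" "t \<in> carrier R - I"
      "c \<in> carrier R" "u \<in> carrier R - I" and
      e: "x = frac R I a s" "y = frac R I b t" "z = frac R I c u"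
      by (metis localization_cases)
    have c': "s \<otimes> t \<in> carrier R - I" "t \<otimes> u \<in> carrier R - I"
      using c compl_closed by auto
    show "x \<otimes>\<^bsub>Loc\<^esub> y \<otimes>\<^bsub>Loc\<^esub> z =
      x \<otimes>\<^bsub>Loc\<^esub> (y \<otimes>\<^bsub>Loc\<^esub> z)"
      unfolding e using c c' by (simp add: mult_frac m_ac)
  next
    fix x assume "x \<in> carrier Loc"
    then obtain a s where c: "a \<in> carrier R" "s \<in> carrier R - I" and e: "x = frac R I a s"
      by (metis localization_cases)
    show "\<one>\<^bsub>Loc\<^esub> \<otimes>\<^bsub>Loc\<^esub> x = x"
      unfolding e one_localization using c one_compl by (simp add: mult_frac)
  qed
next
  fix x y z
  assume "x \<in> carrier Loc" "y \<in> carrier Loc"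
    "z \<in> carrier Loc"
  then obtain a s b t c u where
    c: "a \<in> carrier R" "s \<in> carrier R - I" "b \<in> carrier R" "t \<in> carrier R - I"
    "c \<in> carrier R" "u \<in> carrier R - I" and
    e: "x = frac R I a s" "y = frac R I b t" "z = frac R I c u"
    by (metis localization_cases)
  have c': "s \<otimes> t \<in> carrier R - I" "s \<otimes> u \<in> carrier R - I" "t \<otimes> u \<in> carrier R - I"
    using c compl_closed by auto
  then have c'': "s \<otimes> u \<otimes> (t \<otimes> u) \<in> carrier R - I" "s \<otimes> t \<otimes> u \<in> carrier R - I"
    using c compl_closed by auto
  have "frac R I ((a \<otimes> t \<oplus> b \<otimes> s) \<otimes> c) (s \<otimes> t \<otimes> u) =
     frac R I ((a \<otimes> c) \<otimes> (t \<otimes> u) \<oplus> (b \<otimes> c) \<otimes> (s \<otimes> u)) (s \<otimes> u \<otimes> (t \<otimes> u))"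
    using c c' c'' by (intro frac_eqI) (auto simp: m_ac r_distr l_distr)
  then show "(x \<oplus>\<^bsub>Loc\<^esub> y) \<otimes>\<^bsub>Loc\<^esub> z =
    x \<otimes>\<^bsub>Loc\<^esub> z \<oplus>\<^bsub>Loc\<^esub> y \<otimes>\<^bsub>Loc\<^esub> z"
    unfolding e using c c' by (simp add: mult_frac add_frac)
qed

lemma frac_hom: "(\<lambda>a. frac R I a \<one>) \<in> Ring.ring_hom R Loc"
  using one_compl
  by (intro ring_hom_memI) (auto simp: mult_frac add_frac one_localization intro!: frac_carrier)


text \<open>Extension and contraction of ideals along \<open>a \<mapsto> a/1\<close>. Finitely many fractions have a common
  denominator, so for an ideal \<open>Q\<close> the fractions with numerator in \<open>Q\<close> already form an ideal.\<close>

definition loc_ideal :: "'a set \<Rightarrow> ('a \<times> 'a) set set" where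
  "loc_ideal Q = {frac R I a s | a s. a \<in> Q \<and> s \<in> carrier R - I}"

definition contr :: "('a \<times> 'a) set set \<Rightarrow> 'a set" where
  "contr J = {a \<in> carrier R. frac R I a \<one> \<in> J}"

lemma ideal_loc_ideal:
  assumes Q: "ideal Q R"
  shows "ideal (loc_ideal Q) Loc"
proof -
  interpret Q: ideal Q R by fact
  interpret L: cring Loc by (rule cring_localization)
  have Qc: "a \<in> carrier R" if "a \<in> Q" for a using that Q.Icarr by blast
  show ?thesis
  proof (rule idealI)
    show "ring Loc" ..
    show "subgroup (loc_ideal Q) (add_monoid Loc)"
    proof (rule group.subgroupI)
      show "Group.group (add_monoid Loc)" by (rule L.a_group)
      show "loc_ideal Q \<subseteq> carrier (add_monoid Loc)"
        using Qc frac_carrier by (auto simp: loc_ideal_def)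
      show "loc_ideal Q \<noteq> {}"
        using one_compl Q.zero_closed unfolding loc_ideal_def by blast
    next
      fix x assume "x \<in> loc_ideal Q"
      then obtain a s where a: "a \<in> Q" "s \<in> carrier R - I" "x = frac R I a s"
        by (auto simp: loc_ideal_def)
      have "frac R I (\<ominus> a) s \<oplus>\<^bsub>Loc\<^esub> x = \<zero>\<^bsub>Loc\<^esub>"
        unfolding a(3) by (rule neg_frac[OF Qc[OF a(1)] a(2)])
      then have "\<ominus>\<^bsub>Loc\<^esub> x = frac R I (\<ominus> a) s"
        using a Qc frac_carrier by (intro L.minus_equality) auto
      then show "inv\<^bsub>add_monoid Loc\<^esub> x \<in> loc_ideal Q"
        using a Q.a_inv_closed by (auto simp: a_inv_def loc_ideal_def)
    next
      fix x y assume "x \<in> loc_ideal Q" "y \<in> loc_ideal Q"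
      then obtain a s b t where "a \<in> Q" "s \<in> carrier R - I" "x = frac R I a s"
        "b \<in> Q" "t \<in> carrier R - I" "y = frac R I b t"
        by (auto simp: loc_ideal_def)
      then show "x \<otimes>\<^bsub>add_monoid Loc\<^esub> y \<in> loc_ideal Q"
        using Qc compl_closed
        by (auto simp: loc_ideal_def add_frac intro!: exI Q.a_closed Q.I_r_closed)
    qed
  next
    fix x y assume "x \<in> loc_ideal Q" "y \<in> carrier Loc"
    then obtain a s b t where *: "a \<in> Q" "s \<in> carrier R - I" "x = frac R I a s"
      "b \<in> carrier R" "t \<in> carrier R - I" "y = frac R I b t"
      by (auto simp: loc_ideal_def elim!: localization_cases)
    then show "x \<otimes>\<^bsub>Loc\<^esub> y \<in> loc_ideal Q"
      using Qc compl_closed by (auto simp: loc_ideal_def mult_frac intro!: exI Q.I_r_closed)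
    then show "y \<otimes>\<^bsub>Loc\<^esub> x \<in> loc_ideal Q"
      using * Qc compl_closed frac_carrier by (simp add: L.m_comm)
  qed
qed

text \<open>Denominators are units of the localization.\<close>

lemma frac_in_ideal_iff:
  assumes J: "ideal J Loc" and a: "a \<in> carrier R" "s \<in> carrier R - I"
  shows "frac R I a s \<in> J \<longleftrightarrow> a \<in> contr J"
proof -
  interpret J: ideal J Loc by fact
  have 1: "frac R I a s = frac R I a \<one> \<otimes>\<^bsub>Loc\<^esub> frac R I \<one> s"
    using a one_compl by (simp add: mult_frac)
  have 2: "frac R I a \<one> = frac R I a s \<otimes>\<^bsub>Loc\<^esub> frac R I s \<one>"
    using frac_cancel[OF a(1) one_compl a(2)] a one_compl by (simp add: mult_frac)
  have "frac R I \<one> s \<in> carrier Loc" "frac R I s \<one> \<in> carrier Loc"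
    using a one_compl by (auto intro: frac_carrier)
  then have "frac R I a \<one> \<in> J \<Longrightarrow> frac R I a s \<in> J" "frac R I a s \<in> J \<Longrightarrow> frac R I a \<one> \<in> J"
    using J.I_r_closed 1 2 by metis+
  then show ?thesis using a by (auto simp: contr_def)
qed

lemma loc_ideal_contr:
  assumes J: "ideal J Loc"
  shows "loc_ideal (contr J) = J"
proof -
  interpret J: ideal J Loc by fact
  show ?thesis
  proof
    show "loc_ideal (contr J) \<subseteq> J"
      using frac_in_ideal_iff[OF J] by (auto simp: loc_ideal_def contr_def)
    show "J \<subseteq> loc_ideal (contr J)"
    proof
      fix x assume x: "x \<in> J"
      then obtain a s where "a \<in> carrier R" "s \<in> carrier R - I" "x = frac R I a s"
        using J.Icarr localization_cases by metis
      then show "x \<in> loc_ideal (contr J)"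
        using frac_in_ideal_iff[OF J] x by (auto simp: loc_ideal_def)
    qed
  qed
qed

lemma ideal_contr:
  assumes J: "ideal J Loc"
  shows "ideal (contr J) R"
proof -
  interpret L: cring Loc by (rule cring_localization)
  interpret h: ring_hom_ring R Loc "\<lambda>a. frac R I a \<one>"
    using frac_hom by (intro ring_hom_ringI2) (auto simp: ring_axioms L.ring_axioms)
  show ?thesis unfolding contr_def by (rule h.ideal_vimage[OF J])
qed

text \<open>A prime ideal inside \<open>I\<close> contains no denominator, so the denominators can be cancelled.\<close>

lemma contr_loc_ideal:
  assumes Q: "primeideal Q R" "Q \<subseteq> I"
  shows "contr (loc_ideal Q) = Q"
proof -
  interpret Q: primeideal Q R by fact
  have "a \<in> Q" if a: "a \<in> carrier R" "frac R I a \<one> \<in> loc_ideal Q" for a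
  proof -
    obtain b s where b: "b \<in> Q" "s \<in> carrier R - I" "frac R I a \<one> = frac R I b s"
      using a by (auto simp: loc_ideal_def)
    then obtain u where u: "u \<in> carrier R - I" "u \<otimes> (a \<otimes> s) = u \<otimes> (b \<otimes> \<one>)"
      using a one_compl Q.Icarr by (auto simp: frac_eq_iff)
    have "u \<otimes> (a \<otimes> s) \<in> Q" unfolding u(2) using b u Q.Icarr by (auto intro!: Q.I_l_closed)
    then have "u \<otimes> s \<otimes> a \<in> Q" using a b u by (simp add: m_ac)
    then show "a \<in> Q" using a b u Q.I_prime[of "u \<otimes> s" a] compl_closed[of u s] Q(2) by blast
  qed
  then show ?thesis
    using Q.Icarr one_compl by (auto simp: contr_def loc_ideal_def)
qed

text \<open>An element outside \<open>I\<close> becomes a unit.\<close>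

lemma contr_proper:
  assumes J: "ideal J Loc" and "J \<noteq> carrier Loc"
  shows "contr J \<subseteq> I"
proof
  interpret J: ideal J Loc by fact
  fix a assume a: "a \<in> contr J"
  show "a \<in> I"
  proof (rule ccontr)
    assume "a \<notin> I"
    then have "frac R I a a \<in> J" using a frac_in_ideal_iff[OF J] by (auto simp: contr_def)
    moreover have "frac R I a a = \<one>\<^bsub>Loc\<^esub>"
      unfolding one_localization using a \<open>a \<notin> I\<close> one_compl by (intro frac_eqI) (auto simp: contr_def)
    ultimately show False using J.one_imp_carrier assms by auto
  qed
qed

lemma prime_contr:
  assumes P: "primeideal P Loc"
  shows "primeideal (contr P) R" "contr P \<subseteq> I"
proof -
  interpret P: primeideal P Loc by fact
  show I: "contr P \<subseteq> I" using contr_proper[OF P.is_ideal] P.I_notcarr by auto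
  show "primeideal (contr P) R"
  proof (rule primeidealI[OF ideal_contr[OF P.is_ideal] is_cring])
    show "carrier R \<noteq> contr P" using I one_compl by auto
    fix a b assume ab: "a \<in> carrier R" "b \<in> carrier R" "a \<otimes> b \<in> contr P"
    then have "frac R I a \<one> \<otimes>\<^bsub>Loc\<^esub> frac R I b \<one> \<in> P"
      using one_compl by (simp add: mult_frac contr_def)
    then show "a \<in> contr P \<or> b \<in> contr P"
      using P.I_prime ab one_compl frac_carrier by (auto simp: contr_def)
  qed
qed

lemma prime_loc_ideal:
  assumes Q: "primeideal Q R" "Q \<subseteq> I"
  shows "primeideal (loc_ideal Q) Loc"
proof -
  interpret Q: primeideal Q R by fact
  have J: "ideal (loc_ideal Q) Loc" by (rule ideal_loc_ideal[OF Q.is_ideal])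
  note iff = frac_in_ideal_iff[OF J, unfolded contr_loc_ideal[OF Q]]
  show ?thesis
  proof (rule primeidealI[OF J cring_localization])
    have "frac R I \<one> \<one> \<notin> loc_ideal Q" using iff one_compl Q.I_notcarr Q.one_imp_carrier by auto
    then show "carrier Loc \<noteq> loc_ideal Q" using frac_carrier one_compl by blast
  next
    fix x y assume x: "x \<in> carrier Loc" and y: "y \<in> carrier Loc"
      and xy: "x \<otimes>\<^bsub>Loc\<^esub> y \<in> loc_ideal Q"
    obtain a s b t where c: "a \<in> carrier R" "s \<in> carrier R - I" "b \<in> carrier R" "t \<in> carrier R - I" and
      e: "x = frac R I a s" "y = frac R I b t"
      using x y by (metis localization_cases)
    have "a \<otimes> b \<in> Q" using xy c compl_closed unfolding e by (simp add: mult_frac iff)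
    then show "x \<in> loc_ideal Q \<or> y \<in> loc_ideal Q"
      unfolding e using iff c Q.I_prime by auto
  qed
qed

text \<open>A proper ideal is the extension of its contraction, and the contraction lies in \<open>I\<close>.\<close>

lemma maximalideals_localization:
  "{J. maximalideal J Loc} = {loc_ideal I}"
proof -
  interpret L: cring Loc by (rule cring_localization)
  have I: "primeideal (loc_ideal I) Loc"
    by (rule prime_loc_ideal) (auto simp: primeideal)
  interpret M: primeideal "loc_ideal I" Loc by fact
  have below: "J \<subseteq> loc_ideal I" if "ideal J Loc" "J \<noteq> carrier Loc" for J
  proof -
    have "loc_ideal (contr J) \<subseteq> loc_ideal I"
      using contr_proper[OF that] by (auto simp: loc_ideal_def)
    then show ?thesis by (simp add: loc_ideal_contr that)
  qed
  have "maximalideal (loc_ideal I) Loc"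
  proof (rule maximalidealI)
    show "ideal (loc_ideal I) Loc" by (rule M.is_ideal)
    show "carrier Loc \<noteq> loc_ideal I" using M.I_notcarr by auto
    fix J assume "ideal J Loc" "loc_ideal I \<subseteq> J" "J \<subseteq> carrier Loc"
    then show "J = loc_ideal I \<or> J = carrier Loc" using below by auto
  qed
  moreover have "J = loc_ideal I" if J: "maximalideal J Loc" for J
  proof -
    interpret J: maximalideal J Loc by fact
    have "J \<subseteq> loc_ideal I" using below J.is_ideal J.I_notcarr by auto
    then show ?thesis
      using J.I_maximal[OF M.is_ideal] M.I_notcarr M.a_subset by auto
  qed
  ultimately show ?thesis by blast
qed

text \<open>Generators of the contraction of an ideal also generate the ideal, because it is the extension
  of its contraction.\<close>

lemma noetherian_localization:
  assumes "noetherian_ring R"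
  shows "noetherian_ring Loc"
proof -
  interpret N: noetherian_ring R by fact
  interpret L: cring Loc by (rule cring_localization)
  interpret h: ring_hom_ring R Loc "\<lambda>a. frac R I a \<one>"
    using frac_hom by (intro ring_hom_ringI2) (auto simp: ring_axioms L.ring_axioms)
  show ?thesis
  proof (rule L.noetherian_ringI)
    fix J assume J: "ideal J Loc"
    obtain F where F: "F \<subseteq> carrier R" "finite F" "contr J = Idl F"
      using N.finetely_gen[OF ideal_contr[OF J]] by auto
    let ?G = "(\<lambda>a. frac R I a \<one>) ` F"
    have G: "?G \<subseteq> carrier Loc" using F frac_carrier one_compl by auto
    have "F \<subseteq> contr J" using F genideal_self by simp
    then have "?G \<subseteq> J" by (auto simp: contr_def)
    then have 1: "Idl\<^bsub>Loc\<^esub> ?G \<subseteq> J" by (rule L.genideal_minimal[OF J])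
    let ?K = "Idl\<^bsub>Loc\<^esub> ?G"
    have K: "ideal ?K Loc" by (rule L.genideal_ideal[OF G])
    have "F \<subseteq> contr ?K" using F L.genideal_self[OF G] by (auto simp: contr_def)
    then have "contr J \<subseteq> contr ?K" unfolding F(3) by (rule genideal_minimal[OF ideal_contr[OF K]])
    then have "loc_ideal (contr J) \<subseteq> loc_ideal (contr ?K)" by (auto simp: loc_ideal_def)
    then have "J \<subseteq> ?K" using loc_ideal_contr[OF J] loc_ideal_contr[OF K] by simp
    with 1 G F(2) show "\<exists>A\<subseteq>carrier Loc. finite A \<and> J = Idl\<^bsub>Loc\<^esub> A"
      by blast
  qed
qed

end

section \<open>Regularity of localizations\<close>

text \<open>The length \<open>d\<close> counts the inclusions, so there are \<open>d + 1\<close> prime ideals; the values of \<open>P\<close>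
  beyond \<open>d\<close> are irrelevant.\<close>

definition prime_chain :: "('a, 'm) ring_scheme \<Rightarrow> nat \<Rightarrow> (nat \<Rightarrow> 'a set) \<Rightarrow> bool" where
  "prime_chain A d P \<longleftrightarrow> (\<forall>i\<le>d. primeideal (P i) A) \<and> (\<forall>i<d. P i \<subset> P (Suc i))"

lemma krull_dim_eqI:
  assumes "prime_chain A d P" "\<And>e Q. prime_chain A e Q \<Longrightarrow> e \<le> d"
  shows "krull_dim A = enat d"
proof -
  have "krull_dim A = Sup {enat e | e. \<exists>Q. prime_chain A e Q}"
    by (simp add: krull_dim_def prime_chain_def)
  also have "\<dots> = enat d"
    by (rule antisym) (use assms in \<open>auto intro!: Sup_least Sup_upper\<close>)
  finally show ?thesis .
qed

text \<open>A nonempty set of natural numbers with a finite supremum has a maximum. The prime ideal excludes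
  the empty set, whose supremum is 0 as well.\<close>

lemma krull_dim_attained:
  assumes "krull_dim A = enat d" "primeideal P A"
  obtains Q where "prime_chain A d Q"
proof -
  let ?S = "{enat e | e. \<exists>Q. prime_chain A e Q}"
  have "prime_chain A 0 (\<lambda>_. P)" using assms by (simp add: prime_chain_def)
  then have ne: "?S \<noteq> {}" by blast
  have eq: "Sup ?S = enat d"
    using assms(1) by (simp add: krull_dim_def prime_chain_def)
  then have "finite ?S" unfolding Sup_enat_def using ne by (metis (no_types, lifting) enat.distinct(1))
  then have "Max ?S \<in> ?S" "Sup ?S = Max ?S" using ne Max_in[of ?S] by (auto simp: Sup_enat_def)
  then have "Sup ?S \<in> ?S" by (simp only:)
  then show ?thesis using that unfolding eq by auto
qed

context primeideal
begin

lemma prime_chain_contr: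
  assumes "prime_chain Loc d P"
  shows "prime_chain R d (\<lambda>i. contr (P i))"
proof -
  have id: "ideal (P i) Loc" if "i \<le> d" for i
    using assms that by (auto simp: prime_chain_def primeideal_def)
  have "contr (P i) \<subset> contr (P (Suc i))" if "i < d" for i
  proof -
    have sub: "P i \<subset> P (Suc i)" using assms that by (auto simp: prime_chain_def)
    then have "contr (P i) \<subseteq> contr (P (Suc i))" by (auto simp: contr_def)
    moreover have "contr (P i) \<noteq> contr (P (Suc i))"
    proof
      assume eq: "contr (P i) = contr (P (Suc i))"
      have "P i = loc_ideal (contr (P i))" using that by (intro loc_ideal_contr[symmetric] id) simp
      also have "\<dots> = P (Suc i)" unfolding eq using that by (intro loc_ideal_contr id) simp
      finally have "P i = P (Suc i)" .
      then show False using sub by blast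
    qed
    ultimately show ?thesis by blast
  qed
  moreover have "primeideal (contr (P i)) R" if "i \<le> d" for i
    using assms that by (intro prime_contr(1)) (simp add: prime_chain_def)
  ultimately show ?thesis by (simp add: prime_chain_def)
qed

lemma prime_chain_loc_ideal:
  assumes "prime_chain R d P" "\<And>i. i \<le> d \<Longrightarrow> P i \<subseteq> I"
  shows "prime_chain Loc d (\<lambda>i. loc_ideal (P i))"
proof -
  have "loc_ideal (P i) \<subset> loc_ideal (P (Suc i))" if "i < d" for i
  proof -
    have sub: "P i \<subset> P (Suc i)" and pr: "primeideal (P i) R" "primeideal (P (Suc i)) R"
      using assms that by (auto simp: prime_chain_def)
    have "loc_ideal (P i) \<subseteq> loc_ideal (P (Suc i))" using sub by (auto simp: loc_ideal_def)
    moreover have "loc_ideal (P i) \<noteq> loc_ideal (P (Suc i))"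
    proof
      assume eq: "loc_ideal (P i) = loc_ideal (P (Suc i))"
      have "P i = contr (loc_ideal (P i))"
        using that by (intro contr_loc_ideal[symmetric] pr(1) assms(2)) simp
      also have "\<dots> = P (Suc i)" unfolding eq using that by (intro contr_loc_ideal pr(2) assms(2)) simp
      finally have "P i = P (Suc i)" .
      then show False using sub by blast
    qed
    ultimately show ?thesis by blast
  qed
  moreover have "primeideal (loc_ideal (P i)) Loc" if "i \<le> d" for i
    using assms that by (intro prime_loc_ideal) (simp_all add: prime_chain_def)
  ultimately show ?thesis by (simp add: prime_chain_def)
qed

text \<open>In a domain the images of the generators stay distinct, so that their number remains equal to
  the dimension.\<close>

theorem regular_localizationI:
  assumes "noetherian_ring R" and "domain R"
    and G: "G \<subseteq> carrier R" "finite G" "I = Idl G"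
    and P: "prime_chain R (card G) P" "\<And>i. i \<le> card G \<Longrightarrow> P i \<subseteq> I"
    and bound: "\<And>e Q. prime_chain R e Q \<Longrightarrow> e \<le> card G"
  shows "regular_local_ring Loc"
proof -
  interpret D: "domain" R by fact
  interpret L: cring Loc by (rule cring_localization)
  let ?f = "\<lambda>a. frac R I a \<one>"
  let ?G = "?f ` G"
  have G': "?G \<subseteq> carrier Loc" using G frac_carrier one_compl by auto
  have "inj_on ?f G"
  proof
    fix a b assume ab: "a \<in> G" "b \<in> G" "?f a = ?f b"
    then have c: "a \<in> carrier R" "b \<in> carrier R" using G by auto
    then obtain u where u: "u \<in> carrier R - I" "u \<otimes> a = u \<otimes> b"
      using ab one_compl by (auto simp: frac_eq_iff)
    then have "u \<noteq> \<zero>" by auto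
    then show "a = b" using D.m_lcancel u c by blast
  qed
  then have card: "card ?G = card G" by (rule card_image)
  have "Idl\<^bsub>Loc\<^esub> ?G = loc_ideal I"
  proof
    have "G \<subseteq> I" using G genideal_self by simp
    then have "?G \<subseteq> loc_ideal I" using one_compl by (auto simp: loc_ideal_def)
    then show "Idl\<^bsub>Loc\<^esub> ?G \<subseteq> loc_ideal I"
      by (intro L.genideal_minimal ideal_loc_ideal is_ideal)
    have K: "ideal (Idl\<^bsub>Loc\<^esub> ?G) Loc" by (rule L.genideal_ideal[OF G'])
    have "G \<subseteq> contr (Idl\<^bsub>Loc\<^esub> ?G)"
      using G(1) L.genideal_self[OF G'] unfolding contr_def by blast
    then have "I \<subseteq> contr (Idl\<^bsub>Loc\<^esub> ?G)"
      using genideal_minimal[OF ideal_contr[OF K]] G by simp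
    then show "loc_ideal I \<subseteq> Idl\<^bsub>Loc\<^esub> ?G"
      using loc_ideal_contr[OF K] by (auto simp: loc_ideal_def)
  qed
  moreover have "krull_dim Loc = enat (card ?G)"
    unfolding card using krull_dim_eqI[OF prime_chain_loc_ideal[OF P]] prime_chain_contr bound
    by blast
  ultimately show ?thesis
    unfolding regular_local_ring_def maximalideals_localization
    using noetherian_localization[OF assms(1)] cring_localization G' G(2) by auto
qed

text \<open>The numerators \<open>F\<close> of the generators of the maximal ideal generate \<open>I\<close> up to denominators.\<close>

theorem regular_localizationD:
  assumes "regular_local_ring Loc"
  obtains d F P where "F \<subseteq> I" "finite F" "card F \<le> d"
    "\<And>x. x \<in> I \<Longrightarrow> \<exists>s \<in> carrier R - I. s \<otimes> x \<in> Idl F"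
    "prime_chain R d P" "\<And>i. i \<le> d \<Longrightarrow> P i \<subseteq> I"
proof -
  interpret L: cring Loc by (rule cring_localization)
  obtain M G where M: "{J. maximalideal J Loc} = {M}"
    and G: "G \<subseteq> carrier Loc" "finite G" "M = Idl\<^bsub>Loc\<^esub> G"
      "krull_dim Loc = enat (card G)"
    using assms unfolding regular_local_ring_def by metis
  have M': "M = loc_ideal I" using M maximalideals_localization by auto
  have "primeideal (loc_ideal I) Loc"
    by (rule prime_loc_ideal) (auto simp: primeideal)
  then obtain P where P: "prime_chain Loc (card G) P"
    using krull_dim_attained G(4) by metis
  have "G \<subseteq> loc_ideal I" using L.genideal_self[OF G(1)] unfolding G(3)[symmetric] M' .
  then have "\<exists>a s. a \<in> I \<and> s \<in> carrier R - I \<and> g = frac R I a s" if "g \<in> G" for g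
    using that unfolding loc_ideal_def by blast
  then obtain num den where nd: "\<And>g. g \<in> G \<Longrightarrow> num g \<in> I \<and> den g \<in> carrier R - I \<and>
      g = frac R I (num g) (den g)"
    by metis
  let ?F = "num ` G"
  have F: "?F \<subseteq> I" "finite ?F" "card ?F \<le> card G" using nd G card_image_le by auto
  have Fc: "?F \<subseteq> carrier R" using F Icarr by auto
  have "\<exists>s \<in> carrier R - I. s \<otimes> x \<in> Idl ?F" if x: "x \<in> I" for x
  proof -
    have Fi: "ideal (Idl ?F) R" by (rule genideal_ideal[OF Fc])
    interpret Fi: ideal "Idl ?F" R by fact
    have "G \<subseteq> loc_ideal (Idl ?F)"
      using nd genideal_self[OF Fc] unfolding loc_ideal_def by blast
    then have "M \<subseteq> loc_ideal (Idl ?F)"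
      unfolding G(3) by (intro L.genideal_minimal ideal_loc_ideal Fi)
    then have "frac R I x \<one> \<in> loc_ideal (Idl ?F)"
      using x one_compl unfolding M' by (auto simp: loc_ideal_def)
    then obtain b s where b: "b \<in> Idl ?F" "s \<in> carrier R - I" "frac R I x \<one> = frac R I b s"
      by (auto simp: loc_ideal_def)
    have xc: "x \<in> carrier R" using x Icarr by auto
    obtain u where u: "u \<in> carrier R - I" "u \<otimes> (x \<otimes> s) = u \<otimes> (b \<otimes> \<one>)"
      using b xc one_compl Fi.Icarr by (auto simp: frac_eq_iff)
    have "u \<otimes> (x \<otimes> s) \<in> Idl ?F" unfolding u(2) using b u Fi.Icarr by (auto intro!: Fi.I_l_closed)
    then have "u \<otimes> s \<otimes> x \<in> Idl ?F" using xc b u by (simp add: m_ac)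
    then show ?thesis using compl_closed b u by blast
  qed
  then show ?thesis
  proof (rule that[OF F])
    show "prime_chain R (card G) (\<lambda>i. contr (P i))" by (rule prime_chain_contr[OF P])
    show "contr (P i) \<subseteq> I" if "i \<le> card G" for i
      using P that by (intro prime_contr(2)) (simp add: prime_chain_def)
  qed
qed

end

section \<open>Isomorphic rings have isomorphic spectra\<close>

text \<open>Primality is reflected because \<open>h\<close> preserves products; properness because it preserves 1.\<close>

lemma (in ring_hom_cring) prime_vimage:
  assumes "primeideal P S"
  shows "primeideal {r \<in> carrier R. h r \<in> P} R"
proof -
  interpret P: primeideal P S by fact
  have rh: "ring_hom_ring R S h" by unfold_locales
  have id: "ideal {r \<in> carrier R. h r \<in> P} R" by (rule ring_hom_ring.ideal_vimage[OF rh P.is_ideal])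
  show ?thesis
  proof (rule primeidealI[OF id R.is_cring])
    have "\<one> \<notin> {r \<in> carrier R. h r \<in> P}" using P.one_imp_carrier P.I_notcarr by auto
    then show "carrier R \<noteq> {r \<in> carrier R. h r \<in> P}" using R.one_closed by blast
    show "a \<in> {r \<in> carrier R. h r \<in> P} \<or> b \<in> {r \<in> carrier R. h r \<in> P}"
      if "a \<in> carrier R" "b \<in> carrier R" "a \<otimes> b \<in> {r \<in> carrier R. h r \<in> P}" for a b
      using that P.I_prime[of "h a" "h b"] by auto
  qed
qed

lemma topspace_zariski: "topspace (zariski A) = prime_spectrum A"
proof -
  have "zariski_open A (prime_spectrum A)"
  proof -
    have "\<not> carrier A \<subseteq> p" if "p \<in> prime_spectrum A" for p
    proof -
      interpret primeideal p A using that by (simp add: prime_spectrum_def)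
      show ?thesis using I_notcarr a_subset by auto
    qed
    then show ?thesis unfolding zariski_open_def by blast
  qed
  moreover have "U \<subseteq> prime_spectrum A" if "zariski_open A U" for U
    using that by (auto simp: zariski_open_def)
  ultimately show ?thesis unfolding topspace_def openin_zariski by blast
qed

definition spec_map :: "('b, 'm) ring_scheme \<Rightarrow> ('b \<Rightarrow> 'a) \<Rightarrow> 'a set \<Rightarrow> 'b set" where
  "spec_map B h p = {b \<in> carrier B. h b \<in> p}"

text \<open>The image is a full class of fractions when \<open>h\<close> is bijective, see \<open>frac_map_frac\<close> below.\<close>

definition frac_map :: "('b \<Rightarrow> 'a) \<Rightarrow> ('b \<times> 'b) set \<Rightarrow> ('a \<times> 'a) set" where
  "frac_map h X = map_prod h h ` X"

definition spec_pre :: "('a, 'm) ring_scheme \<Rightarrow> ('b, 'n) ring_scheme \<Rightarrow> ('b \<Rightarrow> 'a) \<Rightarrow> 'b set set \<Rightarrow> 'a set set" where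
  "spec_pre A B h V = {p \<in> prime_spectrum A. spec_map B h p \<in> V}"

definition sec_map :: "('a, 'm) ring_scheme \<Rightarrow> ('b, 'n) ring_scheme \<Rightarrow> ('b \<Rightarrow> 'a) \<Rightarrow> 'b set set \<Rightarrow>
    ('b set \<Rightarrow> ('b \<times> 'b) set) \<Rightarrow> ('a set \<Rightarrow> ('a \<times> 'a) set)" where
  "sec_map A B h V s = (\<lambda>p\<in>spec_pre A B h V. frac_map h (s (spec_map B h p)))"

text \<open>The homomorphism points from \<open>B\<close> to \<open>A\<close>, so that the induced map of spectra points from the
  spectrum of \<open>A\<close> to that of \<open>B\<close>.\<close>

locale cring_iso =
  fixes A :: "('a, 'm) ring_scheme" and B :: "('b, 'n) ring_scheme" and h :: "'b \<Rightarrow> 'a"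
  assumes A: "cring A" and B: "cring B" and iso: "h \<in> ring_iso B A"
begin

sublocale A: cring A by (rule A)
sublocale B: cring B by (rule B)
sublocale h: ring_hom_cring B A h
  using iso by (intro ring_hom_cring.intro A B ring_hom_cring_axioms.intro) (simp add: ring_iso_def)

lemma bij: "bij_betw h (carrier B) (carrier A)"
  using iso by (simp add: ring_iso_def)

lemma inverse: "cring_iso B A (inv_into (carrier B) h)"
  using A B ring_iso_set_sym[OF B.ring_axioms iso] by (simp add: cring_iso_def)

lemma spec_map_prime: "primeideal p A \<Longrightarrow> primeideal (spec_map B h p) B"
  unfolding spec_map_def by (rule h.prime_vimage)

lemma spec_map_inverse: "p \<in> prime_spectrum A \<Longrightarrow> spec_map A (inv_into (carrier B) h) (spec_map B h p) = p"
proof -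
  assume "p \<in> prime_spectrum A"
  then interpret p: primeideal p A by (simp add: prime_spectrum_def)
  have "inv_into (carrier B) h a \<in> carrier B" "h (inv_into (carrier B) h a) = a" if "a \<in> carrier A" for a
    using bij that by (auto simp: bij_betw_def inv_into_into f_inv_into_f)
  then show ?thesis using p.Icarr by (auto simp: spec_map_def)
qed

lemma spec_map_inverse': "q \<in> prime_spectrum B \<Longrightarrow> spec_map B h (spec_map A (inv_into (carrier B) h) q) = q"
proof -
  assume "q \<in> prime_spectrum B"
  then interpret q: primeideal q B by (simp add: prime_spectrum_def)
  have "inv_into (carrier B) h (h a) = a" if "a \<in> carrier B" for a
    using bij that by (auto simp: bij_betw_def)
  then show ?thesis using q.Icarr by (auto simp: spec_map_def)
qed

text \<open>Surjectivity of \<open>h\<close> yields all representatives of the class on the right-hand side, and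
  injectivity turns their defining equations back into equations in \<open>B\<close>.\<close>

lemma frac_map_frac:
  assumes p: "primeideal p A" and a: "a \<in> carrier B" "s \<in> carrier B"
  shows "frac_map h (frac B (spec_map B h p) a s) = frac A p (h a) (h s)"
proof
  show "frac_map h (frac B (spec_map B h p) a s) \<subseteq> frac A p (h a) (h s)"
  proof
    fix z assume "z \<in> frac_map h (frac B (spec_map B h p) a s)"
    then obtain b t u where bt: "b \<in> carrier B" "t \<in> carrier B" "h t \<notin> p" "u \<in> carrier B" "h u \<notin> p"
      and e: "u \<otimes>\<^bsub>B\<^esub> (a \<otimes>\<^bsub>B\<^esub> t) = u \<otimes>\<^bsub>B\<^esub> (b \<otimes>\<^bsub>B\<^esub> s)" and z: "z = (h b, h t)"
      by (auto simp: frac_map_def frac_def spec_map_def)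
    have "h u \<otimes>\<^bsub>A\<^esub> (h a \<otimes>\<^bsub>A\<^esub> h t) = h u \<otimes>\<^bsub>A\<^esub> (h b \<otimes>\<^bsub>A\<^esub> h s)"
      using arg_cong[OF e, of h] a bt by simp
    then show "z \<in> frac A p (h a) (h s)"
      unfolding z frac_def using bt by auto
  qed
  show "frac A p (h a) (h s) \<subseteq> frac_map h (frac B (spec_map B h p) a s)"
  proof
    fix z assume "z \<in> frac A p (h a) (h s)"
    then obtain b' t' u' where bt': "b' \<in> carrier A" "t' \<in> carrier A" "t' \<notin> p" "u' \<in> carrier A" "u' \<notin> p"
      and e: "u' \<otimes>\<^bsub>A\<^esub> (h a \<otimes>\<^bsub>A\<^esub> t') = u' \<otimes>\<^bsub>A\<^esub> (b' \<otimes>\<^bsub>A\<^esub> h s)" and z: "z = (b', t')"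
      by (auto simp: frac_def)
    have "\<And>y. y \<in> carrier A \<Longrightarrow> \<exists>x. x \<in> carrier B \<and> y = h x" using bij by (auto simp: bij_betw_def)
    then obtain b t u where bt: "b \<in> carrier B" "b' = h b" "t \<in> carrier B" "t' = h t"
      "u \<in> carrier B" "u' = h u" using bt' by metis
    have "h (u \<otimes>\<^bsub>B\<^esub> (a \<otimes>\<^bsub>B\<^esub> t)) = h (u \<otimes>\<^bsub>B\<^esub> (b \<otimes>\<^bsub>B\<^esub> s))" using e a bt by simp
    then have "u \<otimes>\<^bsub>B\<^esub> (a \<otimes>\<^bsub>B\<^esub> t) = u \<otimes>\<^bsub>B\<^esub> (b \<otimes>\<^bsub>B\<^esub> s)"
      using bij a bt by (intro inj_onD[of h "carrier B"]) (auto simp: bij_betw_def)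
    then have "(b, t) \<in> frac B (spec_map B h p) a s"
      unfolding frac_def spec_map_def using bt bt' by auto
    then show "z \<in> frac_map h (frac B (spec_map B h p) a s)"
      unfolding z frac_map_def bt by force
  qed
qed

lemma frac_map_hom:
  assumes p: "primeideal p A"
  shows "frac_map h \<in> Ring.ring_hom (localization B (spec_map B h p)) (localization A p)"
proof -
  have compl: "h s \<in> carrier A - p" if "s \<in> carrier B - spec_map B h p" for s
    using that by (simp add: spec_map_def)
  interpret p: primeideal p A by fact
  interpret q: primeideal "spec_map B h p" B by (rule spec_map_prime[OF p])
  note fm = frac_map_frac[OF p]
  show ?thesis
  proof (rule ring_hom_memI)
    fix x y
    assume x: "x \<in> carrier (localization B (spec_map B h p))"
      and y: "y \<in> carrier (localization B (spec_map B h p))"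
    obtain a s b t where c: "a \<in> carrier B" "s \<in> carrier B - spec_map B h p"
        "b \<in> carrier B" "t \<in> carrier B - spec_map B h p"
      and e: "x = frac B (spec_map B h p) a s" "y = frac B (spec_map B h p) b t"
      using x y by (metis q.localization_cases)
    have c': "h a \<in> carrier A" "h b \<in> carrier A" "h s \<in> carrier A - p" "h t \<in> carrier A - p"
      using c compl by auto
    show "frac_map h x \<in> carrier (localization A p)"
      unfolding e using c c' by (simp add: fm p.frac_carrier)
    show "frac_map h (x \<otimes>\<^bsub>localization B (spec_map B h p)\<^esub> y) =
        frac_map h x \<otimes>\<^bsub>localization A p\<^esub> frac_map h y"
      unfolding e using c c' by (simp add: fm q.mult_frac p.mult_frac)
    show "frac_map h (x \<oplus>\<^bsub>localization B (spec_map B h p)\<^esub> y) =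
        frac_map h x \<oplus>\<^bsub>localization A p\<^esub> frac_map h y"
      unfolding e using c c' by (simp add: fm q.add_frac p.add_frac)
  next
    show "frac_map h \<one>\<^bsub>localization B (spec_map B h p)\<^esub> = \<one>\<^bsub>localization A p\<^esub>"
      by (simp add: fm p.one_localization q.one_localization)
  qed
qed

lemma open_spec_pre:
  assumes "openin (zariski B) V"
  shows "openin (zariski A) (spec_pre A B h V)"
proof -
  obtain E where E: "E \<subseteq> carrier B" "V = {p \<in> prime_spectrum B. \<not> E \<subseteq> p}"
    using assms by (auto simp: openin_zariski zariski_open_def)
  have "spec_pre A B h V = {p \<in> prime_spectrum A. \<not> h ` E \<subseteq> p}"
    using E spec_map_prime by (auto simp: spec_pre_def prime_spectrum_def spec_map_def)
  moreover have "h ` E \<subseteq> carrier A" using E by auto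
  ultimately show ?thesis unfolding openin_zariski zariski_open_def by blast
qed

text \<open>A local representation of a section as a fraction is carried over by applying \<open>h\<close> to numerator
  and denominator; the operations are compared point by point.\<close>

lemma sec_map_hom:
  assumes V: "V \<subseteq> prime_spectrum B"
  shows "sec_map A B h V \<in> Ring.ring_hom (Spec_sections B V) (Spec_sections A (spec_pre A B h V))"
proof (rule ring_hom_memI)
  have pt: "frac_map h \<in> Ring.ring_hom (localization B (spec_map B h p)) (localization A p)"
    "spec_map B h p \<in> V" if "p \<in> spec_pre A B h V" for p
    using that frac_map_hom by (auto simp: spec_pre_def prime_spectrum_def)
  have carr: "s (spec_map B h p) \<in> carrier (localization B (spec_map B h p))"
    if "s \<in> carrier (Spec_sections B V)" "p \<in> spec_pre A B h V" for s p
    using that pt by (auto simp: Spec_sections_def PiE_def Pi_def)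
  fix s t assume s: "s \<in> carrier (Spec_sections B V)" and t: "t \<in> carrier (Spec_sections B V)"
  show "sec_map A B h V s \<in> carrier (Spec_sections A (spec_pre A B h V))"
  proof -
    have 1: "sec_map A B h V s \<in> (\<Pi>\<^sub>E p\<in>spec_pre A B h V. carrier (localization A p))"
      using ring_hom_memE(1)[OF pt(1) carr[OF s]] by (auto simp: sec_map_def)
    have "\<exists>W. openin (zariski A) W \<and> p \<in> W \<and> W \<subseteq> spec_pre A B h V \<and>
         (\<exists>a \<in> carrier A. \<exists>f \<in> carrier A. \<forall>q\<in>W. f \<notin> q \<and> sec_map A B h V s q = frac A q a f)"
      if p: "p \<in> spec_pre A B h V" for p
    proof -
      obtain W a f where W: "openin (zariski B) W" "spec_map B h p \<in> W" "W \<subseteq> V"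
        and a: "a \<in> carrier B" "f \<in> carrier B" and val: "\<forall>q\<in>W. f \<notin> q \<and> s q = frac B q a f"
        using s pt(2)[OF p] unfolding Spec_sections_def by auto
      have "p \<in> spec_pre A B h W" "spec_pre A B h W \<subseteq> spec_pre A B h V"
        using p W by (auto simp: spec_pre_def)
      moreover have "h f \<notin> q \<and> sec_map A B h V s q = frac A q (h a) (h f)"
        if q: "q \<in> spec_pre A B h W" for q
      proof
        have qW: "spec_map B h q \<in> W" "q \<in> spec_pre A B h V" "primeideal q A"
          using q W by (auto simp: spec_pre_def prime_spectrum_def)
        have "f \<notin> spec_map B h q" using val qW(1) by blast
        then show "h f \<notin> q" using a by (simp add: spec_map_def)
        show "sec_map A B h V s q = frac A q (h a) (h f)"
          using val qW a by (simp add: sec_map_def frac_map_frac)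
      qed
      ultimately show ?thesis
        using open_spec_pre[OF W(1)] h.hom_closed[OF a(1)] h.hom_closed[OF a(2)]
        by (intro exI[of _ "spec_pre A B h W"] conjI bexI[of _ "h a"] bexI[of _ "h f"] ballI) simp_all
    qed
    with 1 show ?thesis unfolding Spec_sections_def by simp
  qed
  show "sec_map A B h V (s \<otimes>\<^bsub>Spec_sections B V\<^esub> t) =
    sec_map A B h V s \<otimes>\<^bsub>Spec_sections A (spec_pre A B h V)\<^esub> sec_map A B h V t"
  proof
    fix p
    show "sec_map A B h V (s \<otimes>\<^bsub>Spec_sections B V\<^esub> t) p =
      (sec_map A B h V s \<otimes>\<^bsub>Spec_sections A (spec_pre A B h V)\<^esub> sec_map A B h V t) p"
    proof (cases "p \<in> spec_pre A B h V")
      case True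
      then show ?thesis
        using ring_hom_memE(2)[OF pt(1)[OF True] carr[OF s True] carr[OF t True]] pt(2)[OF True]
        by (simp add: sec_map_def Spec_sections_def)
    next
      case False
      then show ?thesis by (simp add: sec_map_def Spec_sections_def)
    qed
  qed
  show "sec_map A B h V (s \<oplus>\<^bsub>Spec_sections B V\<^esub> t) =
    sec_map A B h V s \<oplus>\<^bsub>Spec_sections A (spec_pre A B h V)\<^esub> sec_map A B h V t"
  proof
    fix p
    show "sec_map A B h V (s \<oplus>\<^bsub>Spec_sections B V\<^esub> t) p =
      (sec_map A B h V s \<oplus>\<^bsub>Spec_sections A (spec_pre A B h V)\<^esub> sec_map A B h V t) p"
    proof (cases "p \<in> spec_pre A B h V")
      case True
      then show ?thesis
        using ring_hom_memE(3)[OF pt(1)[OF True] carr[OF s True] carr[OF t True]] pt(2)[OF True]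
        by (simp add: sec_map_def Spec_sections_def)
    next
      case False
      then show ?thesis by (simp add: sec_map_def Spec_sections_def)
    qed
  qed
next
  show "sec_map A B h V \<one>\<^bsub>Spec_sections B V\<^esub> = \<one>\<^bsub>Spec_sections A (spec_pre A B h V)\<^esub>"
  proof
    fix p
    show "sec_map A B h V \<one>\<^bsub>Spec_sections B V\<^esub> p = \<one>\<^bsub>Spec_sections A (spec_pre A B h V)\<^esub> p"
    proof (cases "p \<in> spec_pre A B h V")
      case True
      then have "primeideal p A" "spec_map B h p \<in> V" by (auto simp: spec_pre_def prime_spectrum_def)
      then show ?thesis
        using ring_hom_memE(4)[OF frac_map_hom[of p]] True by (simp add: sec_map_def Spec_sections_def)
    next
      case False
      then show ?thesis by (simp add: sec_map_def Spec_sections_def)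
    qed
  qed
qed

lemma sec_map_inverse:
  assumes V: "V \<subseteq> prime_spectrum B" and s: "s \<in> carrier (Spec_sections B V)"
  shows "sec_map B A (inv_into (carrier B) h) (spec_pre A B h V) (sec_map A B h V s) = s"
proof
  let ?k = "inv_into (carrier B) h"
  interpret k: cring_iso B A ?k by (rule inverse)
  have pre: "q \<in> spec_pre B A ?k (spec_pre A B h V) \<longleftrightarrow> q \<in> V" for q
    using V k.spec_map_prime spec_map_inverse' by (auto simp: spec_pre_def prime_spectrum_def)
  fix q
  show "sec_map B A ?k (spec_pre A B h V) (sec_map A B h V s) q = s q"
  proof (cases "q \<in> V")
    case True
    then have q: "q \<in> prime_spectrum B" using V by auto
    then interpret q: primeideal q B by (simp add: prime_spectrum_def)
    have m: "spec_map A ?k q \<in> spec_pre A B h V"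
      using q True k.spec_map_prime spec_map_inverse' by (auto simp: spec_pre_def prime_spectrum_def)
    have "s q \<in> carrier (localization B q)" using s True by (auto simp: Spec_sections_def PiE_def Pi_def)
    then obtain a t where "s q = frac B q a t" by (metis q.localization_cases)
    then have sq: "s q \<subseteq> carrier B \<times> carrier B" by (auto simp: frac_def)
    have "sec_map B A ?k (spec_pre A B h V) (sec_map A B h V s) q = frac_map ?k (frac_map h (s q))"
      using True m q by (simp add: sec_map_def pre spec_map_inverse')
    also have "\<dots> = (\<lambda>x. x) ` s q"
      unfolding frac_map_def image_image
    proof (rule image_cong)
      fix x assume "x \<in> s q"
      then have "x \<in> carrier B \<times> carrier B" using sq by auto
      then show "map_prod ?k ?k (map_prod h h x) = x"
        using bij by (auto simp: bij_betw_def)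
    qed simp
    finally show ?thesis by simp
  next
    case False
    then have "s q = undefined" using s by (auto simp: Spec_sections_def PiE_def extensional_def)
    then show ?thesis using False by (simp add: sec_map_def pre)
  qed
qed

text \<open>The inverse is the map of sections induced by the inverse of \<open>h\<close>. As that inverse is only
  determined on \<open>carrier A\<close>, the composites are compared on elements of the carriers.\<close>

lemma sec_map_iso:
  assumes V: "V \<subseteq> prime_spectrum B"
  shows "sec_map A B h V \<in> ring_iso (Spec_sections B V) (Spec_sections A (spec_pre A B h V))"
proof -
  let ?k = "inv_into (carrier B) h"
  let ?U = "spec_pre A B h V"
  interpret k: cring_iso B A ?k by (rule inverse)
  have U: "?U \<subseteq> prime_spectrum A" by (auto simp: spec_pre_def)
  have pre: "spec_pre B A ?k ?U = V"
    using V k.spec_map_prime spec_map_inverse' by (auto simp: spec_pre_def prime_spectrum_def)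
  have kk: "inv_into (carrier A) ?k a = h a" if "a \<in> carrier B" for a
  proof -
    have "h a \<in> carrier A" "?k (h a) = a" using that bij by (auto simp: bij_betw_def)
    then show ?thesis using k.bij by (metis bij_betw_def inv_into_f_f)
  qed
  have sec: "sec_map A B (inv_into (carrier A) ?k) V t = sec_map A B h V t"
    if "t \<in> carrier (Spec_sections B V)" for t
  proof -
    have 1: "spec_map B (inv_into (carrier A) ?k) p = spec_map B h p" for p
      by (auto simp: spec_map_def kk)
    have "frac_map (inv_into (carrier A) ?k) (t q) = frac_map h (t q)" if q: "q \<in> V" for q
    proof -
      interpret q: primeideal q B using q V by (auto simp: prime_spectrum_def)
      have "t q \<in> carrier (localization B q)"
        using q \<open>t \<in> _\<close> by (auto simp: Spec_sections_def PiE_def Pi_def)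
      then obtain a u where "t q = frac B q a u" by (metis q.localization_cases)
      then have sq: "t q \<subseteq> carrier B \<times> carrier B" by (auto simp: frac_def)
      then show ?thesis unfolding frac_map_def by (intro image_cong) (auto simp: kk)
    qed
    then show ?thesis unfolding sec_map_def spec_pre_def 1 by (intro restrict_ext) auto
  qed
  have "bij_betw (sec_map A B h V) (carrier (Spec_sections B V)) (carrier (Spec_sections A ?U))"
  proof (rule bij_betw_byWitness[where f' = "sec_map B A ?k ?U"])
    show "\<forall>s\<in>carrier (Spec_sections B V). sec_map B A ?k ?U (sec_map A B h V s) = s"
      using sec_map_inverse[OF V] by blast
    have im: "sec_map B A ?k ?U s \<in> carrier (Spec_sections B V)" if "s \<in> carrier (Spec_sections A ?U)" for s
      using ring_hom_memE(1)[OF k.sec_map_hom[OF U]] that by (simp add: pre)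
    then show "sec_map B A ?k ?U ` carrier (Spec_sections A ?U) \<subseteq> carrier (Spec_sections B V)" by blast
    show "sec_map A B h V ` carrier (Spec_sections B V) \<subseteq> carrier (Spec_sections A ?U)"
      using ring_hom_memE(1)[OF sec_map_hom[OF V]] by blast
    show "\<forall>s\<in>carrier (Spec_sections A ?U). sec_map A B h V (sec_map B A ?k ?U s) = s"
      using k.sec_map_inverse[OF U] sec[OF im] by (simp add: pre)
  qed
  then show ?thesis using sec_map_hom[OF V] by (simp add: ring_iso_def)
qed

lemma homeomorphic_spec_map: "homeomorphic_map (zariski A) (zariski B) (spec_map B h)"
proof -
  let ?k = "inv_into (carrier B) h"
  interpret k: cring_iso B A ?k by (rule inverse)
  have "continuous_map (zariski A) (zariski B) (spec_map B h)"
    unfolding continuous_map_def topspace_zariski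
    using spec_map_prime open_spec_pre by (auto simp: prime_spectrum_def spec_pre_def)
  moreover have "continuous_map (zariski B) (zariski A) (spec_map A ?k)"
    unfolding continuous_map_def topspace_zariski
    using k.spec_map_prime k.open_spec_pre by (auto simp: prime_spectrum_def spec_pre_def)
  ultimately have "homeomorphic_maps (zariski A) (zariski B) (spec_map B h) (spec_map A ?k)"
    unfolding homeomorphic_maps_def topspace_zariski using spec_map_inverse spec_map_inverse' by blast
  then show ?thesis by (rule homeomorphic_maps_imp_map)
qed

text \<open>The condition \<open>h (\<beta> a) = \<alpha> a\<close> says that \<open>h\<close> is a homomorphism of \<open>K\<close>-algebras; it makes the
  isomorphism compatible with the structure morphisms.\<close>

theorem isomorphic_Spec:
  assumes \<beta>: "\<And>a. \<beta> a \<in> carrier B" and \<alpha>: "\<And>a. h (\<beta> a) = \<alpha> a"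
  shows "isomorphic_over (Spec \<alpha> A) (Spec \<beta> B)"
  unfolding isomorphic_over_def Let_def
proof (intro exI conjI allI impI ballI)
  show "homeomorphic_map (space (Spec \<alpha> A)) (space (Spec \<beta> B)) (spec_map B h)"
    using homeomorphic_spec_map by (simp add: Spec_def)
  have pre: "{x \<in> topspace (space (Spec \<alpha> A)). spec_map B h x \<in> V} = spec_pre A B h V" for V
    by (simp add: Spec_def topspace_zariski spec_pre_def)
  fix V assume "openin (space (Spec \<beta> B)) V"
  then have V: "V \<subseteq> prime_spectrum B"
    using openin_subset[of "zariski B" V] by (simp add: Spec_def topspace_zariski)
  show "sec_map A B h V \<in> ring_iso (sections (Spec \<beta> B) V)
      (sections (Spec \<alpha> A) {x \<in> topspace (space (Spec \<alpha> A)). spec_map B h x \<in> V})"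
    unfolding pre using sec_map_iso[OF V] by (simp add: Spec_def)
  fix a
  show "sec_map A B h V (scalar (Spec \<beta> B) V a) =
      scalar (Spec \<alpha> A) {x \<in> topspace (space (Spec \<alpha> A)). spec_map B h x \<in> V} a"
    unfolding pre
  proof
    fix p
    show "sec_map A B h V (scalar (Spec \<beta> B) V a) p = scalar (Spec \<alpha> A) (spec_pre A B h V) a p"
      using frac_map_frac[of p "\<beta> a" "\<one>\<^bsub>B\<^esub>"] \<beta>[of a] \<alpha>[of a]
      by (cases "p \<in> spec_pre A B h V") (auto simp: sec_map_def Spec_def spec_pre_def prime_spectrum_def)
  qed
next
  have pre: "{x \<in> topspace (space (Spec \<alpha> A)). spec_map B h x \<in> V} = spec_pre A B h V" for V
    by (simp add: Spec_def topspace_zariski spec_pre_def)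
  fix V W :: "'b set set" and s assume "W \<subseteq> V"
  then show "sec_map A B h W (restr (Spec \<beta> B) W s) =
      restr (Spec \<alpha> A) {x \<in> topspace (space (Spec \<alpha> A)). spec_map B h x \<in> W} (sec_map A B h V s)"
    unfolding pre by (auto simp: Spec_def sec_map_def spec_pre_def restrict_def fun_eq_iff)
qed

end

section \<open>Global sections of the structure sheaf\<close>

text \<open>Negatives come for free as multiples by \<open>-1\<close>.\<close>

lemma (in cring) cring_idealI:
  assumes "J \<subseteq> carrier R" "\<zero> \<in> J"
    and add: "\<And>x y. x \<in> J \<Longrightarrow> y \<in> J \<Longrightarrow> x \<oplus> y \<in> J"
    and mult: "\<And>r x. r \<in> carrier R \<Longrightarrow> x \<in> J \<Longrightarrow> r \<otimes> x \<in> J"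
  shows "ideal J R"
proof (rule idealI[OF ring_axioms])
  show "subgroup J (add_monoid R)"
  proof (rule group.subgroupI)
    show "Group.group (add_monoid R)" by (rule a_group)
    fix x assume x: "x \<in> J"
    then have "x \<in> carrier R" using assms by auto
    then have "\<ominus> x = (\<ominus> \<one>) \<otimes> x" by (simp add: l_minus)
    then have "\<ominus> x \<in> J" using x mult by simp
    then show "inv\<^bsub>add_monoid R\<^esub> x \<in> J" by (simp add: a_inv_def)
  qed (use assms in auto)
next
  fix a x assume a: "a \<in> J" and x: "x \<in> carrier R"
  then show "x \<otimes> a \<in> J" by (intro mult)
  then show "a \<otimes> x \<in> J" using a x assms(1) m_comm[of a x] by auto
qed

text \<open>By Zorn's lemma there is an ideal \<open>M\<close> that is maximal among those that contain \<open>J\<close> and avoid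
  the powers of \<open>g\<close>. It is prime: if \<open>a\<close> and \<open>b\<close> are not in \<open>M\<close>, then adding either to \<open>M\<close>
  produces a power of \<open>g\<close>, and the product of these two powers would lie in \<open>M\<close> together with
  \<open>a \<otimes> b\<close>.\<close>

lemma (in cring) exists_prime_avoiding_powers:
  assumes J: "ideal J R" and g: "g \<in> carrier R" and pow: "\<And>n::nat. g [^] n \<notin> J"
  obtains p where "primeideal p R" "J \<subseteq> p" "g \<notin> p"
proof -
  let ?S = "{K. ideal K R \<and> J \<subseteq> K \<and> (\<forall>n::nat. g [^] n \<notin> K)}"
  \<comment> \<open>Zorn's lemma applies since the union of a chain of ideals is an ideal\<close>
  have "\<exists>M\<in>?S. \<forall>X\<in>?S. M \<subseteq> X \<longrightarrow> X = M"
  proof (rule subset_Zorn_nonempty)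
    show "?S \<noteq> {}" using assms by blast
    fix C assume C: "C \<noteq> {}" "subset.chain ?S C"
    then have "subset.chain {I. ideal I R} C" by (auto simp: subset.chain_def)
    then have "ideal (\<Union>C) R" using chain_Union_is_ideal[of C] C by simp
    moreover have "C \<subseteq> ?S" using C by (simp add: subset.chain_def)
    ultimately show "\<Union>C \<in> ?S" using C(1) by blast
  qed
  then obtain M where MS: "M \<in> ?S" and maxS: "\<forall>X\<in>?S. M \<subseteq> X \<longrightarrow> X = M"
    by (rule bexE)
  have M: "ideal M R" "J \<subseteq> M" "\<And>n::nat. g [^] n \<notin> M"
    using MS by simp_all
  have max: "X = M" if "ideal X R" "J \<subseteq> X" "\<And>n::nat. g [^] n \<notin> X" "M \<subseteq> X" for X
    using maxS that by simp
  interpret M: ideal M R by fact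
  have big: "\<exists>n::nat. \<exists>x\<in>M. \<exists>r\<in>carrier R. g [^] n = x \<oplus> r \<otimes> a"
    if a: "a \<in> carrier R" "a \<notin> M" for a
  proof (rule ccontr)
    assume no: "\<not> ?thesis"
    let ?X = "{x \<oplus> r \<otimes> a | x r. x \<in> M \<and> r \<in> carrier R}"
    have X: "ideal ?X R"
    proof (rule cring_idealI)
      show "?X \<subseteq> carrier R" using a M.Icarr by auto
      show "\<zero> \<in> ?X" using a M.zero_closed by (intro CollectI exI[of _ \<zero>]) auto
      fix u v assume "u \<in> ?X" "v \<in> ?X"
      then obtain x r y s where "u = x \<oplus> r \<otimes> a" "v = y \<oplus> s \<otimes> a" and
        c: "x \<in> M" "r \<in> carrier R" "y \<in> M" "s \<in> carrier R" by blast
      then have "u \<oplus> v = (x \<oplus> y) \<oplus> (r \<oplus> s) \<otimes> a"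
        using a M.Icarr by (simp add: l_distr a_ac)
      then show "u \<oplus> v \<in> ?X" using c M.a_closed by blast
    next
      fix t u assume t: "t \<in> carrier R" and "u \<in> ?X"
      then obtain x r where "u = x \<oplus> r \<otimes> a" and c: "x \<in> M" "r \<in> carrier R" by blast
      then have "t \<otimes> u = t \<otimes> x \<oplus> (t \<otimes> r) \<otimes> a"
        using a t M.Icarr by (simp add: r_distr m_ac)
      then show "t \<otimes> u \<in> ?X" using c t M.I_l_closed by blast
    qed
    have MX: "M \<subseteq> ?X"
    proof
      fix x assume x: "x \<in> M"
      then have "x = x \<oplus> \<zero> \<otimes> a" using a M.Icarr by simp
      then show "x \<in> ?X" using x by blast
    qed
    moreover have "g [^] n \<notin> ?X" for n :: nat using no by blast
    ultimately have "?X = M" using max[OF X] M(2) by blast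
    moreover have "a \<in> ?X"
    proof -
      have "a = \<zero> \<oplus> \<one> \<otimes> a" using a by simp
      then show ?thesis using M.zero_closed by blast
    qed
    ultimately show False using a by blast
  qed
  have "primeideal M R"
  proof (rule primeidealI[OF M(1) is_cring])
    show "carrier R \<noteq> M" using M(3)[of 0] by auto
    fix a b assume ab: "a \<in> carrier R" "b \<in> carrier R" "a \<otimes> b \<in> M"
    show "a \<in> M \<or> b \<in> M"
    proof (rule ccontr)
      assume "\<not> ?thesis"
      then obtain m n :: nat and x r y s where
        e: "g [^] m = x \<oplus> r \<otimes> a" "g [^] n = y \<oplus> s \<otimes> b" and
        c: "x \<in> M" "r \<in> carrier R" "y \<in> M" "s \<in> carrier R"
        using big ab by meson
      have xy: "x \<in> carrier R" "y \<in> carrier R" using c M.Icarr by auto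
      have "g [^] (m + n) = (x \<oplus> r \<otimes> a) \<otimes> (y \<oplus> s \<otimes> b)"
        using g by (simp add: nat_pow_mult[symmetric] e)
      also have "\<dots> = (y \<oplus> s \<otimes> b) \<otimes> x \<oplus> ((r \<otimes> a) \<otimes> y \<oplus> (r \<otimes> s) \<otimes> (a \<otimes> b))"
        using c xy ab by (simp add: l_distr r_distr m_ac a_ac)
      also have "\<dots> \<in> M"
        using c xy ab M.I_l_closed[OF ab(3), of "r \<otimes> s"] M.I_l_closed[of x "y \<oplus> s \<otimes> b"]
          M.I_l_closed[of y "r \<otimes> a"] by (intro M.a_closed) auto
      finally show False using M(3) by blast
    qed
  qed
  moreover have "g \<notin> M" using M(3)[of 1] g by simp
  ultimately show ?thesis using that M(2) by blast
qed

lemma (in cring) exists_prime_above: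
  assumes J: "ideal J R" and "\<one> \<notin> J"
  obtains p where "primeideal p R" "J \<subseteq> p"
  using exists_prime_avoiding_powers[OF J one_closed] assms by auto

text \<open>Otherwise some prime ideal contains the annihilator of \<open>x\<close> and avoids \<open>g\<close>, although an element
  outside this prime ideal annihilates \<open>x\<close>.\<close>

lemma (in cring) locally_zero_imp_power_annihilates:
  assumes x: "x \<in> carrier R" and g: "g \<in> carrier R"
    and loc: "\<And>p. primeideal p R \<Longrightarrow> g \<notin> p \<Longrightarrow> \<exists>u \<in> carrier R - p. u \<otimes> x = \<zero>"
  shows "\<exists>n::nat. g [^] n \<otimes> x = \<zero>"
proof (rule ccontr)
  assume no: "\<not> ?thesis"
  let ?J = "{r \<in> carrier R. r \<otimes> x = \<zero>}"
  have "ideal ?J R"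
    by (rule cring_idealI) (use x in \<open>auto simp: l_distr m_assoc\<close>)
  then obtain p where "primeideal p R" "?J \<subseteq> p" "g \<notin> p"
    using exists_prime_avoiding_powers[of ?J g] no g by auto
  then show False using loc by blast
qed

text \<open>Quasi-compactness of the spectrum in algebraic form: the elements generated by finite subsets of
  \<open>H\<close> already form an ideal.\<close>

lemma (in cring) finite_subset_generates_one:
  assumes H: "H \<subseteq> carrier R" and one: "\<one> \<in> Idl H"
  obtains F where "finite F" "F \<subseteq> H" "\<one> \<in> Idl F"
proof -
  let ?J = "{r. \<exists>F. finite F \<and> F \<subseteq> H \<and> r \<in> Idl F}"
  have id: "ideal (Idl F) R" if "F \<subseteq> H" for F using that H by (intro genideal_ideal) auto
  have mono: "Idl F \<subseteq> Idl F'" if "F \<subseteq> F'" "F' \<subseteq> H" for F F'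
    using that H genideal_self[of F'] by (intro genideal_minimal id) auto
  have "ideal ?J R"
  proof (rule cring_idealI)
    show "?J \<subseteq> carrier R"
    proof
      fix r assume "r \<in> ?J"
      then obtain F where F: "F \<subseteq> H" "r \<in> Idl F" by blast
      show "r \<in> carrier R" using ideal.Icarr[OF id[OF F(1)] F(2)] .
    qed
    have "\<zero> \<in> Idl {}" using id[of "{}"] by (simp add: additive_subgroup.zero_closed ideal_def)
    then show "\<zero> \<in> ?J" by blast
    fix x y assume "x \<in> ?J" "y \<in> ?J"
    then obtain F F' where F: "finite F" "F \<subseteq> H" "x \<in> Idl F" "finite F'" "F' \<subseteq> H" "y \<in> Idl F'"
      by blast
    have FF: "F \<union> F' \<subseteq> H" using F by simp
    have "x \<in> Idl (F \<union> F')" "y \<in> Idl (F \<union> F')"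
      using mono[of F "F \<union> F'"] mono[of F' "F \<union> F'"] F by auto
    then have "x \<oplus> y \<in> Idl (F \<union> F')"
      using id[OF FF] by (simp add: additive_subgroup.a_closed ideal_def)
    then show "x \<oplus> y \<in> ?J" using F FF by (intro CollectI exI[of _ "F \<union> F'"]) auto
  next
    fix r x assume r: "r \<in> carrier R" and "x \<in> ?J"
    then obtain F where F: "finite F" "F \<subseteq> H" "x \<in> Idl F" by blast
    have "r \<otimes> x \<in> Idl F" using ideal.I_l_closed[OF id[OF F(2)] F(3) r] .
    then show "r \<otimes> x \<in> ?J" using F by blast
  qed
  moreover have "H \<subseteq> ?J"
  proof
    fix h assume "h \<in> H"
    then have "h \<in> Idl {h}" using H by (intro genideal_self') auto
    then show "h \<in> ?J" using \<open>h \<in> H\<close> by (intro CollectI exI[of _ "{h}"]) auto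
  qed
  ultimately have "Idl H \<subseteq> ?J" by (rule genideal_minimal)
  then show ?thesis using one that by blast
qed

definition global_section :: "('a, 'm) ring_scheme \<Rightarrow> 'a \<Rightarrow> ('a set \<Rightarrow> ('a \<times> 'a) set)" where
  "global_section A a = (\<lambda>p\<in>prime_spectrum A. frac A p a \<one>\<^bsub>A\<^esub>)"

context cring
begin

lemma global_section_hom:
  "global_section R \<in> Ring.ring_hom R (Spec_sections R (prime_spectrum R))"
proof (rule ring_hom_memI)
  have op: "openin (zariski R) (prime_spectrum R)"
    using openin_topspace[of "zariski R"] by (simp add: topspace_zariski)
  have hom: "(\<lambda>a. frac R p a \<one>) \<in> Ring.ring_hom R (localization R p)" if "p \<in> prime_spectrum R" for p
    using that primeideal.frac_hom by (auto simp: prime_spectrum_def)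
  have not1: "\<one> \<notin> p" if "p \<in> prime_spectrum R" for p
    using that primeideal.one_compl by (auto simp: prime_spectrum_def)
  fix a b assume a: "a \<in> carrier R" and b: "b \<in> carrier R"
  have "\<exists>V. openin (zariski R) V \<and> p \<in> V \<and> V \<subseteq> prime_spectrum R \<and>
      (\<exists>a'\<in>carrier R. \<exists>f\<in>carrier R. \<forall>q\<in>V. f \<notin> q \<and> global_section R a q = frac R q a' f)"
    if "p \<in> prime_spectrum R" for p
    using op not1 a that
    by (intro exI[of _ "prime_spectrum R"] conjI bexI[of _ a] bexI[of _ \<one>]) (auto simp: global_section_def)
  moreover have "global_section R a \<in> (\<Pi>\<^sub>E p\<in>prime_spectrum R. carrier (localization R p))"
    using ring_hom_memE(1)[OF hom a] by (auto simp: global_section_def)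
  ultimately show "global_section R a \<in> carrier (Spec_sections R (prime_spectrum R))"
    by (simp add: Spec_sections_def)
  show "global_section R (a \<otimes> b) =
      global_section R a \<otimes>\<^bsub>Spec_sections R (prime_spectrum R)\<^esub> global_section R b"
    using ring_hom_memE(2)[OF hom a b]
    by (auto simp: global_section_def Spec_sections_def fun_eq_iff restrict_def)
  show "global_section R (a \<oplus> b) =
      global_section R a \<oplus>\<^bsub>Spec_sections R (prime_spectrum R)\<^esub> global_section R b"
    using ring_hom_memE(3)[OF hom a b]
    by (auto simp: global_section_def Spec_sections_def fun_eq_iff restrict_def)
next
  show "global_section R \<one> = \<one>\<^bsub>Spec_sections R (prime_spectrum R)\<^esub>"
    by (auto simp: global_section_def Spec_sections_def localization_def)
qed

text \<open>If two elements agree in all localizations, their difference is annihilated by a power of 1.\<close>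

lemma inj_global_section: "inj_on (global_section R) (carrier R)"
proof
  fix a b assume a: "a \<in> carrier R" and b: "b \<in> carrier R"
    and eq: "global_section R a = global_section R b"
  have "\<exists>u \<in> carrier R - p. u \<otimes> (a \<ominus> b) = \<zero>" if p: "primeideal p R" for p
  proof -
    interpret p: primeideal p R by fact
    have "frac R p a \<one> = frac R p b \<one>"
      using fun_cong[OF eq, of p] p by (simp add: global_section_def prime_spectrum_def)
    then obtain u where u: "u \<in> carrier R - p" "u \<otimes> (a \<otimes> \<one>) = u \<otimes> (b \<otimes> \<one>)"
      using a b p.one_compl p.frac_eq_iff[of a \<one> b \<one>] by auto
    then have "u \<otimes> (a \<ominus> b) = \<zero>" using a b by (simp add: minus_eq r_distr r_minus r_neg)
    then show ?thesis using u by blast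
  qed
  then obtain n :: nat where "\<one> [^] n \<otimes> (a \<ominus> b) = \<zero>"
    using locally_zero_imp_power_annihilates[of "a \<ominus> b" \<one>] a b by auto
  then show "a = b" using a b by (simp add: r_right_minus_eq)
qed

text \<open>A neighbourhood of \<open>p\<close> contains the set where some \<open>g \<notin> p\<close> does not vanish. Expanding the local
  fraction by \<open>g\<close> produces a fraction that is valid wherever its own denominator does not vanish.\<close>

lemma basic_open_fraction:
  assumes s: "s \<in> carrier (Spec_sections R (prime_spectrum R))" and p: "p \<in> prime_spectrum R"
  shows "\<exists>h \<in> carrier R - p. \<exists>a \<in> carrier R.
    \<forall>q. primeideal q R \<longrightarrow> h \<notin> q \<longrightarrow> s q = frac R q a h"
proof -
  have "\<exists>V. openin (zariski R) V \<and> p \<in> V \<and> V \<subseteq> prime_spectrum R \<and>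
      (\<exists>a\<in>carrier R. \<exists>f\<in>carrier R. \<forall>q\<in>V. f \<notin> q \<and> s q = frac R q a f)"
    using s p unfolding Spec_sections_def by simp
  then obtain V a f where V: "openin (zariski R) V" "p \<in> V" and a: "a \<in> carrier R" "f \<in> carrier R"
    and val: "\<And>q. q \<in> V \<Longrightarrow> f \<notin> q \<and> s q = frac R q a f"
    by (elim exE conjE bexE) (simp add: Ball_def)
  obtain E where E: "E \<subseteq> carrier R" "V = {p \<in> prime_spectrum R. \<not> E \<subseteq> p}"
    using V by (auto simp: openin_zariski zariski_open_def)
  then obtain g where g: "g \<in> E" "g \<notin> p" using V by auto
  then have gc: "g \<in> carrier R" using E by auto
  interpret p: primeideal p R using p by (simp add: prime_spectrum_def)
  show ?thesis
  proof (rule bexI[of _ "f \<otimes> g"], rule bexI[of _ "a \<otimes> g"], intro allI impI)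
    show "f \<otimes> g \<in> carrier R - p" using p.compl_closed[of f g] val[OF V(2)] a g gc by simp
    show "a \<otimes> g \<in> carrier R" using a gc by simp
    fix q assume q: "primeideal q R" "f \<otimes> g \<notin> q"
    interpret q: primeideal q R by fact
    have nq: "g \<notin> q" "f \<notin> q" using q a gc q.I_l_closed q.I_r_closed by auto
    then have "q \<in> V" using E g q by (auto simp: prime_spectrum_def)
    then show "s q = frac R q (a \<otimes> g) (f \<otimes> g)"
      using val q.frac_cancel[of a f g] nq a gc by simp
  qed
qed

lemma primes_cover_imp_one_in_ideal:
  assumes H: "H \<subseteq> carrier R" and cov: "\<And>p. primeideal p R \<Longrightarrow> \<not> H \<subseteq> p"
  shows "\<one> \<in> Idl H"
proof (rule ccontr)
  assume "\<one> \<notin> Idl H"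
  then obtain p where "primeideal p R" "Idl H \<subseteq> p"
    using exists_prime_above[OF genideal_ideal[OF H]] by blast
  then show False using cov genideal_self[OF H] by blast
qed

text \<open>The glueing argument. Finitely many \<open>h\<close> suffice to cover the spectrum by sets on which the section
  is a single fraction \<open>num h / h\<close>. Two of these fractions agree on the overlap, which means
  equality of the cross products up to a power of \<open>h \<otimes> h'\<close>. Expanding every fraction by
  \<open>h [^] N\<close> with \<open>N\<close> large enough makes the cross products equal. The numerator \<open>c\<close> of the global
  element must satisfy \<open>?D h \<otimes> c = ?A h\<close> for the new denominators \<open>?D h\<close> and numerators \<open>?A h\<close>.
  Instead of using coefficients of a partition of unity, the proof considers all \<open>r\<close> for which
  \<open>?D h \<otimes> c = ?A h \<otimes> r\<close> is solvable simultaneously in \<open>h\<close>: they form an ideal that contains all the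
  denominators and therefore 1.\<close>

lemma surj_global_section:
  assumes s: "s \<in> carrier (Spec_sections R (prime_spectrum R))"
  shows "\<exists>c \<in> carrier R. s = global_section R c"
proof -
  let ?ok = "\<lambda>h a. a \<in> carrier R \<and> (\<forall>q. primeideal q R \<longrightarrow> h \<notin> q \<longrightarrow> s q = frac R q a h)"
  let ?H = "{h \<in> carrier R. \<exists>a. ?ok h a}"
  have cov: "\<not> ?H \<subseteq> p" if "primeideal p R" for p
  proof -
    have "p \<in> prime_spectrum R" using that by (simp add: prime_spectrum_def)
    from basic_open_fraction[OF s this] obtain h a where h: "h \<in> carrier R - p" and "?ok h a"
      by (elim bexE) (rule that, assumption, rule conjI, assumption+)
    then have "h \<in> ?H" using h by blast
    then show ?thesis using h by blast
  qed
  have "\<one> \<in> Idl ?H" by (rule primes_cover_imp_one_in_ideal) (use cov in auto)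
  then obtain F where F: "finite F" "F \<subseteq> ?H" "\<one> \<in> Idl F"
    using finite_subset_generates_one[of ?H] by blast
  have Fc: "h \<in> carrier R" if "h \<in> F" for h using that F by auto
  have "\<forall>h\<in>F. \<exists>a. ?ok h a" using F(2) by blast
  then have "\<exists>num. \<forall>h\<in>F. ?ok h (num h)" by (rule bchoice)
  then obtain num where num0: "\<forall>h\<in>F. ?ok h (num h)" by (rule exE)
  have num: "?ok h (num h)" if "h \<in> F" for h by (rule bspec[OF num0 that])
  have numc: "num h \<in> carrier R" if "h \<in> F" for h using num that by blast
  have "\<exists>n::nat. (h \<otimes> h') [^] n \<otimes> (num h \<otimes> h' \<ominus> num h' \<otimes> h) = \<zero>" if h: "h \<in> F" "h' \<in> F" for h h'
  proof (rule locally_zero_imp_power_annihilates)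
    show "num h \<otimes> h' \<ominus> num h' \<otimes> h \<in> carrier R" "h \<otimes> h' \<in> carrier R"
      using h Fc numc by auto
    fix p assume p: "primeideal p R" "h \<otimes> h' \<notin> p"
    interpret p: primeideal p R by fact
    have np: "h \<notin> p" "h' \<notin> p" using p h Fc p.I_l_closed p.I_r_closed by auto
    then have "frac R p (num h) h = frac R p (num h') h'" using num h p by metis
    then obtain u where u: "u \<in> carrier R - p" "u \<otimes> (num h \<otimes> h') = u \<otimes> (num h' \<otimes> h)"
      using np h Fc numc p.frac_eq_iff[of "num h" h "num h'" h'] by auto
    then have "u \<otimes> (num h \<otimes> h' \<ominus> num h' \<otimes> h) = \<zero>"
      using h Fc numc by (simp add: minus_eq r_distr r_minus r_neg)
    then show "\<exists>u \<in> carrier R - p. u \<otimes> (num h \<otimes> h' \<ominus> num h' \<otimes> h) = \<zero>" using u by blast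
  qed
  then obtain e where e: "\<And>h h'. h \<in> F \<Longrightarrow> h' \<in> F \<Longrightarrow>
      (h \<otimes> h') [^] (e h h' :: nat) \<otimes> (num h \<otimes> h' \<ominus> num h' \<otimes> h) = \<zero>" by metis
  \<comment> \<open>one exponent for all pairs\<close>
  define N where "N = Max ((\<lambda>(h, h'). e h h') ` (F \<times> F))"
  have N: "(h \<otimes> h') [^] N \<otimes> (num h \<otimes> h' \<ominus> num h' \<otimes> h) = \<zero>" if h: "h \<in> F" "h' \<in> F" for h h'
  proof -
    have "e h h' \<le> N" unfolding N_def using F(1) h by (intro Max_ge) auto
    then have "(h \<otimes> h') [^] N = (h \<otimes> h') [^] (N - e h h') \<otimes> (h \<otimes> h') [^] e h h'"
      using h Fc by (simp add: nat_pow_mult)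
    then show ?thesis using h Fc numc e[OF h] by (simp add: m_assoc)
  qed
  let ?D = "\<lambda>h. h [^] Suc N"
  let ?A = "\<lambda>h. num h \<otimes> h [^] N"
  have comp: "?D h' \<otimes> ?A h = ?A h' \<otimes> ?D h" if h: "h \<in> F" "h' \<in> F" for h h'
  proof -
    have c: "h \<in> carrier R" "h' \<in> carrier R" "num h \<in> carrier R" "num h' \<in> carrier R"
      using h Fc numc by auto
    have "(h \<otimes> h') [^] N \<otimes> (num h \<otimes> h') \<ominus> (h \<otimes> h') [^] N \<otimes> (num h' \<otimes> h) = \<zero>"
      using N[OF h] c by (simp add: minus_eq r_distr r_minus)
    then have "(h \<otimes> h') [^] N \<otimes> (num h \<otimes> h') = (h \<otimes> h') [^] N \<otimes> (num h' \<otimes> h)"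
      using c by (subst (asm) r_right_minus_eq) auto
    then show ?thesis using c by (simp add: nat_pow_distrib m_ac)
  qed
  have Dc: "?D ` F \<subseteq> carrier R" using Fc by auto
  have Dp: "\<exists>h\<in>F. h \<notin> p" if p: "primeideal p R" for p
  proof (rule ccontr)
    interpret p: primeideal p R by fact
    assume "\<not> ?thesis"
    then have "Idl F \<subseteq> p" by (intro genideal_minimal p.is_ideal) auto
    then show False using F(3) p.one_compl by auto
  qed
  have powp: "h [^] (n::nat) \<notin> p" if "primeideal p R" "h \<in> carrier R - p" for p h n
    using that by (induction n) (auto simp: primeideal.one_compl dest: primeideal.I_prime intro: primeideal.one_compl[THEN DiffD2])
  have one: "\<one> \<in> Idl (?D ` F)"
  proof (rule primes_cover_imp_one_in_ideal[OF Dc])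
    fix p assume p: "primeideal p R"
    then obtain h where "h \<in> F" "h \<notin> p" using Dp by blast
    then show "\<not> ?D ` F \<subseteq> p" using powp[OF p, of h "Suc N"] Fc by blast
  qed
  \<comment> \<open>the ideal of all \<open>r\<close> for which \<open>r\<close> times the section is a global element\<close>
  let ?K = "{r \<in> carrier R. \<exists>c\<in>carrier R. \<forall>h\<in>F. ?D h \<otimes> c = ?A h \<otimes> r}"
  have "ideal ?K R"
  proof (rule cring_idealI)
    have "\<forall>h\<in>F. ?D h \<otimes> \<zero> = ?A h \<otimes> \<zero>" using Fc numc by simp
    then show "\<zero> \<in> ?K" by blast
    fix x y assume "x \<in> ?K" "y \<in> ?K"
    then obtain c d where c: "x \<in> carrier R" "y \<in> carrier R" "c \<in> carrier R" "d \<in> carrier R"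
      and "\<forall>h\<in>F. ?D h \<otimes> c = ?A h \<otimes> x" "\<forall>h\<in>F. ?D h \<otimes> d = ?A h \<otimes> y" by blast
    then have "\<forall>h\<in>F. ?D h \<otimes> (c \<oplus> d) = ?A h \<otimes> (x \<oplus> y)"
      using Fc numc by (simp add: r_distr del: nat_pow_Suc)
    then show "x \<oplus> y \<in> ?K" using c by blast
  next
    fix r x assume r: "r \<in> carrier R" and "x \<in> ?K"
    then obtain c where c: "x \<in> carrier R" "c \<in> carrier R" and eq: "\<And>h. h \<in> F \<Longrightarrow> ?D h \<otimes> c = ?A h \<otimes> x"
      by blast
    have "?D h \<otimes> (r \<otimes> c) = ?A h \<otimes> (r \<otimes> x)" if h: "h \<in> F" for h
    proof -
      have "?D h \<otimes> (r \<otimes> c) = r \<otimes> (?D h \<otimes> c)" using r c h Fc by (simp add: m_lcomm del: nat_pow_Suc)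
      also have "\<dots> = ?A h \<otimes> (r \<otimes> x)" unfolding eq[OF h] using r c h Fc numc by (simp add: m_lcomm)
      finally show ?thesis .
    qed
    then show "r \<otimes> x \<in> ?K" using r c by blast
  qed auto
  moreover have "?D ` F \<subseteq> ?K"
  proof
    fix d assume "d \<in> ?D ` F"
    then obtain h where h: "h \<in> F" "d = ?D h" by blast
    then have "\<forall>h'\<in>F. ?D h' \<otimes> ?A h = ?A h' \<otimes> d" using comp by blast
    then show "d \<in> ?K" using h Fc numc by (intro CollectI conjI bexI[of _ "?A h"]) auto
  qed
  ultimately have "Idl (?D ` F) \<subseteq> ?K" by (rule genideal_minimal)
  then have "\<one> \<in> ?K" using one by (rule subsetD)
  then obtain c where c: "c \<in> carrier R" "\<forall>h\<in>F. ?D h \<otimes> c = ?A h \<otimes> \<one>" by blast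
  have "s p = global_section R c p" for p
  proof (cases "p \<in> prime_spectrum R")
    case True
    then have p: "primeideal p R" by (simp add: prime_spectrum_def)
    interpret p: primeideal p R by fact
    obtain h where h: "h \<in> F" "h \<notin> p" using Dp[OF p] by blast
    have hc: "h \<in> carrier R" "h \<in> carrier R - p" "num h \<in> carrier R" "h [^] Suc N \<in> carrier R - p"
        "h [^] N \<in> carrier R - p"
      using h Fc numc powp[OF p, of h N] powp[OF p, of h "Suc N"] by (simp_all del: nat_pow_Suc)
    have "s p = frac R p (num h) h" using num h p by blast
    also have "\<dots> = frac R p (?A h) (?D h)"
      using p.frac_cancel[OF hc(3) hc(2) hc(5)] hc by (simp add: m_comm)
    also have "\<dots> = frac R p c \<one>"
    proof (rule p.frac_eqI)
      have "?D h \<otimes> c = ?A h \<otimes> \<one>" using c h by blast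
      then show "?A h \<otimes> \<one> = c \<otimes> ?D h" using c hc by (simp add: m_comm del: nat_pow_Suc)
    qed (use hc c p.one_compl in auto)
    finally show ?thesis using True by (simp add: global_section_def)
  next
    case False
    then have "s p = undefined" using s by (auto simp: Spec_sections_def PiE_def extensional_def)
    then show ?thesis using False by (simp add: global_section_def)
  qed
  then show ?thesis using c by blast
qed

theorem global_section_iso: "global_section R \<in> ring_iso R (Spec_sections R (prime_spectrum R))"
  using global_section_hom inj_global_section surj_global_section ring_hom_memE(1)[OF global_section_hom]
  by (auto simp: ring_iso_def bij_betw_def)

end

text \<open>The component of the isomorphism of sheaves at the whole space relates the global sections, and
  these are the two rings.\<close>

theorem isomorphic_Spec_imp_ring_iso:
  assumes A: "cring A" and B: "cring B"
    and \<alpha>: "\<And>a. \<alpha> a \<in> carrier A" and \<beta>: "\<And>a. \<beta> a \<in> carrier B"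
    and iso: "isomorphic_over (Spec \<alpha> A) (Spec \<beta> B)"
  obtains h where "h \<in> ring_iso B A" "\<And>a. h (\<beta> a) = \<alpha> a"
proof -
  interpret A: cring A by fact
  interpret B: cring B by fact
  let ?X = "Spec \<alpha> A" let ?Y = "Spec \<beta> B"
  let ?V = "prime_spectrum B" let ?U = "prime_spectrum A"
  obtain \<phi> \<psi> where hom: "homeomorphic_map (space ?X) (space ?Y) \<phi>"
    and iso: "\<forall>V. openin (space ?Y) V \<longrightarrow>
       \<psi> V \<in> ring_iso (sections ?Y V) (sections ?X {x \<in> topspace (space ?X). \<phi> x \<in> V}) \<and>
       (\<forall>a. \<psi> V (scalar ?Y V a) = scalar ?X {x \<in> topspace (space ?X). \<phi> x \<in> V} a)"
    using iso unfolding isomorphic_over_def Let_def by (elim exE conjE) (rule that, assumption+)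
  have op: "openin (space ?Y) ?V"
    using openin_topspace[of "zariski B"] by (simp add: Spec_def topspace_zariski)
  have "\<phi> ` topspace (space ?X) = topspace (space ?Y)"
    using homeomorphic_imp_surjective_map[OF hom] .
  then have pre: "{x \<in> topspace (space ?X). \<phi> x \<in> ?V} = ?U"
    by (auto simp: Spec_def topspace_zariski)
  have \<psi>: "\<psi> ?V \<in> ring_iso (Spec_sections B ?V) (Spec_sections A ?U)"
    and sc: "\<psi> ?V (global_section B (\<beta> a)) = global_section A (\<alpha> a)" for a
    using iso[rule_format, OF op] unfolding pre by (auto simp: Spec_def global_section_def)
  have "inv_into (carrier A) (global_section A) \<in> ring_iso (Spec_sections A ?U) A"
    by (rule ring_iso_set_sym[OF A.ring_axioms A.global_section_iso])
  then have "inv_into (carrier A) (global_section A) \<circ> (\<psi> ?V \<circ> global_section B) \<in> ring_iso B A"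
    using \<psi> B.global_section_iso by (intro ring_iso_set_trans)
  moreover have "(inv_into (carrier A) (global_section A) \<circ> (\<psi> ?V \<circ> global_section B)) (\<beta> a) = \<alpha> a" for a
    using A.inj_global_section \<alpha> by (simp add: sc)
  ultimately show ?thesis using that by blast
qed

section \<open>Polynomial rings and substitution\<close>

text \<open>Short names for the constants of \<open>Poly_Mapping\<close>.\<close>

abbreviation keys :: "('v \<Rightarrow>\<^sub>0 'b::zero) \<Rightarrow> 'v set" where
  "keys \<equiv> Poly_Mapping.keys"

abbreviation single :: "'v \<Rightarrow> 'b \<Rightarrow> ('v \<Rightarrow>\<^sub>0 'b::zero)" where
  "single \<equiv> Poly_Mapping.single"

abbreviation lookup :: "('v \<Rightarrow>\<^sub>0 'b::zero) \<Rightarrow> 'v \<Rightarrow> 'b" where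
  "lookup \<equiv> Poly_Mapping.lookup"

lemma keys_add_exp: "keys (s + t) = keys s \<union> keys t"
  for s t :: "'v \<Rightarrow>\<^sub>0 nat"
  by (auto simp: in_keys_iff lookup_add)

lemma vars_add: "vars (f + g) \<subseteq> vars f \<union> vars g"
  using Poly_Mapping.keys_add[of f g] unfolding vars_def by blast

lemma vars_mult: "vars (f * g) \<subseteq> vars f \<union> vars g"
  for f g :: "('v, 'k::comm_ring_1) mpoly"
  using keys_mult[of f g] unfolding vars_def by (fastforce simp: keys_add_exp)

lemma keys_uminus: "keys (- f) = keys (f :: ('v, 'k::ab_group_add) mpoly)"
  by (auto simp: in_keys_iff)

lemma vars_uminus: "vars (- f) = vars (f :: ('v, 'k::ab_group_add) mpoly)"
  by (simp add: vars_def keys_uminus)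

lemma vars_zero [simp]: "vars 0 = {}" and vars_one [simp]: "vars (1 :: ('v, 'k::zero_neq_one) mpoly) = {}"
  and vars_Const [simp]: "vars (Const c) = {}"
  and vars_Var [simp]: "vars (Var v :: ('v, 'k) mpoly) = {v}"
  by (auto simp: vars_def Const_def Var_def)

lemma Const_0 [simp]: "Const 0 = 0" and Const_1 [simp]: "Const 1 = 1"
  and Const_add: "Const (a + b) = Const a + Const b"
  and Const_mult: "Const (a * b) = (Const a * Const b :: ('v, 'k::comm_ring_1) mpoly)"
  by (auto simp: Const_def single_add mult_single)

lemma Const_eq_iff [simp]: "Const a = Const b \<longleftrightarrow> a = b"
  by (auto simp: Const_def dest: injD[OF inj_single])

lemma Const_eq_0_iff [simp]: "Const a = 0 \<longleftrightarrow> a = 0"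
  using Const_eq_iff[of a 0] by simp

lemma poly_ring_simps [simp]:
  "carrier (poly_ring V) = {f. vars f \<subseteq> V}"
  "(\<otimes>\<^bsub>poly_ring V\<^esub>) = (*)" "(\<oplus>\<^bsub>poly_ring V\<^esub>) = (+)"
  "\<one>\<^bsub>poly_ring V\<^esub> = 1" "\<zero>\<^bsub>poly_ring V\<^esub> = 0"
  by (simp_all add: poly_ring_def)

lemma vars_add_sub: "vars f \<subseteq> V \<Longrightarrow> vars g \<subseteq> V \<Longrightarrow> vars (f + g) \<subseteq> V"
  using vars_add[of f g] by auto

lemma vars_mult_sub: "vars f \<subseteq> V \<Longrightarrow> vars g \<subseteq> V \<Longrightarrow> vars (f * g) \<subseteq> V"
  for f g :: "('v, 'k::comm_ring_1) mpoly"
  using vars_mult[of f g] by auto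

lemma vars_diff_sub: "vars f \<subseteq> V \<Longrightarrow> vars g \<subseteq> V \<Longrightarrow> vars (f - g) \<subseteq> V"
  for f g :: "('v, 'k::comm_ring_1) mpoly"
  using vars_add[of f "- g"] vars_uminus[of g] by auto

lemma vars_sum_sub: "(\<And>i. i \<in> A \<Longrightarrow> vars (f i) \<subseteq> V) \<Longrightarrow> vars (sum f A) \<subseteq> V"
  by (induction A rule: infinite_finite_induct) (simp_all add: vars_add_sub)

lemma vars_power_sub: "vars f \<subseteq> V \<Longrightarrow> vars (f ^ n) \<subseteq> V"
  for f :: "('v, 'k::comm_ring_1) mpoly"
  by (induction n) (simp_all add: vars_mult_sub)

lemma vars_prod_sub: "(\<And>i. i \<in> A \<Longrightarrow> vars (f i) \<subseteq> V) \<Longrightarrow> vars (prod f A) \<subseteq> V"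
  for f :: "_ \<Rightarrow> ('v, 'k::comm_ring_1) mpoly"
  by (induction A rule: infinite_finite_induct) (simp_all add: vars_mult_sub)

lemma cring_poly_ring: "cring (poly_ring V :: ('v, 'k::field) mpoly ring)"
proof (rule cringI)
  show "abelian_group (poly_ring V :: ('v, 'k) mpoly ring)"
  proof (rule abelian_groupI)
    fix f assume "f \<in> carrier (poly_ring V :: ('v, 'k) mpoly ring)"
    then show "\<exists>g\<in>carrier (poly_ring V). g \<oplus>\<^bsub>poly_ring V\<^esub> f = \<zero>\<^bsub>poly_ring V\<^esub>"
      by (intro bexI[of _ "- f"]) (auto simp: vars_uminus)
  qed (auto intro: vars_add_sub[THEN subsetD] simp: add_ac)
  show "Group.comm_monoid (poly_ring V :: ('v, 'k) mpoly ring)"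
    by (rule comm_monoidI) (auto intro: vars_mult_sub[THEN subsetD] simp: mult_ac)
qed (auto simp: distrib_right)

lemma poly_ring_uminus:
  assumes "vars f \<subseteq> V"
  shows "\<ominus>\<^bsub>poly_ring V\<^esub> f = - (f :: ('v, 'k::field) mpoly)"
proof -
  interpret cring "poly_ring V :: ('v, 'k) mpoly ring" by (rule cring_poly_ring)
  show ?thesis using assms by (intro minus_equality) (auto simp: vars_uminus)
qed

lemma poly_ring_minus:
  assumes "vars f \<subseteq> V" "vars g \<subseteq> V"
  shows "f \<ominus>\<^bsub>poly_ring V\<^esub> g = (f - g :: ('v, 'k::field) mpoly)"
  using assms by (simp add: a_minus_def poly_ring_uminus)

definition mon_eval :: "('v \<Rightarrow> 'r) \<Rightarrow> ('v \<Rightarrow>\<^sub>0 nat) \<Rightarrow> 'r::comm_monoid_mult" where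
  "mon_eval g t = (\<Prod>v\<in>keys t. g v ^ lookup t v)"

lemma mon_eval_superset:
  "finite S \<Longrightarrow> keys t \<subseteq> S \<Longrightarrow> mon_eval g t = (\<Prod>v\<in>S. g v ^ lookup t v)"
  unfolding mon_eval_def by (rule prod.mono_neutral_left) (auto simp: in_keys_iff)

lemma mon_eval_add: "mon_eval g (s + t) = mon_eval g s * mon_eval g t"
proof -
  let ?S = "keys s \<union> keys t"
  have "mon_eval g (s + t) = (\<Prod>v\<in>?S. g v ^ lookup (s + t) v)"
    by (rule mon_eval_superset) (auto simp: keys_add_exp)
  also have "\<dots> = (\<Prod>v\<in>?S. g v ^ lookup s v) * (\<Prod>v\<in>?S. g v ^ lookup t v)"
    by (simp add: lookup_add power_add prod.distrib)
  also have "\<dots> = mon_eval g s * mon_eval g t"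
    by (subst (1 2) mon_eval_superset[of ?S]) auto
  finally show ?thesis .
qed

lemma mon_eval_0 [simp]: "mon_eval g 0 = 1" by (simp add: mon_eval_def)

lemma mon_eval_single [simp]: "mon_eval g (single v n) = g v ^ n"
  by (cases "n = 0") (auto simp: mon_eval_def)

definition subst :: "('v \<Rightarrow> ('w, 'k) mpoly) \<Rightarrow> ('v, 'k) mpoly \<Rightarrow> ('w, 'k::comm_ring_1) mpoly" where
  "subst g f = (\<Sum>t\<in>keys f. Const (lookup f t) * mon_eval g t)"

lemma subst_superset:
  "finite S \<Longrightarrow> keys f \<subseteq> S \<Longrightarrow> subst g f = (\<Sum>t\<in>S. Const (lookup f t) * mon_eval g t)"
  unfolding subst_def by (rule sum.mono_neutral_left) (auto simp: in_keys_iff)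

lemma subst_add: "subst g (f + f') = subst g f + subst g f'"
proof -
  let ?S = "keys f \<union> keys f'"
  have "subst g (f + f') = (\<Sum>t\<in>?S. Const (lookup (f + f') t) * mon_eval g t)"
    using Poly_Mapping.keys_add[of f f'] by (intro subst_superset) auto
  also have "\<dots> = (\<Sum>t\<in>?S. Const (lookup f t) * mon_eval g t) + (\<Sum>t\<in>?S. Const (lookup f' t) * mon_eval g t)"
    by (simp add: lookup_add Const_add distrib_right sum.distrib)
  also have "\<dots> = subst g f + subst g f'"
    by (subst (1 2) subst_superset[of ?S]) auto
  finally show ?thesis .
qed

lemma subst_0 [simp]: "subst g 0 = 0" by (simp add: subst_def)

lemma subst_sum: "subst g (sum f A) = (\<Sum>i\<in>A. subst g (f i))"
  by (induction A rule: infinite_finite_induct) (auto simp: subst_add)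

lemma subst_single: "subst g (single t c) = Const c * mon_eval g t"
  by (cases "c = 0") (auto simp: subst_def)

lemma poly_mapping_expand: "f = (\<Sum>t\<in>keys f. single t (lookup f t))"
proof (rule poly_mapping_eqI)
  fix k
  have "lookup (\<Sum>t\<in>keys f. single t (lookup f t)) k =
      (\<Sum>t\<in>keys f. if t = k then lookup f k else 0)"
    by (auto simp: lookup_sum lookup_single when_def intro!: sum.cong)
  also have "\<dots> = lookup f k" by (auto simp: in_keys_iff)
  finally show "lookup f k = lookup (\<Sum>t\<in>keys f. single t (lookup f t)) k" ..
qed

lemma subst_mult: "subst g (f * f') = subst g f * subst g f'"
proof -
  let ?s = "single"
  have "f * f' = (\<Sum>s\<in>keys f. \<Sum>t\<in>keys f'. ?s (s + t) (lookup f s * lookup f' t))"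
    by (subst (1) poly_mapping_expand[of f], subst (1) poly_mapping_expand[of f'])
      (simp add: sum_product mult_single)
  then have "subst g (f * f') = (\<Sum>s\<in>keys f. \<Sum>t\<in>keys f'.
      (Const (lookup f s) * mon_eval g s) * (Const (lookup f' t) * mon_eval g t))"
    by (simp add: subst_sum subst_single Const_mult mon_eval_add mult_ac)
  also have "\<dots> = subst g f * subst g f'" by (simp add: subst_def sum_product)
  finally show ?thesis .
qed

lemma subst_Const [simp]: "subst g (Const c) = Const c"
  unfolding Const_def[of c] by (simp add: subst_single Const_def)

lemma subst_1 [simp]: "subst g 1 = 1"
  using subst_Const[of g 1] by simp

lemma subst_Var [simp]: "subst g (Var v) = g v"
  by (simp add: Var_def subst_single)

lemma subst_uminus: "subst g (- f) = - subst g f"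
  using subst_add[of g f "- f"] by (simp add: eq_neg_iff_add_eq_0 add.commute)

lemma subst_diff: "subst g (f - f') = subst g f - subst g f'"
  by (simp add: subst_add subst_uminus flip: add_uminus_conv_diff)

lemma vars_subst:
  assumes "\<And>v. v \<in> vars f \<Longrightarrow> vars (g v) \<subseteq> W"
  shows "vars (subst g f) \<subseteq> W"
proof -
  have "vars (g v) \<subseteq> W" if "t \<in> keys f" "v \<in> keys t" for t v
    using that by (intro assms) (auto simp: vars_def)
  then show ?thesis
    unfolding subst_def mon_eval_def
    by (intro vars_sum_sub vars_mult_sub vars_prod_sub vars_power_sub) simp_all
qed

lemma Var_power: "Var v ^ n = single (single v n) (1 :: 'k::comm_ring_1)"
  by (induction n) (auto simp: Var_def mult_single single_add[symmetric])

lemma mon_eval_Var: "mon_eval Var t = single t (1 :: 'k::comm_ring_1)"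
proof -
  have prod: "(\<Prod>v\<in>S. single (e v) (1::'k)) = single (\<Sum>v\<in>S. e v) 1"
    if "finite S" for S and e :: "'a \<Rightarrow> 'a \<Rightarrow>\<^sub>0 nat"
    using that by induction (auto simp: mult_single)
  show ?thesis
    unfolding mon_eval_def Var_power
    by (subst prod) (use poly_mapping_expand[of t] in auto)
qed

lemma subst_Var_id: "subst Var f = f"
  unfolding subst_def mon_eval_Var
  by (subst (3) poly_mapping_expand[of f]) (simp add: Const_def mult_single)

text \<open>Every polynomial arises from constants and indeterminates by sums and products, as its expansion
  \<open>subst Var f = f\<close> shows.\<close>

lemma poly_ring_induct [consumes 1, case_names Const Var add mult]:
  fixes f :: "('v, 'k::comm_ring_1) mpoly"
  assumes f: "vars f \<subseteq> V"
    and c: "\<And>c. P (Const c)" and v: "\<And>v. v \<in> V \<Longrightarrow> P (Var v)"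
    and add: "\<And>f g. vars f \<subseteq> V \<Longrightarrow> vars g \<subseteq> V \<Longrightarrow> P f \<Longrightarrow> P g \<Longrightarrow> P (f + g)"
    and mult: "\<And>f g. vars f \<subseteq> V \<Longrightarrow> vars g \<subseteq> V \<Longrightarrow> P f \<Longrightarrow> P g \<Longrightarrow> P (f * g)"
  shows "P f"
proof -
  let ?Q = "\<lambda>f. vars f \<subseteq> V \<and> P f"
  have m: "?Q (f * g)" if "?Q f" "?Q g" for f g using that mult vars_mult_sub by blast
  have one: "?Q 1" using c[of 1] by simp
  have pow: "?Q (Var v ^ n)" if "v \<in> V" for v n
    by (induction n) (use one m v[OF that] that in auto)
  have prod: "?Q (\<Prod>i\<in>A. e i)" if "finite A" "\<And>i. i \<in> A \<Longrightarrow> ?Q (e i)"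
    for A :: "'v set" and e :: "'v \<Rightarrow> ('v, 'k) mpoly"
    using that
  proof (induction rule: finite_induct)
    case (insert x F)
    then have "?Q (e x * prod e F)" by (intro m) blast+
    then show ?case using insert.hyps by simp
  qed (use one in simp)
  have sum: "?Q (\<Sum>i\<in>A. e i)" if "finite A" "\<And>i. i \<in> A \<Longrightarrow> ?Q (e i)" for A and e :: "('v \<Rightarrow>\<^sub>0 nat) \<Rightarrow> _"
    using that
  proof (induction rule: finite_induct)
    case empty
    then show ?case using c[of 0] by simp
  next
    case (insert x F)
    then show ?case by (simp add: add vars_add_sub)
  qed
  have "?Q (subst Var f)"
    unfolding subst_def mon_eval_def
  proof (intro sum finite_keys m prod)
    fix t assume "t \<in> keys f"
    show "?Q (Const (lookup f t))" using c by simp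
    fix w assume "w \<in> keys t"
    with \<open>t \<in> _\<close> f show "?Q (Var w ^ lookup t w)" by (intro pow) (auto simp: vars_def)
  qed
  then show ?thesis by (simp add: subst_Var_id)
qed

lemma subst_subst: "subst g (subst h f) = subst (\<lambda>v. subst g (h v)) f"
proof -
  have "vars f \<subseteq> UNIV" by simp
  then show ?thesis by (induction f rule: poly_ring_induct) (simp_all add: subst_add subst_mult)
qed

lemma subst_cong:
  assumes "\<And>v. v \<in> vars f \<Longrightarrow> g v = h v"
  shows "subst g f = subst h f"
proof -
  have "g v = h v" if "t \<in> keys f" "v \<in> keys t" for t v
    using that by (intro assms) (auto simp: vars_def)
  then show ?thesis
    unfolding subst_def mon_eval_def
    by (intro sum.cong arg_cong2[where f = "(*)"] prod.cong refl) simp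
qed

lemma subst_hom:
  assumes "\<And>v. v \<in> V \<Longrightarrow> vars (g v) \<subseteq> W"
  shows "subst g \<in> Ring.ring_hom (poly_ring V) (poly_ring W :: ('w, 'k::field) mpoly ring)"
proof (rule ring_hom_memI)
  show "subst g f \<in> carrier (poly_ring W)" if "f \<in> carrier (poly_ring V)" for f
    using that assms vars_subst[of f g W] by auto
qed (simp_all add: subst_add subst_mult)

lemma domain_poly_ring: "domain (poly_ring V :: (nat, 'k::field) mpoly ring)"
proof -
  interpret cring "poly_ring V :: (nat, 'k) mpoly ring" by (rule cring_poly_ring)
  show ?thesis by unfold_locales auto
qed

text \<open>Addition of exponents is cancellative, so only one term of \<open>g\<close> contributes.\<close>

lemma lookup_single_mult:
  "lookup (single u c * g) (u + t) = c * lookup (g :: ('v, 'k::comm_ring_1) mpoly) t"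
proof -
  let ?s = "single"
  have "?s u c * g = (\<Sum>s\<in>keys g. ?s (u + s) (c * lookup g s))"
    by (subst (1) poly_mapping_expand[of g]) (simp add: sum_distrib_left mult_single)
  then have "lookup (?s u c * g) (u + t) = (\<Sum>s\<in>keys g. if s = t then c * lookup g t else 0)"
    by (auto simp: lookup_sum lookup_single when_def intro!: sum.cong)
  then show ?thesis by (auto simp: in_keys_iff)
qed

lemma single_Suc_neq_0 [simp]: "single v (Suc n) \<noteq> 0"
  using keys_single[of v "Suc n"] by (metis keys_zero insert_not_empty nat.distinct(1))

lemma single_Suc_0_eq_iff [simp]:
  "single v (Suc 0) = single w (Suc 0) \<longleftrightarrow> v = w"
  by (metis keys_single singleton_inject nat.distinct(1))

lemma poly_ideal:
  fixes I :: "('v, 'k::field) mpoly set"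
  assumes I: "ideal I (poly_ring V)"
  shows poly_ideal_vars: "f \<in> I \<Longrightarrow> vars f \<subseteq> V"
    and poly_ideal_0: "0 \<in> I"
    and poly_ideal_add: "f \<in> I \<Longrightarrow> g \<in> I \<Longrightarrow> f + g \<in> I"
    and poly_ideal_mult: "g \<in> I \<Longrightarrow> vars h \<subseteq> V \<Longrightarrow> h * g \<in> I"
proof -
  interpret ideal I "poly_ring V" by fact
  show "f \<in> I \<Longrightarrow> vars f \<subseteq> V" using Icarr by simp
  show "0 \<in> I" using additive_subgroup.zero_closed[OF is_additive_subgroup] unfolding poly_ring_simps .
  show "f \<in> I \<Longrightarrow> g \<in> I \<Longrightarrow> f + g \<in> I" using additive_subgroup.a_closed[OF is_additive_subgroup] by simp
  show "g \<in> I \<Longrightarrow> vars h \<subseteq> V \<Longrightarrow> h * g \<in> I" using I_l_closed[of g h] by simp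
qed

lemma poly_ideal_uminus: "ideal I (poly_ring V) \<Longrightarrow> f \<in> I \<Longrightarrow> - f \<in> (I :: ('v, 'k::field) mpoly set)"
  using poly_ideal_mult[of I V f "- 1"] by (simp add: vars_uminus)

lemma poly_ideal_diff: "ideal I (poly_ring V) \<Longrightarrow> f \<in> I \<Longrightarrow> g \<in> I \<Longrightarrow> f - g \<in> (I :: ('v, 'k::field) mpoly set)"
  using poly_ideal_add[of I V f "- g"] poly_ideal_uminus[of I V g] by simp

lemma poly_ideal_sum:
  "ideal I (poly_ring V) \<Longrightarrow> (\<And>a. a \<in> A \<Longrightarrow> f a \<in> I) \<Longrightarrow> sum f A \<in> (I :: ('v, 'k::field) mpoly set)"
  by (induction A rule: infinite_finite_induct) (auto intro: poly_ideal_0 poly_ideal_add)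

lemma poly_idealI:
  fixes I :: "('v, 'k::field) mpoly set"
  assumes "\<And>f. f \<in> I \<Longrightarrow> vars f \<subseteq> V" "0 \<in> I"
    and "\<And>f g. f \<in> I \<Longrightarrow> g \<in> I \<Longrightarrow> f + g \<in> I" "\<And>h g. vars h \<subseteq> V \<Longrightarrow> g \<in> I \<Longrightarrow> h * g \<in> I"
  shows "ideal I (poly_ring V)"
  by (rule cring.cring_idealI[OF cring_poly_ring]) (use assms in auto)


section \<open>The dimension of a polynomial ring\<close>

text \<open>A homogeneous linear system with unknowns indexed by \<open>T\<close> and fewer equations, indexed by \<open>B\<close>, has
  a nonzero solution: an equation is used to eliminate an unknown \<open>t0\<close>.\<close>

lemma homogeneous_system_has_solution:
  fixes a :: "'t \<Rightarrow> 'b \<Rightarrow> 'k::field"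
  assumes "finite B" "finite T" "card B < card T"
  shows "\<exists>u. (\<exists>t\<in>T. u t \<noteq> 0) \<and> (\<forall>b\<in>B. (\<Sum>t\<in>T. u t * a t b) = 0)"
  using assms
proof (induction B arbitrary: T a rule: finite_induct)
  case empty
  then have "T \<noteq> {}" by auto
  then show ?case by (intro exI[of _ "\<lambda>_. 1"]) auto
next
  case (insert b B)
  show ?case
  proof (cases "\<forall>t\<in>T. a t b = 0")
    case True
    obtain u where "\<exists>t\<in>T. u t \<noteq> 0" "\<forall>b\<in>B. (\<Sum>t\<in>T. u t * a t b) = 0"
      using insert.IH[of T a] insert.prems insert.hyps by auto
    then show ?thesis using True by (intro exI[of _ u]) auto
  next
    case False
    then obtain t0 where t0: "t0 \<in> T" "a t0 b \<noteq> 0" by auto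
    let ?T = "T - {t0}"
    have "card B < card ?T" using insert t0 by simp
    then obtain u where u: "\<exists>t\<in>?T. u t \<noteq> 0"
      "\<And>b'. b' \<in> B \<Longrightarrow> (\<Sum>t\<in>?T. u t * (a t b' - a t b / a t0 b * a t0 b')) = 0"
      using insert.IH[of ?T "\<lambda>t b'. a t b' - a t b / a t0 b * a t0 b'"] insert.prems by auto
    define c where "c = - (\<Sum>t\<in>?T. u t * (a t b / a t0 b))"
    let ?u = "\<lambda>t. if t = t0 then c else u t"
    have sum: "(\<Sum>t\<in>T. ?u t * a t b') = c * a t0 b' + (\<Sum>t\<in>?T. u t * a t b')" for b'
      using insert.prems t0 by (subst sum.remove[of T t0]) (auto intro!: sum.cong)
    have "(\<Sum>t\<in>T. ?u t * a t b) = 0"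
      unfolding sum unfolding c_def using t0 by (simp add: sum_distrib_right)
    moreover have "(\<Sum>t\<in>T. ?u t * a t b') = 0" if "b' \<in> B" for b'
    proof -
      have "(\<Sum>t\<in>?T. u t * a t b') = (\<Sum>t\<in>?T. u t * (a t b / a t0 b)) * a t0 b'"
        using u(2)[OF that] by (simp add: right_diff_distrib sum_subtractf sum_distrib_right mult.assoc)
      then show ?thesis unfolding sum unfolding c_def by simp
    qed
    ultimately show ?thesis using u(1) by (intro exI[of _ ?u]) auto
  qed
qed

definition exp_box :: "nat \<Rightarrow> nat \<Rightarrow> (nat \<Rightarrow>\<^sub>0 nat) set" where
  "exp_box d m = {t. keys t \<subseteq> {..<d} \<and> (\<forall>v. lookup t v \<le> m)}"

lemma exp_box_card: "finite (exp_box d m)" "card (exp_box d m) = (m + 1) ^ d"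
proof -
  let ?r = "\<lambda>t. restrict (lookup t) {..<d}"
  have "bij_betw ?r (exp_box d m) ({..<d} \<rightarrow>\<^sub>E {..m})"
  proof (rule bij_betw_imageI)
    show "inj_on ?r (exp_box d m)"
    proof
      fix s t assume st: "s \<in> exp_box d m" "t \<in> exp_box d m" "?r s = ?r t"
      show "s = t"
      proof (rule poly_mapping_eqI)
        fix v
        show "lookup s v = lookup t v"
        proof (cases "v < d")
          case True
          then show ?thesis using fun_cong[OF st(3), of v] by simp
        next
          case False
          then have "v \<notin> keys s" "v \<notin> keys t" using st by (auto simp: exp_box_def)
          then show ?thesis by (simp add: in_keys_iff)
        qed
      qed
    qed
    show "?r ` exp_box d m = {..<d} \<rightarrow>\<^sub>E {..m}"
    proof
      show "?r ` exp_box d m \<subseteq> {..<d} \<rightarrow>\<^sub>E {..m}" by (simp add: image_subset_iff PiE_iff exp_box_def)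
      show "{..<d} \<rightarrow>\<^sub>E {..m} \<subseteq> ?r ` exp_box d m"
      proof
        fix f assume f: "f \<in> {..<d} \<rightarrow>\<^sub>E {..m}"
        define t where "t = Abs_poly_mapping (\<lambda>v. if v < d then f v else 0)"
        have l: "lookup t v = (if v < d then f v else 0)" for v
          unfolding t_def by (subst lookup_Abs_poly_mapping) (auto intro: finite_subset[of _ "{..<d}"])
        have "lookup t v \<le> m" for v using PiE_mem[OF f, of v] by (simp add: l)
        moreover have "keys t \<subseteq> {..<d}" by (auto simp: in_keys_iff l split: if_splits)
        ultimately have "t \<in> exp_box d m" by (simp add: exp_box_def)
        moreover have "?r t = f"
        proof
          fix v show "?r t v = f v" using PiE_arb[OF f, of v] by (simp add: l)
        qed
        ultimately show "f \<in> ?r ` exp_box d m" by blast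
      qed
    qed
  qed
  note bij_betw_finite[OF this] bij_betw_same_card[OF this]
  then show "finite (exp_box d m)" "card (exp_box d m) = (m + 1) ^ d"
    by (simp_all add: card_PiE finite_PiE)
qed

text \<open>Individual exponents are bounded rather than total degrees, in accordance with \<open>exp_box\<close>.\<close>

definition exps_le :: "('v, 'k::zero) mpoly \<Rightarrow> nat \<Rightarrow> bool" where
  "exps_le f m \<longleftrightarrow> (\<forall>t\<in>keys f. \<forall>v. lookup t v \<le> m)"

lemma exps_le_mult: "exps_le f m \<Longrightarrow> exps_le g n \<Longrightarrow> exps_le (f * g) (m + n)"
  for f g :: "('v, 'k::comm_ring_1) mpoly"
  using keys_mult[of f g] unfolding exps_le_def by (fastforce simp: lookup_add intro: add_mono)

lemma exps_le_1: "exps_le (1 :: ('v, 'k::comm_ring_1) mpoly) 0"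
  by (simp add: exps_le_def)

lemma exps_le_mono: "exps_le f m \<Longrightarrow> m \<le> n \<Longrightarrow> exps_le f n"
  unfolding exps_le_def using le_trans by blast

lemma exps_le_power: "exps_le f m \<Longrightarrow> exps_le (f ^ n) (n * m)"
  for f :: "('v, 'k::comm_ring_1) mpoly"
  by (induction n) (auto simp: exps_le_1 intro: exps_le_mult)

lemma exps_le_prod:
  fixes f :: "_ \<Rightarrow> ('v, 'k::comm_ring_1) mpoly"
  shows "finite A \<Longrightarrow> (\<And>i. i \<in> A \<Longrightarrow> exps_le (f i) (m i)) \<Longrightarrow> exps_le (prod f A) (sum m A)"
  by (induction A rule: finite_induct) (auto simp: exps_le_1 intro!: exps_le_mult)

lemma ex_exps_le: "\<exists>m. exps_le f m"
proof -
  let ?S = "\<Union>t\<in>keys f. lookup t ` keys t"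
  have "lookup t v \<le> Max (insert 0 ?S)" if "t \<in> keys f" for t v
    using that by (cases "v \<in> keys t") (auto simp: in_keys_iff intro!: Max_ge)
  then show ?thesis unfolding exps_le_def by blast
qed

text \<open>A counting argument. There are \<open>N ^ (d + 1)\<close> monomials in \<open>x 0, \<dots>, x d\<close> with exponents below
  \<open>N\<close>. If \<open>D\<close> bounds the exponents in the \<open>x i\<close>, they all lie in the space of polynomials in \<open>d\<close>
  indeterminates with exponents at most \<open>N (d + 1) D\<close>, whose dimension only grows like \<open>N ^ d\<close>.\<close>

lemma algebraically_dependent:
  fixes x :: "nat \<Rightarrow> (nat, 'k::field) mpoly"
  assumes x: "\<And>i. i \<le> d \<Longrightarrow> vars (x i) \<subseteq> {..<d}"
  obtains Q where "Q \<noteq> 0" "vars Q \<subseteq> {..d}" "subst x Q = 0"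
proof -
  have "\<forall>i. \<exists>m. exps_le (x i) m" by (simp add: ex_exps_le)
  then obtain m where m: "\<And>i. exps_le (x i) (m i)" by metis
  define D where "D = sum m {..d}"
  have D: "exps_le (x i) D" if "i \<le> d" for i
    using m[of i] that member_le_sum[of i "{..d}" m] by (auto simp: D_def intro: exps_le_mono)
  \<comment> \<open>large enough for \<open>N ^ (d + 1)\<close> to exceed the number of monomials in the box below\<close>
  define N where "N = ((d + 1) * D + 1) ^ d + 1"
  let ?T = "exp_box (Suc d) (N - 1)"
  let ?B = "exp_box d (N * ((d + 1) * D))"
  have "card ?B = (N * ((d + 1) * D) + 1) ^ d" by (simp add: exp_box_card)
  also have "\<dots> \<le> (N * ((d + 1) * D + 1)) ^ d"
    by (rule power_mono) (simp_all add: N_def algebra_simps)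
  also have "\<dots> = N ^ d * ((d + 1) * D + 1) ^ d" by (rule power_mult_distrib)
  also have "\<dots> < N ^ d * N" by (simp add: N_def)
  also have "\<dots> = card ?T" by (simp add: exp_box_card N_def)
  finally have "card ?B < card ?T" .
  with exp_box_card(1) exp_box_card(1)
  have "\<exists>u. (\<exists>t\<in>?T. u t \<noteq> 0) \<and> (\<forall>b\<in>?B. (\<Sum>t\<in>?T. u t * lookup (mon_eval x t) b) = 0)"
    by (rule homogeneous_system_has_solution)
  then obtain u where u: "\<exists>t\<in>?T. u t \<noteq> 0"
    and u0: "\<forall>b\<in>?B. (\<Sum>t\<in>?T. u t * lookup (mon_eval x t) b) = 0"
    by (elim exE conjE) (rule that)
  define Q where "Q = (\<Sum>t\<in>?T. single t (u t))"
  have lQ: "lookup Q t = (if t \<in> ?T then u t else 0)" for t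
    unfolding Q_def by (simp add: lookup_sum lookup_single when_def exp_box_card)
  have keysB: "keys (mon_eval x t) \<subseteq> ?B" if t: "t \<in> ?T" for t
  proof
    have k: "keys t \<subseteq> {..d}" using t by (auto simp: exp_box_def less_Suc_eq_le)
    have e: "exps_le (mon_eval x t) (\<Sum>v\<in>keys t. lookup t v * D)"
      unfolding mon_eval_def using D k by (intro exps_le_prod exps_le_power) auto
    have "(\<Sum>v\<in>keys t. lookup t v * D) \<le> (\<Sum>v\<in>keys t. N * D)"
      using t by (intro sum_mono mult_right_mono) (auto simp: exp_box_def intro: le_trans)
    also have "\<dots> = card (keys t) * (N * D)" by simp
    also have "\<dots> \<le> (d + 1) * (N * D)"
      using card_mono[of "{..d}" "keys t"] k by (intro mult_le_mono1) simp
    also have "\<dots> = N * ((d + 1) * D)" by (simp add: algebra_simps)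
    finally have e': "exps_le (mon_eval x t) (N * ((d + 1) * D))"
      by (rule exps_le_mono[OF e])
    have v: "vars (mon_eval x t) \<subseteq> {..<d}"
      unfolding mon_eval_def using x k by (intro vars_prod_sub vars_power_sub) auto
    fix b assume "b \<in> keys (mon_eval x t)"
    then show "b \<in> ?B" using e' v by (auto simp: exp_box_def exps_le_def vars_def)
  qed
  show ?thesis
  proof (rule that)
    show "Q \<noteq> 0" using u lQ by (metis lookup_zero)
    show "vars Q \<subseteq> {..d}"
    proof -
      have "keys Q \<subseteq> ?T" using lQ by (auto simp: in_keys_iff split: if_splits)
      then have "keys t \<subseteq> {..<Suc d}" if "t \<in> keys Q" for t
        using that by (auto simp: exp_box_def)
      then show ?thesis unfolding vars_def by (simp add: UN_subset_iff lessThan_Suc_atMost)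
    qed
    have s: "subst x Q = (\<Sum>t\<in>?T. Const (u t) * mon_eval x t)"
      unfolding Q_def by (simp add: subst_sum subst_single)
    show "subst x Q = 0"
    proof (rule poly_mapping_eqI)
      fix b
      have l: "lookup (Const c * f) b = c * lookup f b" for c and f :: "(nat, 'k) mpoly"
        using lookup_single_mult[of 0 c f b] by (simp add: Const_def)
      have "lookup (subst x Q) b = (\<Sum>t\<in>?T. u t * lookup (mon_eval x t) b)"
        unfolding s by (simp add: lookup_sum l)
      also have "\<dots> = 0"
      proof (cases "b \<in> ?B")
        case True
        then show ?thesis by (rule bspec[OF u0])
      next
        case False
        have "lookup (mon_eval x t) b = 0" if "t \<in> ?T" for t
          using keysB[OF that] False by (auto simp: in_keys_iff)
        then show ?thesis by simp
      qed
      finally show "lookup (subst x Q) b = lookup 0 b" by simp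
    qed
  qed
qed

text \<open>The step of the dimension bound. Split \<open>Q = A + Var k * R\<close>, where \<open>A\<close> consists of the terms
  without the indeterminate \<open>k\<close>. If \<open>A \<noteq> 0\<close>, then \<open>A\<close> is as required because \<open>x k\<close> is in \<open>P'\<close>. If
  \<open>A = 0\<close>, then \<open>x k \<notin> P\<close> and primality of \<open>P\<close> put the value of \<open>R\<close> into \<open>P\<close>, and the degree of \<open>R\<close>
  in \<open>k\<close> is smaller.\<close>

lemma drop_variable:
  fixes x :: "nat \<Rightarrow> (nat, 'k::field) mpoly"
  assumes P: "primeideal P (poly_ring W)" and P': "ideal P' (poly_ring W)" "P \<subseteq> P'"
    and x: "x k \<in> P'" "x k \<notin> P" and xW: "\<And>i. i \<in> {k..d} \<Longrightarrow> vars (x i) \<subseteq> W" and k: "k \<le> d"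
    and Q: "Q \<noteq> 0" "vars Q \<subseteq> {k..d}" "subst x Q \<in> P" "\<forall>t\<in>keys Q. lookup t k \<le> N"
  shows "\<exists>A. A \<noteq> 0 \<and> vars A \<subseteq> {Suc k..d} \<and> subst x A \<in> P'"
  using Q
proof (induction N arbitrary: Q)
  case 0
  have "k \<notin> vars Q" using "0.prems"(4) by (auto simp: vars_def in_keys_iff)
  moreover have "{k..d} \<subseteq> insert k {Suc k..d}" by auto
  ultimately have "vars Q \<subseteq> {Suc k..d}" using "0.prems"(2) by blast
  then show ?case using "0.prems" P' by blast
next
  case (Suc N)
  interpret P: primeideal P "poly_ring W" by fact
  interpret P': ideal P' "poly_ring W" by fact
  let ?s = "single"
  let ?e = "?s k (1::nat)"
  define K0 where "K0 = {t \<in> keys Q. lookup t k = 0}"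
  define K1 where "K1 = {t \<in> keys Q. lookup t k \<noteq> 0}"
  define A where "A = (\<Sum>t\<in>K0. ?s t (lookup Q t))"
  define R where "R = (\<Sum>t\<in>K1. ?s (t - ?e) (lookup Q t))"
  have fin: "finite K0" "finite K1" by (auto simp: K0_def K1_def)
  have te: "?e + (t - ?e) = t" if "t \<in> K1" for t
    by (rule poly_mapping_eqI) (use that in \<open>auto simp: K1_def lookup_add lookup_minus lookup_single when_def\<close>)
  have lA: "lookup A t = (if t \<in> K0 then lookup Q t else 0)" for t
    unfolding A_def using fin by (simp add: lookup_sum lookup_single when_def)
  have keysR: "keys R \<subseteq> (\<lambda>t. t - ?e) ` K1"
    unfolding R_def using keys_sum[of "\<lambda>t. ?s (t - ?e) (lookup Q t)" K1] by (fastforce split: if_splits)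
  have "Q = (\<Sum>t\<in>K0 \<union> K1. ?s t (lookup Q t))"
  proof -
    have "K0 \<union> K1 = keys Q" by (auto simp: K0_def K1_def)
    then show ?thesis using poly_mapping_expand[of Q] by simp
  qed
  also have "\<dots> = A + (\<Sum>t\<in>K1. ?s t (lookup Q t))"
    unfolding A_def using fin by (intro sum.union_disjoint) (auto simp: K0_def K1_def)
  also have "(\<Sum>t\<in>K1. ?s t (lookup Q t)) = Var k * R"
    unfolding R_def Var_def sum_distrib_left by (intro sum.cong refl) (simp add: mult_single te del: One_nat_def)
  finally have QAR: "Q = A + Var k * R" .
  have vA: "vars A \<subseteq> {Suc k..d}"
  proof
    fix v assume "v \<in> vars A"
    then obtain t where "t \<in> K0" "v \<in> keys t"
      by (auto simp: vars_def in_keys_iff lA split: if_splits)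
    then have "v \<in> vars Q" unfolding vars_def K0_def by blast
    then have "v \<in> {k..d}" using Suc.prems(2) by blast
    moreover have "v \<noteq> k" using \<open>t \<in> K0\<close> \<open>v \<in> keys t\<close> by (auto simp: K0_def in_keys_iff)
    ultimately show "v \<in> {Suc k..d}" by auto
  qed
  have vR: "vars R \<subseteq> {k..d}"
  proof
    fix v assume "v \<in> vars R"
    then obtain s where "s \<in> keys R" "v \<in> keys s" unfolding vars_def by blast
    then obtain t where "t \<in> K1" "v \<in> keys (t - ?e)" using keysR by blast
    then have "t \<in> keys Q" "v \<in> keys t"
      by (auto simp: K1_def in_keys_iff lookup_minus)
    then have "v \<in> vars Q" unfolding vars_def by blast
    then show "v \<in> {k..d}" using Suc.prems(2) by blast
  qed
  have "vars (x v) \<subseteq> W" if "v \<in> vars R \<union> vars A" for v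
    using that vR vA by (intro xW) auto
  then have xR: "vars (subst x R) \<subseteq> W" and xA: "vars (subst x A) \<subseteq> W" "vars (x k) \<subseteq> W"
    using xW[of k] k by (simp_all add: vars_subst)
  have sQ: "subst x Q = subst x A + x k * subst x R" unfolding QAR by (simp add: subst_add subst_mult)
  show ?case
  proof (cases "A = 0")
    case False
    have "subst x R \<otimes>\<^bsub>poly_ring W\<^esub> x k \<in> P'" using x xR by (intro P'.I_l_closed) auto
    then have 1: "x k * subst x R \<in> P'" by (simp add: mult.commute)
    have "(- 1) \<otimes>\<^bsub>poly_ring W\<^esub> (x k * subst x R) \<in> P'"
      using 1 by (intro P'.I_l_closed) (auto simp: vars_uminus)
    then have "subst x Q \<oplus>\<^bsub>poly_ring W\<^esub> (- 1) \<otimes>\<^bsub>poly_ring W\<^esub> (x k * subst x R) \<in> P'"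
      using Suc.prems(3) P'(2) by (intro P'.a_closed) auto
    then have "subst x A \<in> P'" by (simp add: sQ)
    then show ?thesis using False vA by blast
  next
    case True
    have "x k \<otimes>\<^bsub>poly_ring W\<^esub> subst x R \<in> P" using sQ Suc.prems(3) True by simp
    then have "subst x R \<in> P" using P.I_prime[of "x k" "subst x R"] x xR xA by auto
    moreover have "R \<noteq> 0" using QAR True Suc.prems(1) by auto
    moreover have "\<forall>t\<in>keys R. lookup t k \<le> N"
    proof
      fix t assume "t \<in> keys R"
      then obtain s where "s \<in> keys Q" "t = s - ?e" using keysR by (auto simp: K1_def)
      then show "lookup t k \<le> N" using Suc.prems(4) by (auto simp: lookup_minus)
    qed
    ultimately show ?thesis using Suc.IH vR by blast
  qed
qed

text \<open>In a longer chain choose \<open>x i\<close> in \<open>P (Suc i)\<close> but not in \<open>P i\<close> for all \<open>i \<le> d\<close>. An algebraic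
  relation between these \<open>d + 1\<close> polynomials has a value in \<open>P 0\<close>. Dropping one indeterminate at each step of
  the chain turns it into a nonzero constant in \<open>P (Suc d)\<close>.\<close>

theorem prime_chain_poly_ring_le:
  fixes P :: "nat \<Rightarrow> (nat, 'k::field) mpoly set"
  assumes P: "prime_chain (poly_ring {..<d}) e P"
  shows "e \<le> d"
proof (rule ccontr)
  assume "\<not> e \<le> d"
  let ?B = "poly_ring {..<d} :: (nat, 'k) mpoly ring"
  have pr: "primeideal (P i) ?B" if "i \<le> Suc d" for i
    using P that \<open>\<not> e \<le> d\<close> by (simp add: prime_chain_def)
  have "P i \<subset> P (Suc i)" if "i \<le> d" for i
    using P that \<open>\<not> e \<le> d\<close> by (simp add: prime_chain_def)
  then have "\<exists>y. y \<in> P (Suc i) \<and> y \<notin> P i" if "i \<le> d" for i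
    using that by blast
  then obtain x where x: "\<And>i. i \<le> d \<Longrightarrow> x i \<in> P (Suc i) \<and> x i \<notin> P i" by metis
  have xc: "vars (x i) \<subseteq> {..<d}" if "i \<le> d" for i
    using additive_subgroup.a_Hcarr[of "P (Suc i)" ?B "x i"] pr[of "Suc i"] x[OF that] that
    by (auto simp: primeideal_def ideal_def)
  have step: "\<exists>Q. Q \<noteq> 0 \<and> vars Q \<subseteq> {k..d} \<and> subst x Q \<in> P k" if "k \<le> Suc d" for k
    using that
  proof (induction k)
    case 0
    interpret P0: primeideal "P 0" ?B by (rule pr) simp
    obtain Q where Q: "Q \<noteq> 0" "vars Q \<subseteq> {..d}" "subst x Q = 0"
      using algebraically_dependent[of d x] xc by blast
    have "0 \<in> P 0"
      using additive_subgroup.zero_closed[OF P0.is_additive_subgroup] unfolding poly_ring_simps .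
    then show ?case using Q by (intro exI[of _ Q]) (simp add: atMost_atLeast0)
  next
    case (Suc k)
    then obtain Q where Q: "Q \<noteq> 0" "vars Q \<subseteq> {k..d}" "subst x Q \<in> P k" by auto
    obtain N where "exps_le Q N" using ex_exps_le by blast
    moreover have "ideal (P (Suc k)) ?B" using pr[of "Suc k"] Suc.prems by (simp add: primeideal_def)
    moreover have "P k \<subset> P (Suc k)"
      using P Suc.prems \<open>\<not> e \<le> d\<close> by (simp add: prime_chain_def)
    ultimately show ?case
      using Suc.prems Q x xc pr
      by (intro drop_variable[of "P k" "{..<d}" "P (Suc k)" x k d Q N]) (auto simp: exps_le_def)
  qed
  interpret Pd: primeideal "P (Suc d)" ?B by (rule pr) simp
  obtain Q where Q: "Q \<noteq> 0" "vars Q \<subseteq> {Suc d..d}" "subst x Q \<in> P (Suc d)" using step by blast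
  have "keys Q \<subseteq> {0}" using Q(2) by (auto simp: vars_def)
  then have Qc: "Q = Const (lookup Q 0)"
    by (intro poly_mapping_eqI) (auto simp: Const_def lookup_single when_def in_keys_iff)
  let ?c = "lookup Q 0"
  have c: "?c \<noteq> 0" using Q(1) Qc by (metis Const_0)
  have "Const ?c \<in> P (Suc d)" using Q(3) by (subst (asm) Qc) simp
  then have "Const (1 / ?c) \<otimes>\<^bsub>?B\<^esub> Const ?c \<in> P (Suc d)"
    by (intro Pd.I_l_closed) auto
  then have "\<one>\<^bsub>?B\<^esub> \<in> P (Suc d)" using c by (simp add: Const_mult[symmetric])
  then show False using Pd.one_imp_carrier Pd.I_notcarr by auto
qed

section \<open>Polynomial rings are Noetherian\<close>

lemma nat_sequence_nondecreasing_subsequence: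
  fixes s :: "nat \<Rightarrow> nat"
  obtains r :: "nat \<Rightarrow> nat" where "strict_mono r" "\<And>i j. i \<le> j \<Longrightarrow> s (r i) \<le> s (r j)"
proof -
  obtain f where f: "strict_mono f" "monoseq (\<lambda>n. s (f n))" using seq_monosub[of s] by blast
  then consider "\<forall>m n. m \<le> n \<longrightarrow> s (f m) \<le> s (f n)" | "\<forall>m n. m \<le> n \<longrightarrow> s (f n) \<le> s (f m)"
    unfolding monoseq_def by blast
  then show ?thesis
  proof cases
    case 1
    then show ?thesis using that[of f] f(1) by simp
  next
    case 2
    \<comment> \<open>a nonincreasing sequence of natural numbers is constant from its minimum on\<close>
    obtain n0 where n0: "\<And>n. s (f n0) \<le> s (f n)"
      using ex_has_least_nat[of "\<lambda>_. True" 0 "\<lambda>n. s (f n)"] by auto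
    have "s (f (i + n0)) = s (f n0)" for i using 2 n0 by (simp add: le_antisym)
    moreover have "strict_mono (\<lambda>i. f (i + n0))" using f(1) by (simp add: strict_mono_def)
    ultimately show ?thesis using that[of "\<lambda>i. f (i + n0)"] by simp
  qed
qed

lemma common_nondecreasing_subsequence:
  fixes g :: "nat \<Rightarrow> nat \<Rightarrow> nat"
  shows "\<exists>r :: nat \<Rightarrow> nat. strict_mono r \<and> (\<forall>v<d. \<forall>i j. i \<le> j \<longrightarrow> g (r i) v \<le> g (r j) v)"
proof (induction d)
  case 0
  show ?case by (intro exI[of _ id]) (simp add: strict_mono_def)
next
  case (Suc d)
  then obtain r :: "nat \<Rightarrow> nat" where r: "strict_mono r"
    and mono: "\<forall>v<d. \<forall>i j. i \<le> j \<longrightarrow> g (r i) v \<le> g (r j) v"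
    by (elim exE conjE) (rule that)
  obtain q :: "nat \<Rightarrow> nat" where q: "strict_mono q" "\<And>i j. i \<le> j \<Longrightarrow> g (r (q i)) d \<le> g (r (q j)) d"
    by (rule nat_sequence_nondecreasing_subsequence[of "\<lambda>i. g (r i) d"]) (rule that, assumption+)
  have "q i \<le> q j" if "i \<le> j" for i j using q(1) that by (simp add: strict_mono_less_eq)
  then have "g (r (q i)) v \<le> g (r (q j)) v" if "v < Suc d" "i \<le> j" for v i j
    using mono q(2) that by (cases "v = d") auto
  then have "\<forall>v<Suc d. \<forall>i j. i \<le> j \<longrightarrow> g ((r \<circ> q) i) v \<le> g ((r \<circ> q) j) v" by simp
  then show ?case using strict_mono_o[OF r q(1)] by blast
qed

lemma mon_dvd_iff: "(\<exists>u. t = s + u) \<longleftrightarrow> (\<forall>v. lookup s v \<le> lookup t v)" for s t :: "'v \<Rightarrow>\<^sub>0 nat"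
proof
  assume "\<forall>v. lookup s v \<le> lookup t v"
  then have "t = s + (t - s)" by (intro poly_mapping_eqI) (simp add: lookup_add lookup_minus)
  then show "\<exists>u. t = s + u" by blast
qed (auto simp: lookup_add)

text \<open>A sequence of exponent vectors has a subsequence in which every one of the \<open>d\<close> coordinates is
  nondecreasing; its first two members will do.\<close>

lemma dickson:
  fixes f :: "nat \<Rightarrow> mon"
  assumes "\<And>i. f i \<in> terms d"
  obtains i j where "i < j" "mon_dvd (f i) (f j)"
proof -
  obtain r :: "nat \<Rightarrow> nat" where r: "strict_mono r"
    and mono: "\<forall>v<d. \<forall>i j. i \<le> j \<longrightarrow> lookup (f (r i)) v \<le> lookup (f (r j)) v"
    using common_nondecreasing_subsequence[of d "\<lambda>i. lookup (f i)"] by (elim exE conjE) (rule that)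
  have "lookup (f (r 0)) v \<le> lookup (f (r 1)) v" for v
  proof (cases "v < d")
    case False
    then have "v \<notin> keys (f (r 0))" using assms[of "r 0"] by (auto simp: terms_def)
    then show ?thesis by (simp add: in_keys_iff)
  qed (use mono in simp)
  then have "mon_dvd (f (r 0)) (f (r 1))" by (simp add: mon_dvd_def mon_dvd_iff)
  moreover have "r 0 < r 1" using r by (simp add: strict_mono_def)
  ultimately show ?thesis using that by blast
qed

text \<open>In an infinite descending sequence some member would divide a later one, and divisors are not
  larger in the lexicographic order.\<close>

lemma wf_terms: "wf {(s, t). s \<in> terms d \<and> t \<in> terms d \<and> s < t}"
  unfolding wf_iff_no_infinite_down_chain
proof
  assume "\<exists>f. \<forall>i. (f (Suc i), f i) \<in> {(s, t). s \<in> terms d \<and> t \<in> terms d \<and> s < t}"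
  then obtain f where f: "\<And>i. f i \<in> terms d" "\<And>i. f (Suc i) < f i" by blast
  then obtain i j where ij: "i < j" "mon_dvd (f i) (f j)" using dickson by metis
  have "f j < f i"
    using ij(1)
  proof (induction j)
    case (Suc j)
    then show ?case using f(2)[of j] by (cases "i = j") (auto intro: less_trans)
  qed simp
  obtain u where "f j = f i + u" using ij(2) by (auto simp: mon_dvd_def)
  moreover have "0 \<le> u"
  proof (rule ccontr)
    assume "\<not> 0 \<le> u"
    then have "u < 0" by simp
    then show False by transfer (auto simp: less_fun_def)
  qed
  ultimately have "f i \<le> f j" using add_left_mono[of 0 u "f i"] by simp
  then show False using \<open>f j < f i\<close> by simp
qed

text \<open>Otherwise one could choose monomials from \<open>L\<close> one after the other, none of them divisible by an
  earlier one.\<close>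

lemma finite_divisibility_basis:
  assumes L: "L \<subseteq> terms d"
  obtains F where "finite F" "F \<subseteq> L" "\<And>t. t \<in> L \<Longrightarrow> \<exists>s\<in>F. mon_dvd s t"
proof (rule ccontr)
  note basis = that
  assume no: "\<not> thesis"
  have ex: "\<exists>t. t \<in> L \<and> (\<forall>s\<in>F. \<not> mon_dvd s t)" if "finite F" "F \<subseteq> L" for F
  proof (rule ccontr)
    assume "\<not> ?thesis"
    then show False using no basis[OF that] by blast
  qed
  \<comment> \<open>a monomial of \<open>L\<close> that is not divisible by any element of \<open>F\<close>\<close>
  define pick where "pick F = (SOME t. t \<in> L \<and> (\<forall>s\<in>F. \<not> mon_dvd s t))" for F
  have n: "pick F \<in> L \<and> (\<forall>s\<in>F. \<not> mon_dvd s (pick F))" if "finite F" "F \<subseteq> L" for F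
    unfolding pick_def by (rule someI_ex[OF ex[OF that]])
  define S where "S = rec_nat {} (\<lambda>_ F. insert (pick F) F)"
  have S: "S 0 = {}" "S (Suc i) = insert (pick (S i)) (S i)" for i by (simp_all add: S_def)
  have fin: "finite (S i) \<and> S i \<subseteq> L" for i by (induction i) (use n in \<open>auto simp: S\<close>)
  have mem: "pick (S i) \<in> S j" if "i < j" for i j
    using that by (induction j) (auto simp: S less_Suc_eq)
  have nS: "pick (S i) \<in> L \<and> (\<forall>s\<in>S i. \<not> mon_dvd s (pick (S i)))" for i
    using n[of "S i"] fin[of i] by blast
  have "pick (S i) \<in> terms d" for i using nS[of i] L by blast
  then obtain i j where ij: "i < j" "mon_dvd (pick (S i)) (pick (S j))" by (rule dickson)
  then show False using nS[of j] mem[OF ij(1)] by blast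
qed

text \<open>The maximum refers to the lexicographic order on finitely supported functions.\<close>

definition lead_mon :: "(nat, 'k::zero) mpoly \<Rightarrow> mon" where
  "lead_mon f = Max (keys f)"

lemma lead_mon_in: "f \<noteq> 0 \<Longrightarrow> lead_mon f \<in> keys f"
  unfolding lead_mon_def by (intro Max_in) auto

lemma lead_mon_ge: "t \<in> keys f \<Longrightarrow> t \<le> lead_mon f"
  unfolding lead_mon_def by (intro Max_ge) auto

lemma lead_term_cancel:
  fixes f g :: "(nat, 'k::field) mpoly"
  assumes f: "f \<noteq> 0" and g: "g \<noteq> 0" and u: "lead_mon f = u + lead_mon g"
  defines "c \<equiv> lookup f (lead_mon f) / lookup g (lead_mon g)"
  assumes ne: "f - single u c * g \<noteq> 0"
  shows "lead_mon (f - single u c * g) < lead_mon f"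
proof -
  let ?f = "f - single u c * g"
  have "lookup g (lead_mon g) \<noteq> 0" using lead_mon_in[OF g] by (simp add: in_keys_iff)
  then have "lookup ?f (lead_mon f) = 0"
    unfolding lookup_minus by (subst (2) u) (simp add: lookup_single_mult c_def)
  then have "lead_mon ?f \<noteq> lead_mon f"
    using lead_mon_in[OF ne] by (auto simp: in_keys_iff)
  moreover have "t \<le> lead_mon f" if "t \<in> keys ?f" for t
  proof (cases "t \<in> keys f")
    case False
    then have "t \<in> keys (single u c * g)"
      using that by (auto simp: in_keys_iff lookup_minus)
    then obtain s where "s \<in> keys g" "t = u + s"
      using keys_mult[of "single u c" g] by (auto split: if_splits)
    then show ?thesis unfolding u using lead_mon_ge add_left_mono by blast
  qed (rule lead_mon_ge)
  ultimately show ?thesis using lead_mon_in[OF ne] by fastforce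
qed

text \<open>Choose finitely many elements \<open>G\<close> of the ideal whose leading monomials divide those of all others.
  Subtracting multiples of elements of \<open>G\<close> lowers the leading monomial as long as the difference is
  not zero, which cannot go on forever.\<close>

theorem hilbert_basis: "noetherian_ring (poly_ring {..<d} :: (nat, 'k::field) mpoly ring)"
proof -
  let ?B = "poly_ring {..<d} :: (nat, 'k) mpoly ring"
  interpret cring ?B by (rule cring_poly_ring)
  show ?thesis
  proof (rule noetherian_ringI)
    fix J assume J: "ideal J ?B"
    interpret J: ideal J ?B by fact
    have Jv: "vars f \<subseteq> {..<d}" if "f \<in> J" for f using J.Icarr[OF that] by simp
    have terms: "t \<in> terms d" if "f \<in> J" "t \<in> keys f" for f t
      using Jv[OF that(1)] that(2) unfolding terms_def vars_def by blast
    let ?L = "lead_mon ` (J - {0})"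
    have "?L \<subseteq> terms d" using lead_mon_in terms by blast
    then obtain F where F: "finite F" "F \<subseteq> ?L" "\<And>t. t \<in> ?L \<Longrightarrow> \<exists>s\<in>F. mon_dvd s t"
      using finite_divisibility_basis by metis
    obtain G where G: "G \<subseteq> J - {0}" "finite G" "F = lead_mon ` G"
      using finite_subset_image[OF F(1,2)] by blast
    have Gc: "G \<subseteq> carrier ?B" using G J.a_subset by blast
    interpret K: ideal "Idl\<^bsub>?B\<^esub> G" ?B by (rule genideal_ideal[OF Gc])
    have GK: "G \<subseteq> Idl\<^bsub>?B\<^esub> G" by (rule genideal_self[OF Gc])
    have "f \<in> Idl\<^bsub>?B\<^esub> G" if "lead_mon f = t" "f \<in> J" for f t
      using that
    proof (induction t arbitrary: f rule: wf_induct_rule[OF wf_terms[of d]])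
      case (1 t)
      show ?case
      proof (cases "f = 0")
        case True
        then show ?thesis
          using additive_subgroup.zero_closed[OF K.is_additive_subgroup] unfolding poly_ring_simps by simp
      next
        case False
        have t: "t \<in> terms d" using terms lead_mon_in False 1(2,3) by blast
        obtain g where g: "g \<in> G" "mon_dvd (lead_mon g) t"
          using F(3)[of t] 1(2,3) False unfolding G(3) by blast
        then obtain u where u: "lead_mon f = u + lead_mon g"
          using 1(2) by (auto simp: mon_dvd_def add.commute)
        have g0: "g \<noteq> 0" "g \<in> J" using g G by auto
        define c where "c = lookup f (lead_mon f) / lookup g (lead_mon g)"
        let ?m = "single u c"
        have mc: "vars ?m \<subseteq> {..<d}" "vars (- ?m) \<subseteq> {..<d}"
          using t unfolding 1(2)[symmetric] u vars_uminus by (auto simp: vars_def terms_def keys_add_exp)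
        have "g \<in> Idl\<^bsub>?B\<^esub> G" using g(1) GK by blast
        then have m: "- ?m * g \<in> J" "?m * g \<in> Idl\<^bsub>?B\<^esub> G"
          using J.I_l_closed[of g "- ?m"] K.I_l_closed[of g ?m] g0(2) mc by simp_all
        have "f \<oplus>\<^bsub>?B\<^esub> (- ?m * g) \<in> J" using m(1) 1(3) by (rule J.a_closed[rotated])
        then have f': "f - ?m * g \<in> J" by simp
        have "f - ?m * g \<in> Idl\<^bsub>?B\<^esub> G"
        proof (cases "f - ?m * g = 0")
          case True
          then show ?thesis
            using additive_subgroup.zero_closed[OF K.is_additive_subgroup] unfolding poly_ring_simps by simp
        next
          case ne: False
          have "lead_mon (f - ?m * g) < t"
            using lead_term_cancel[OF False g0(1) u] ne 1(2) by (simp add: c_def)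
          moreover have "lead_mon (f - ?m * g) \<in> terms d"
            using terms[OF f' lead_mon_in[OF ne]] .
          ultimately show ?thesis using 1(1) t f' by blast
        qed
        then have "(f - ?m * g) \<oplus>\<^bsub>?B\<^esub> (?m * g) \<in> Idl\<^bsub>?B\<^esub> G" using m(2) by (rule K.a_closed)
        then show ?thesis by simp
      qed
    qed
    then have "J \<subseteq> Idl\<^bsub>?B\<^esub> G" by blast
    moreover have "Idl\<^bsub>?B\<^esub> G \<subseteq> J" using G by (intro genideal_minimal J) auto
    ultimately show "\<exists>G\<subseteq>carrier ?B. finite G \<and> J = Idl\<^bsub>?B\<^esub> G" using Gc G(2) by blast
  qed
qed

section \<open>Rational points of affine space are regular\<close>

text \<open>For a surjective homomorphism \<open>h\<close>, taking preimages embeds the ideals of the target into those of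
  the source. So finite generation and bounds on chains of prime ideals descend to the target.\<close>

locale surj_cring_hom = ring_hom_cring +
  assumes surj: "h ` carrier R = carrier S"
begin

lemma image_vimage:
  assumes "J \<subseteq> carrier S"
  shows "h ` {r \<in> carrier R. h r \<in> J} = J"
  using assms unfolding surj[symmetric] by auto

lemma genideal_of_vimage:
  assumes J: "ideal J S" and F: "F \<subseteq> carrier R" "{r \<in> carrier R. h r \<in> J} = Idl\<^bsub>R\<^esub> F"
  shows "J = Idl\<^bsub>S\<^esub> (h ` F)"
proof
  interpret J: ideal J S by fact
  have Fc: "h ` F \<subseteq> carrier S" using F by auto
  have FJ: "F \<subseteq> {r \<in> carrier R. h r \<in> J}" unfolding F(2) by (rule R.genideal_self[OF F(1)])
  then show "Idl\<^bsub>S\<^esub> (h ` F) \<subseteq> J" by (intro S.genideal_minimal J) auto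
  have K: "ideal (Idl\<^bsub>S\<^esub> (h ` F)) S" by (rule S.genideal_ideal[OF Fc])
  have "F \<subseteq> {r \<in> carrier R. h r \<in> Idl\<^bsub>S\<^esub> (h ` F)}" using F(1) S.genideal_self[OF Fc] by auto
  then have "Idl\<^bsub>R\<^esub> F \<subseteq> {r \<in> carrier R. h r \<in> Idl\<^bsub>S\<^esub> (h ` F)}"
    by (rule R.genideal_minimal[OF ring.ideal_vimage[OF K]])
  then show "J \<subseteq> Idl\<^bsub>S\<^esub> (h ` F)"
    using image_vimage[OF J.a_subset] unfolding F(2) by blast
qed

lemma noetherian_image:
  assumes "noetherian_ring R"
  shows "noetherian_ring S"
proof (rule S.noetherian_ringI)
  fix J assume J: "ideal J S"
  obtain F where F: "F \<subseteq> carrier R" "finite F" "{r \<in> carrier R. h r \<in> J} = Idl\<^bsub>R\<^esub> F"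
    using noetherian_ring.finetely_gen[OF assms ring.ideal_vimage[OF J]] by blast
  then show "\<exists>G\<subseteq>carrier S. finite G \<and> J = Idl\<^bsub>S\<^esub> G"
    using genideal_of_vimage[OF J F(1,3)] by (intro exI[of _ "h ` F"]) auto
qed

lemma prime_chain_vimage:
  assumes "prime_chain S e Q"
  shows "prime_chain R e (\<lambda>i. {r \<in> carrier R. h r \<in> Q i})"
proof -
  have sub: "Q i \<subseteq> carrier S" if "i \<le> e" for i
    using assms that by (simp add: prime_chain_def primeideal_def ideal_def additive_subgroup.a_subset)
  have "{r \<in> carrier R. h r \<in> Q i} \<subset> {r \<in> carrier R. h r \<in> Q (Suc i)}" if "i < e" for i
  proof -
    have Q: "Q i \<subset> Q (Suc i)" using assms that by (simp add: prime_chain_def)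
    then have "{r \<in> carrier R. h r \<in> Q i} \<subseteq> {r \<in> carrier R. h r \<in> Q (Suc i)}" by blast
    moreover have "{r \<in> carrier R. h r \<in> Q i} \<noteq> {r \<in> carrier R. h r \<in> Q (Suc i)}"
    proof
      assume eq: "{r \<in> carrier R. h r \<in> Q i} = {r \<in> carrier R. h r \<in> Q (Suc i)}"
      have "Q i = h ` {r \<in> carrier R. h r \<in> Q i}" using that by (intro image_vimage[symmetric] sub) simp
      also have "\<dots> = Q (Suc i)" unfolding eq using that by (intro image_vimage sub) simp
      finally show False using Q by blast
    qed
    ultimately show ?thesis by blast
  qed
  moreover have "primeideal {r \<in> carrier R. h r \<in> Q i} R" if "i \<le> e" for i
    using assms that by (intro prime_vimage) (simp add: prime_chain_def)
  ultimately show ?thesis by (simp add: prime_chain_def)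
qed

end

lemma kernel_prime:
  fixes g :: "nat \<Rightarrow> (nat, 'k::field) mpoly"
  assumes "\<And>v. v \<in> V \<Longrightarrow> vars (g v) \<subseteq> W"
  shows "primeideal {f. vars f \<subseteq> V \<and> subst g f = 0} (poly_ring V)"
proof -
  interpret W: "domain" "poly_ring W :: (nat, 'k) mpoly ring" by (rule domain_poly_ring)
  interpret h: ring_hom_cring "poly_ring V" "poly_ring W :: (nat, 'k) mpoly ring" "subst g"
    using subst_hom[OF assms]
    by (intro ring_hom_cring.intro cring_poly_ring ring_hom_cring_axioms.intro)
  show ?thesis using h.prime_vimage[OF W.zeroprimeideal] by simp
qed

text \<open>By assumption every \<open>Var j\<close> is congruent to some constant \<open>a j\<close> modulo \<open>q\<close>. Modulo the differences
  \<open>Var j - Const (a j)\<close> every polynomial is congruent to its value at \<open>a\<close>. A nonzero constant is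
  not in \<open>q\<close>, so these differences generate \<open>q\<close>. The member \<open>P i\<close> of the chain is the kernel of
  substituting \<open>a j\<close> for the indeterminates \<open>j < i\<close>.\<close>

lemma rational_point_generators_and_chain:
  fixes q :: "(nat, 'k::field) mpoly set"
  assumes q: "primeideal q (poly_ring {..<d})" and res: "\<And>f. vars f \<subseteq> {..<d} \<Longrightarrow> \<exists>c. f - Const c \<in> q"
  shows "\<exists>G P. G \<subseteq> carrier (poly_ring {..<d}) \<and> finite G \<and> card G = d \<and> q = Idl\<^bsub>poly_ring {..<d}\<^esub> G \<and>
    prime_chain (poly_ring {..<d}) d P \<and> (\<forall>i\<le>d. P i \<subseteq> q)"
proof -
  let ?B = "poly_ring {..<d} :: (nat, 'k) mpoly ring"
  interpret q: primeideal q ?B by fact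
  have "\<forall>j. \<exists>c. j < d \<longrightarrow> Var j - Const c \<in> q" using res[of "Var _"] by simp
  then obtain a where a: "\<And>j. j < d \<Longrightarrow> Var j - Const (a j) \<in> q" by metis
  let ?g = "\<lambda>j. Var j - Const (a j) :: (nat, 'k) mpoly"
  let ?G = "?g ` {..<d}"
  have gv: "vars (?g j) \<subseteq> {..<d}" if "j < d" for j using that by (intro vars_diff_sub) simp_all
  then have Gc: "?G \<subseteq> carrier ?B" by (simp add: image_subset_iff)
  have inj: "inj_on ?g {..<d}"
  proof
    fix i j assume eq: "?g i = ?g j"
    have l: "lookup (?g i) (single j 1) = (if i = j then 1 else 0)" for i j
      by (auto simp: lookup_minus Var_def Const_def lookup_single when_def)
    show "i = j" using l[of i j] l[of j j] eq by (auto split: if_splits)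
  qed
  interpret K: ideal "Idl\<^bsub>?B\<^esub> ?G" ?B by (rule q.genideal_ideal[OF Gc])
  have K0: "0 \<in> Idl\<^bsub>?B\<^esub> ?G"
    using additive_subgroup.zero_closed[OF K.is_additive_subgroup] unfolding poly_ring_simps .
  have Kadd: "f + g \<in> Idl\<^bsub>?B\<^esub> ?G" if "f \<in> Idl\<^bsub>?B\<^esub> ?G" "g \<in> Idl\<^bsub>?B\<^esub> ?G" for f g
    using K.a_closed[OF that] by simp
  have Kmult: "f * g \<in> Idl\<^bsub>?B\<^esub> ?G" if "g \<in> Idl\<^bsub>?B\<^esub> ?G" "vars f \<subseteq> {..<d}" for f g
    using K.I_l_closed[of g f] that by simp
  let ?ev = "subst (\<lambda>j. Const (a j) :: (nat, 'k) mpoly)"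
  have ev: "vars (?ev f) \<subseteq> {}" for f by (intro vars_subst) simp
  have evc: "\<exists>c. ?ev f = Const c" for f
  proof -
    have "keys (?ev f) \<subseteq> {0}" using ev[of f] by (auto simp: vars_def)
    then have "?ev f = Const (lookup (?ev f) 0)"
      by (intro poly_mapping_eqI) (auto simp: Const_def lookup_single when_def in_keys_iff)
    then show ?thesis by blast
  qed
  have cong: "f - ?ev f \<in> Idl\<^bsub>?B\<^esub> ?G" if "vars f \<subseteq> {..<d}" for f
    using that
  proof (induction f rule: poly_ring_induct)
    case (Const c)
    then show ?case using K0 by simp
  next
    case (Var v)
    then show ?case using q.genideal_self[OF Gc] by auto
  next
    case (add f g)
    then show ?case using Kadd[of "f - ?ev f" "g - ?ev g"] by (simp add: subst_add algebra_simps)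
  next
    case (mult f g)
    have "vars (?ev g) \<subseteq> {..<d}" using ev[of g] by blast
    then have "f * (g - ?ev g) + ?ev g * (f - ?ev f) \<in> Idl\<^bsub>?B\<^esub> ?G"
      using mult by (intro Kadd Kmult) auto
    then show ?case by (simp add: subst_mult algebra_simps)
  qed
  have Kq: "Idl\<^bsub>?B\<^esub> ?G \<subseteq> q" using a by (intro q.genideal_minimal q.is_ideal) auto
  have ev0: "?ev f = 0" if "f \<in> q" for f
  proof -
    have "vars f \<subseteq> {..<d}" using q.Icarr[OF that] by simp
    then have "f - ?ev f \<in> q" using cong Kq by blast
    then have "f - (f - ?ev f) \<in> q" by (rule poly_ideal_diff[OF q.is_ideal that])
    then have e: "?ev f \<in> q" by simp
    obtain c where c: "?ev f = Const c" using evc by blast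
    have "c = 0"
    proof (rule ccontr)
      assume "c \<noteq> 0"
      have "Const (1 / c) \<otimes>\<^bsub>?B\<^esub> ?ev f \<in> q" using e by (intro q.I_l_closed) auto
      then have "\<one>\<^bsub>?B\<^esub> \<in> q" using \<open>c \<noteq> 0\<close> by (simp add: c Const_mult[symmetric])
      then show False using q.one_imp_carrier q.I_notcarr by auto
    qed
    then show ?thesis using c by simp
  qed
  have "q \<subseteq> Idl\<^bsub>?B\<^esub> ?G"
  proof
    fix f assume f: "f \<in> q"
    then have "vars f \<subseteq> {..<d}" using q.Icarr by fastforce
    then show "f \<in> Idl\<^bsub>?B\<^esub> ?G" using cong[of f] ev0[OF f] by simp
  qed
  with Kq have qG: "q = Idl\<^bsub>?B\<^esub> ?G" by blast
  define \<sigma> where "\<sigma> i j = (if j < i then Const (a j) else Var j :: (nat, 'k) mpoly)" for i j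
  define P where "P i = {f. vars f \<subseteq> {..<d} \<and> subst (\<sigma> i) f = 0}" for i
  have Pd: "P d \<subseteq> q"
  proof
    fix f assume "f \<in> P d"
    then have f: "vars f \<subseteq> {..<d}" "subst (\<sigma> d) f = 0" by (auto simp: P_def)
    have "subst (\<sigma> d) f = ?ev f" using f(1) by (intro subst_cong) (auto simp: \<sigma>_def)
    then show "f \<in> q" using cong[OF f(1)] f(2) qG by simp
  qed
  have Pi: "P i \<subset> P (Suc i)" if "i < d" for i
  proof
    show "P i \<subseteq> P (Suc i)"
    proof
      fix f assume f: "f \<in> P i"
      have "subst (\<sigma> (Suc i)) f = subst (\<sigma> (Suc i)) (subst (\<sigma> i) f)"
        unfolding subst_subst by (intro subst_cong) (auto simp: \<sigma>_def)
      then show "f \<in> P (Suc i)" using f by (simp add: P_def)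
    qed
    have "?g i \<in> P (Suc i)" using Gc that by (auto simp: P_def subst_diff \<sigma>_def)
    moreover have "?g i \<notin> P i"
    proof
      assume "?g i \<in> P i"
      then have "?g i = 0" by (simp add: P_def subst_diff \<sigma>_def)
      then have "lookup (?g i) (single i 1) = 0" by simp
      then show False by (simp add: lookup_minus Var_def Const_def lookup_single when_def)
    qed
    ultimately show "P i \<noteq> P (Suc i)" by blast
  qed
  have "primeideal (P i) ?B" for i
    unfolding P_def by (rule kernel_prime[where W = "{..<d}"]) (auto simp: \<sigma>_def)
  with Pi have chain: "prime_chain ?B d P" by (simp add: prime_chain_def)
  have "P i \<subseteq> P d" if "i \<le> d" for i
    using that by (induction i rule: inc_induct) (use Pi in blast)+
  then have "\<forall>i\<le>d. P i \<subseteq> q" using Pd by blast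
  moreover have "card ?G = d" using card_image[OF inj] by simp
  ultimately show ?thesis using Gc qG chain by (intro exI[of _ ?G] exI[of _ P]) simp
qed

text \<open>The assumption on \<open>q\<close> says that the residue field at \<open>q\<close> is the ground field. Generators and
  chains of prime ideals are transported along \<open>h\<close> and its inverse.\<close>

theorem regular_at_rational_point:
  fixes h :: "(nat, 'k::field) mpoly \<Rightarrow> 'a"
  assumes A: "cring A" and h: "h \<in> ring_iso (poly_ring {..<d}) A" and q: "primeideal q A"
    and res: "\<And>x. x \<in> carrier A \<Longrightarrow> \<exists>c. x \<ominus>\<^bsub>A\<^esub> h (Const c) \<in> q"
  shows "regular_local_ring (localization A q)"
proof -
  let ?B = "poly_ring {..<d} :: (nat, 'k) mpoly ring"
  interpret h: cring_iso A ?B h using A h cring_poly_ring by (simp add: cring_iso_def)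
  interpret q: primeideal q A by fact
  interpret sh: surj_cring_hom ?B A h
    by unfold_locales (use h.bij in \<open>simp add: bij_betw_def\<close>)
  let ?k = "inv_into (carrier ?B) h"
  interpret k: cring_iso ?B A ?k by (rule h.inverse)
  interpret sk: surj_cring_hom A ?B ?k
    by unfold_locales (use k.bij in \<open>simp add: bij_betw_def\<close>)
  let ?q = "{r \<in> carrier ?B. h r \<in> q}"
  have pq: "primeideal ?q ?B" by (rule h.h.prime_vimage[OF q])
  have "\<exists>c. f - Const c \<in> ?q" if f: "vars f \<subseteq> {..<d}" for f
  proof -
    obtain c where c: "h f \<ominus>\<^bsub>A\<^esub> h (Const c) \<in> q" using res[of "h f"] f by auto
    have "h (f - Const c) = h (f \<ominus>\<^bsub>?B\<^esub> Const c)" using f by (simp add: poly_ring_minus)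
    also have "\<dots> = h f \<ominus>\<^bsub>A\<^esub> h (Const c)" 
      using f h.h.hom_add[of f "\<ominus>\<^bsub>?B\<^esub> Const c"] h.h.hom_a_inv[of "Const c"] h.B.a_inv_closed[of "Const c"]
      by (simp add: a_minus_def)
    finally show ?thesis using c f vars_diff_sub[of f "{..<d}" "Const c"] by auto
  qed
  then obtain G P where G: "G \<subseteq> carrier ?B" "finite G" "card G = d" "?q = Idl\<^bsub>?B\<^esub> G"
    and P: "prime_chain ?B d P" "\<forall>i\<le>d. P i \<subseteq> ?q"
    using rational_point_generators_and_chain[OF pq] by blast
  have card: "card (h ` G) = d"
    using G(1,3) h.bij by (subst card_image) (auto simp: bij_betw_def intro: inj_on_subset)
  have dom: "domain A"
    using domain.ring_iso_imp_img_domain[OF domain_poly_ring h] h.h.hom_one h.h.hom_zero by simp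
  show ?thesis
  proof (rule q.regular_localizationI[where G = "h ` G"])
    show "noetherian_ring A" by (rule sh.noetherian_image[OF hilbert_basis])
    show "domain A" by (rule dom)
    show "h ` G \<subseteq> carrier A" "finite (h ` G)" using G by auto
    show "q = Idl\<^bsub>A\<^esub> (h ` G)" by (rule sh.genideal_of_vimage[OF q.is_ideal G(1,4)])
    show "prime_chain A (card (h ` G)) (\<lambda>i. {r \<in> carrier A. ?k r \<in> P i})"
      unfolding card by (rule sk.prime_chain_vimage[OF P(1)])
    show "{r \<in> carrier A. ?k r \<in> P i} \<subseteq> q" if "i \<le> card (h ` G)" for i
    proof
      fix r assume "r \<in> {r \<in> carrier A. ?k r \<in> P i}"
      then have "r \<in> carrier A" "?k r \<in> ?q" using P(2) that card by auto
      then show "r \<in> q" using sh.surj by (simp add: f_inv_into_f)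
    qed
    show "e \<le> card (h ` G)" if "prime_chain A e Q" for e Q
      unfolding card using prime_chain_poly_ring_le[OF sh.prime_chain_vimage[OF that]] .
  qed
qed

section \<open>Graded quotients of polynomial rings\<close>

lemma poly_quot:
  fixes I :: "('v, 'k::field) mpoly set"
  assumes I: "ideal I (poly_ring V)"
  shows cring_poly_quot: "cring (poly_ring V Quot I)"
    and surj_poly_quot: "surj_cring_hom (poly_ring V) (poly_ring V Quot I) ((+>\<^bsub>poly_ring V\<^esub>) I)"
    and poly_quot_eq_iff: "\<And>f g. vars f \<subseteq> V \<Longrightarrow> vars g \<subseteq> V \<Longrightarrow>
      I +>\<^bsub>poly_ring V\<^esub> f = I +>\<^bsub>poly_ring V\<^esub> g \<longleftrightarrow> f - g \<in> I"
proof -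
  interpret P: cring "poly_ring V :: ('v, 'k) mpoly ring" by (rule cring_poly_ring)
  interpret I: ideal I "poly_ring V" by fact
  show A: "cring (poly_ring V Quot I)" by (rule I.quotient_is_cring[OF P.is_cring])
  interpret hom: ring_hom_cring "poly_ring V" "poly_ring V Quot I" "(+>\<^bsub>poly_ring V\<^esub>) I"
    using I.rcos_ring_hom by (intro ring_hom_cring.intro P.is_cring A ring_hom_cring_axioms.intro)
  show "surj_cring_hom (poly_ring V) (poly_ring V Quot I) ((+>\<^bsub>poly_ring V\<^esub>) I)"
    by unfold_locales (auto simp: FactRing_def A_RCOSETS_def')
  show "I +>\<^bsub>poly_ring V\<^esub> f = I +>\<^bsub>poly_ring V\<^esub> g \<longleftrightarrow> f - g \<in> I"
    if "vars f \<subseteq> V" "vars g \<subseteq> V" for f g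
    using P.quotient_eq_iff_same_a_r_cos[OF I, of f g] that by (simp add: poly_ring_minus)
qed

lemma exp_add_eq_0_iff: "s + t = 0 \<longleftrightarrow> s = 0 \<and> t = 0" for s t :: "'v \<Rightarrow>\<^sub>0 nat"
  by (auto simp: poly_mapping_eq_iff lookup_add fun_eq_iff)

text \<open>An indeterminate is not a product of two nontrivial monomials.\<close>

lemma exp_add_eq_single:
  fixes s t :: "'v \<Rightarrow>\<^sub>0 nat"
  assumes "s + t = single v 1"
  shows "s = 0 \<and> t = single v 1 \<or> s = single v 1 \<and> t = 0"
proof -
  have l: "lookup s u + lookup t u = (if u = v then 1 else 0)" for u
    using arg_cong[OF assms, of "\<lambda>p. lookup p u"] by (simp add: lookup_add lookup_single when_def)
  then have z: "lookup s u = 0 \<and> lookup t u = 0" if "u \<noteq> v" for u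
    using that by (metis add_is_0)
  consider "lookup s v = 0" "lookup t v = 1" | "lookup s v = 1" "lookup t v = 0"
    using l[of v] by (auto simp: add_eq_if split: if_splits)
  then show ?thesis
  proof cases
    case 1
    then have "s = 0" "t = single v 1"
      using z by (auto intro!: poly_mapping_eqI simp: lookup_single when_def) (metis gr0I)+
    then show ?thesis by simp
  next
    case 2
    then have "t = 0" "s = single v 1"
      using z by (auto intro!: poly_mapping_eqI simp: lookup_single when_def) (metis gr0I)+
    then show ?thesis by simp
  qed
qed

lemma lookup_mult_expand:
  "lookup (f * g) k = (\<Sum>s\<in>keys f. lookup (single s (lookup f s) * g) k)"
  for f g :: "('v, 'k::comm_ring_1) mpoly"
  by (subst (1) poly_mapping_expand[of f]) (simp add: sum_distrib_right lookup_sum)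

lemma lookup_single_mult_eq_0:
  fixes g :: "('v, 'k::comm_ring_1) mpoly"
  assumes "\<And>t. s + t \<noteq> k"
  shows "lookup (single s c * g) k = 0"
proof -
  have "k \<notin> keys (single s c * g)"
    using keys_mult[of "single s c" g] assms by (auto split: if_splits)
  then show ?thesis by (simp add: in_keys_iff)
qed

text \<open>The coefficients of the linear part of \<open>f\<close>. For \<open>f\<close> in the ideal \<open>m\<close> of the origin they are the
  coordinates of the class of \<open>f\<close> in the cotangent space \<open>m/m\<^sup>2\<close>.\<close>

definition lin :: "('v, 'k::zero) mpoly \<Rightarrow> 'v \<Rightarrow> 'k" where
  "lin f v = lookup f (single v 1)"

lemma lookup_mult_0: "lookup (f * g) 0 = lookup f 0 * lookup g 0"
  for f g :: "('v, 'k::comm_ring_1) mpoly"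
proof -
  have "lookup (single s c * g) 0 = (if s = 0 then c * lookup g 0 else 0)" for s c
    using lookup_single_mult[of 0 c g 0] lookup_single_mult_eq_0[of s 0 c g]
    by (auto simp: exp_add_eq_0_iff)
  then have "lookup (f * g) 0 = (\<Sum>s\<in>keys f. if s = 0 then lookup f 0 * lookup g 0 else 0)"
    unfolding lookup_mult_expand[of f g] by (intro sum.cong) auto
  then show ?thesis by (auto simp: in_keys_iff)
qed

lemma lin_mult: "lin (f * g) v = lookup f 0 * lin g v + lin f v * lookup g 0"
  for f g :: "('v, 'k::comm_ring_1) mpoly"
proof -
  let ?v = "single v (1::nat)"
  have "lookup (single s c * g) ?v =
      (if s = 0 then c * lookup g ?v else 0) + (if s = ?v then c * lookup g 0 else 0)" for s c
  proof -
    consider "s = 0" | "s = ?v" | "\<And>t. s + t \<noteq> ?v" using exp_add_eq_single[of s _ v] by blast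
    then show ?thesis
    proof cases
      case 3
      then have "s \<noteq> 0" "s \<noteq> ?v" using 3[of ?v] 3[of 0] by auto
      then show ?thesis using lookup_single_mult_eq_0[OF 3] by simp
    qed (use lookup_single_mult[of 0 c g ?v] lookup_single_mult[of ?v c g 0] in auto)
  qed
  then have "lookup (f * g) ?v = (\<Sum>s\<in>keys f. (if s = 0 then lookup f 0 * lookup g ?v else 0) +
      (if s = ?v then lookup f ?v * lookup g 0 else 0))"
    unfolding lookup_mult_expand[of f g] by (intro sum.cong) auto
  then show ?thesis by (auto simp: lin_def sum.distrib in_keys_iff)
qed

lemma lin_add: "lin (f + g) v = lin f v + lin g v" and lin_0 [simp]: "lin 0 v = 0"
  and lin_sum: "lin (sum e A) v = (\<Sum>a\<in>A. lin (e a) v)"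
  and lin_Var: "lin (Var u :: ('v, 'k::zero_neq_one) mpoly) v = (if u = v then 1 else 0)"
  by (auto simp: lin_def lookup_add lookup_sum Var_def lookup_single when_def)

lemma lin_diff: "lin (f - g) v = lin f v - (lin g v :: 'k::ab_group_add)"
  by (simp add: lin_def lookup_minus)

lemma lookup_Const_0 [simp]: "lookup (Const c) 0 = c" and lin_Const [simp]: "lin (Const c) v = 0"
  and lookup_Var_0 [simp]: "lookup (Var v) 0 = 0"
  by (auto simp: Const_def lin_def Var_def lookup_single when_def)

lemma lin_Const_mult: "lin (Const c * f) v = c * lin f v" for f :: "('v, 'k::comm_ring_1) mpoly"
  by (simp add: lin_mult)

lemma origin_eq:
  fixes V :: "'v set"
  shows "origin V = {f :: ('v, 'k::field) mpoly. vars f \<subseteq> V \<and> lookup f 0 = 0}"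
proof
  let ?P = "poly_ring V :: ('v, 'k) mpoly ring"
  let ?m = "{f :: ('v, 'k::field) mpoly. vars f \<subseteq> V \<and> lookup f 0 = 0}"
  interpret P: cring ?P by (rule cring_poly_ring)
  have V: "Var ` V \<subseteq> carrier ?P" by auto
  have m: "ideal ?m ?P"
    by (rule poly_idealI) (auto simp: lookup_add lookup_mult_0 vars_add_sub vars_mult_sub)
  show "origin V \<subseteq> ?m" unfolding origin_def by (rule P.genideal_minimal[OF m]) auto
  have o: "ideal (origin V) ?P" unfolding origin_def by (rule P.genideal_ideal[OF V])
  have "f - Const (lookup f 0) \<in> origin V" if "vars f \<subseteq> V" for f :: "('v, 'k) mpoly"
    using that
  proof (induction f rule: poly_ring_induct)
    case (Const c)
    then show ?case by (simp add: poly_ideal_0[OF o])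
  next
    case (Var v)
    then show ?case using P.genideal_self[OF V] by (auto simp: origin_def)
  next
    case (add f g)
    then show ?case using poly_ideal_add[OF o, of "f - Const (lookup f 0)" "g - Const (lookup g 0)"]
      by (simp add: lookup_add Const_add algebra_simps)
  next
    case (mult f g)
    have "f * (g - Const (lookup g 0)) + Const (lookup g 0) * (f - Const (lookup f 0)) \<in> origin V"
      using mult by (intro poly_ideal_add[OF o] poly_ideal_mult[OF o]) auto
    then show ?case by (simp add: lookup_mult_0 Const_mult algebra_simps)
  qed
  then show "?m \<subseteq> origin V" by fastforce
qed

text \<open>The degree of a monomial when the indeterminate \<open>v\<close> has degree \<open>w v\<close>. Degrees are taken in an
  arbitrary commutative monoid, so that exponent vectors can serve as degrees.\<close>

definition wdeg :: "('v \<Rightarrow> 'g) \<Rightarrow> ('v \<Rightarrow>\<^sub>0 nat) \<Rightarrow> 'g::comm_monoid_add" where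
  "wdeg w t = (\<Sum>v\<in>keys t. \<Sum>i<lookup t v. w v)"

lemma wdeg_superset:
  "finite S \<Longrightarrow> keys t \<subseteq> S \<Longrightarrow> wdeg w t = (\<Sum>v\<in>S. \<Sum>i<lookup t v. w v)"
  unfolding wdeg_def by (rule sum.mono_neutral_left) (auto simp: in_keys_iff)

lemma wdeg_add: "wdeg w (s + t) = wdeg w s + wdeg w t"
proof -
  let ?S = "keys s \<union> keys t"
  have c: "(\<Sum>i<m + n. c) = (\<Sum>i<m. c) + (\<Sum>i<n. c)" for m n :: nat and c :: 'a
    by (induction n) (auto simp: add_ac)
  have "wdeg w (s + t) = (\<Sum>v\<in>?S. \<Sum>i<lookup (s + t) v. w v)"
    by (rule wdeg_superset) (auto simp: keys_add_exp)
  also have "\<dots> = (\<Sum>v\<in>?S. \<Sum>i<lookup s v. w v) + (\<Sum>v\<in>?S. \<Sum>i<lookup t v. w v)"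
    by (simp add: lookup_add c sum.distrib)
  also have "\<dots> = wdeg w s + wdeg w t"
    by (subst (1 2) wdeg_superset[of ?S]) auto
  finally show ?thesis .
qed

lemma wdeg_0 [simp]: "wdeg w 0 = 0" and wdeg_single [simp]: "wdeg w (single v (Suc 0)) = w v"
  by (simp_all add: wdeg_def)

definition hom_part :: "('v \<Rightarrow> 'g::comm_monoid_add) \<Rightarrow> 'g \<Rightarrow> ('v, 'k) mpoly \<Rightarrow> ('v, 'k::comm_monoid_add) mpoly" where
  "hom_part w g f = (\<Sum>t\<in>{t \<in> keys f. wdeg w t = g}. single t (lookup f t))"

lemma lookup_hom_part: "lookup (hom_part w g f) t = (if wdeg w t = g then lookup f t else 0)"
  unfolding hom_part_def by (auto simp: lookup_sum lookup_single when_def in_keys_iff)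

lemma hom_part_add: "hom_part w g (f + f') = hom_part w g f + hom_part w g f'"
  by (rule poly_mapping_eqI) (simp add: lookup_hom_part lookup_add)

lemma hom_part_sum: "hom_part w g (sum e A) = (\<Sum>a\<in>A. hom_part w g (e a))"
  by (rule poly_mapping_eqI) (auto simp: lookup_hom_part lookup_sum)

lemma vars_hom_part: "vars (hom_part w g f) \<subseteq> vars f"
  by (auto simp: vars_def in_keys_iff lookup_hom_part split: if_splits)

text \<open>Remove one indeterminate at a time.\<close>

lemma wdeg_in_cone:
  assumes add: "\<And>a b. a \<in> Pos \<Longrightarrow> b \<in> Pos \<Longrightarrow> a + b \<in> Pos"
    and "t \<noteq> 0" "\<And>v. v \<in> keys t \<Longrightarrow> w v \<in> Pos"
  shows "wdeg w t \<in> Pos"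
  using assms(2,3)
proof (induction "\<Sum>v\<in>keys t. lookup t v" arbitrary: t rule: less_induct)
  case less
  obtain v where v: "v \<in> keys t" using less.prems(1) by (metis all_not_in_conv keys_eq_empty)
  let ?t = "t - single v 1"
  have t: "t = ?t + single v 1"
    using v by (intro poly_mapping_eqI) (auto simp: lookup_add lookup_minus lookup_single when_def in_keys_iff)
  have sub: "keys ?t \<subseteq> keys t" by (auto simp: in_keys_iff lookup_minus)
  have e: "wdeg w t = wdeg w ?t + w v" by (subst t, subst wdeg_add) simp
  show ?case
  proof (cases "?t = 0")
    case True
    then show ?thesis using e v less.prems(2) by simp
  next
    case False
    have "(\<Sum>x\<in>keys ?t. lookup ?t x) \<le> (\<Sum>x\<in>keys t. lookup ?t x)"
      using sub by (intro sum_mono2) auto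
    also have "\<dots> < (\<Sum>x\<in>keys t. lookup t x)"
      using v by (intro sum_strict_mono_ex1) (auto simp: lookup_minus lookup_single when_def in_keys_iff)
    finally have "wdeg w ?t \<in> Pos" using less.hyps False sub less.prems(2) by blast
    then show ?thesis using e add v less.prems(2) by simp
  qed
qed

text \<open>The elements of \<open>F\<close> generate the ideal \<open>q\<close> of the origin up to multiplication by elements \<open>s\<close>
  outside \<open>q\<close>. Such an \<open>s\<close> has a nonzero constant term \<open>s\<^sub>0\<close>, so multiplying by \<open>s\<close> amounts to
  multiplying linear parts by \<open>s\<^sub>0\<close>. Hence modulo the linear parts of \<open>I\<close> the linear parts of
  representatives of \<open>F\<close> span the linear forms. The set \<open>K\<close> of all polynomials without constant
  term whose linear part is such a combination is an ideal by the product rule \<open>lin_mult\<close>.\<close>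

lemma cotangent_space_spanned:
  fixes V :: "'v set" and I :: "('v, 'k::field) mpoly set"
  assumes I: "ideal I (poly_ring V)" and I0: "\<And>f. f \<in> I \<Longrightarrow> lookup f 0 = 0"
    and q: "primeideal q (poly_ring V Quot I)"
      "\<And>f. vars f \<subseteq> V \<Longrightarrow> I +>\<^bsub>poly_ring V\<^esub> f \<in> q \<longleftrightarrow> lookup f 0 = 0"
    and F: "F \<subseteq> q" "finite F"
    and gen: "\<And>x. x \<in> q \<Longrightarrow> \<exists>s \<in> carrier (poly_ring V Quot I) - q.
      s \<otimes>\<^bsub>poly_ring V Quot I\<^esub> x \<in> Idl\<^bsub>poly_ring V Quot I\<^esub> F"
  shows "\<exists>lift. \<forall>v\<in>V. \<exists>c. \<exists>i\<in>I. \<forall>u\<in>V.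
    (if u = v then 1 else 0) = (\<Sum>X\<in>F. c X * lin (lift X) u) + lin i u"
proof -
  let ?P = "poly_ring V :: ('v, 'k) mpoly ring"
  let ?A = "poly_ring V Quot I"
  let ?\<pi> = "(+>\<^bsub>poly_ring V\<^esub>) I"
  interpret \<pi>: surj_cring_hom ?P ?A ?\<pi> by (rule surj_poly_quot[OF I])
  interpret q: primeideal q ?A by fact
  have piadd: "?\<pi> (f + g) = ?\<pi> f \<oplus>\<^bsub>?A\<^esub> ?\<pi> g" and pimult: "?\<pi> (f * g) = ?\<pi> f \<otimes>\<^bsub>?A\<^esub> ?\<pi> g"
    if "vars f \<subseteq> V" "vars g \<subseteq> V" for f g
    using \<pi>.hom_add[of f g] \<pi>.hom_mult[of f g] that by simp_all
  have picl: "?\<pi> f \<in> carrier ?A" if "vars f \<subseteq> V" for f using \<pi>.hom_closed[of f] that by simp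
  have pisurj: "\<exists>f. vars f \<subseteq> V \<and> X = ?\<pi> f" if "X \<in> carrier ?A" for X
    using that unfolding \<pi>.surj[symmetric] by auto
  have "\<forall>X\<in>F. \<exists>f. vars f \<subseteq> V \<and> lookup f 0 = 0 \<and> X = ?\<pi> f"
    using F(1) pisurj q(2) q.Icarr by (metis subsetD)
  then obtain lift where lift: "\<And>X. X \<in> F \<Longrightarrow> vars (lift X) \<subseteq> V \<and> lookup (lift X) 0 = 0 \<and> X = ?\<pi> (lift X)"
    by metis
  define K where "K = {f. vars f \<subseteq> V \<and> lookup f 0 = 0 \<and>
    (\<exists>c. \<exists>i\<in>I. \<forall>v\<in>V. lin f v = (\<Sum>X\<in>F. c X * lin (lift X) v) + lin i v)}"
  have Kadd: "f + g \<in> K" if f: "f \<in> K" and g: "g \<in> K" for f g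
  proof -
    obtain c i where c: "i \<in> I" "\<forall>v\<in>V. lin f v = (\<Sum>X\<in>F. c X * lin (lift X) v) + lin i v"
      using f by (auto simp: K_def)
    obtain c' i' where c': "i' \<in> I" "\<forall>v\<in>V. lin g v = (\<Sum>X\<in>F. c' X * lin (lift X) v) + lin i' v"
      using g by (auto simp: K_def)
    have "\<forall>v\<in>V. lin (f + g) v = (\<Sum>X\<in>F. (c X + c' X) * lin (lift X) v) + lin (i + i') v"
      using c c' by (simp add: lin_add distrib_right sum.distrib)
    then have "\<exists>c. \<exists>i\<in>I. \<forall>v\<in>V. lin (f + g) v = (\<Sum>X\<in>F. c X * lin (lift X) v) + lin i v"
      using poly_ideal_add[OF I c(1) c'(1)] by (intro exI[of _ "\<lambda>X. c X + c' X"] bexI[of _ "i + i'"])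
    then show ?thesis using f g by (simp add: K_def vars_add_sub lookup_add)
  qed
  have Kmult: "h * f \<in> K" if f: "f \<in> K" and h: "vars h \<subseteq> V" for f h
  proof -
    obtain c i where c: "i \<in> I" "\<forall>v\<in>V. lin f v = (\<Sum>X\<in>F. c X * lin (lift X) v) + lin i v"
      using f by (auto simp: K_def)
    let ?h = "lookup h 0"
    have "\<forall>v\<in>V. lin (h * f) v = (\<Sum>X\<in>F. (?h * c X) * lin (lift X) v) + lin (Const ?h * i) v"
      using c f by (simp add: lin_mult K_def sum_distrib_left mult.assoc distrib_left)
    then have "\<exists>c. \<exists>i\<in>I. \<forall>v\<in>V. lin (h * f) v = (\<Sum>X\<in>F. c X * lin (lift X) v) + lin i v"
      using poly_ideal_mult[OF I c(1), of "Const ?h"]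
      by (intro exI[of _ "\<lambda>X. ?h * c X"] bexI[of _ "Const ?h * i"]) simp_all
    then show ?thesis using f h by (simp add: K_def vars_mult_sub lookup_mult_0)
  qed
  have KI: "f \<in> K" if "f \<in> I" for f
    using that poly_ideal_vars[OF I that] I0[OF that] by (auto simp: K_def intro!: exI[of _ "\<lambda>_. 0"] bexI[of _ f])
  have Klift: "lift X \<in> K" if "X \<in> F" for X
  proof -
    have "\<forall>v\<in>V. lin (lift X) v = (\<Sum>Y\<in>F. (if Y = X then 1 else 0) * lin (lift Y) v) + lin 0 v"
      using F(2) that by (simp add: if_distrib[of "\<lambda>c. c * _"] cong: if_cong)
    then have "\<exists>c. \<exists>i\<in>I. \<forall>v\<in>V. lin (lift X) v = (\<Sum>Y\<in>F. c Y * lin (lift Y) v) + lin i v"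
      using poly_ideal_0[OF I] by (intro exI[of _ "\<lambda>Y. if Y = X then 1 else 0"] bexI[of _ 0])
    then show ?thesis using lift[OF that] by (simp add: K_def)
  qed
  have "ideal (?\<pi> ` K) ?A"
  proof (rule \<pi>.S.cring_idealI)
    show "?\<pi> ` K \<subseteq> carrier ?A" using picl by (auto simp: K_def)
    show "\<zero>\<^bsub>?A\<^esub> \<in> ?\<pi> ` K"
      using KI[OF poly_ideal_0[OF I]] \<pi>.hom_zero by (metis imageI poly_ring_simps(5))
    fix X Y assume "X \<in> ?\<pi> ` K" "Y \<in> ?\<pi> ` K"
    then obtain f g where fg: "f \<in> K" "g \<in> K" "X = ?\<pi> f" "Y = ?\<pi> g" by blast
    then have "X \<oplus>\<^bsub>?A\<^esub> Y = ?\<pi> (f + g)" by (simp add: piadd K_def)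
    then show "X \<oplus>\<^bsub>?A\<^esub> Y \<in> ?\<pi> ` K" using Kadd fg by blast
  next
    fix X Y assume "X \<in> carrier ?A" "Y \<in> ?\<pi> ` K"
    then obtain f g where fg: "vars f \<subseteq> V" "g \<in> K" "X = ?\<pi> f" "Y = ?\<pi> g" using pisurj by blast
    then have "X \<otimes>\<^bsub>?A\<^esub> Y = ?\<pi> (f * g)" by (simp add: pimult K_def)
    then show "X \<otimes>\<^bsub>?A\<^esub> Y \<in> ?\<pi> ` K" using Kmult fg by blast
  qed
  moreover have "F \<subseteq> ?\<pi> ` K" using lift Klift by blast
  ultimately have IdlK: "Idl\<^bsub>?A\<^esub> F \<subseteq> ?\<pi> ` K" by (rule \<pi>.S.genideal_minimal)
  have "\<exists>c. \<exists>i\<in>I. \<forall>u\<in>V. (if u = v then 1 else 0) = (\<Sum>X\<in>F. c X * lin (lift X) u) + lin i u"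
    if v: "v \<in> V" for v
  proof -
    have "?\<pi> (Var v) \<in> q" using q(2)[of "Var v"] v by simp
    then obtain S where S: "S \<in> carrier ?A - q" "S \<otimes>\<^bsub>?A\<^esub> ?\<pi> (Var v) \<in> Idl\<^bsub>?A\<^esub> F" using gen by blast
    obtain s where s: "vars s \<subseteq> V" "S = ?\<pi> s" using S(1) pisurj by blast
    then have s0: "lookup s 0 \<noteq> 0" using S(1) q(2) by blast
    have "?\<pi> (s * Var v) \<in> ?\<pi> ` K" using S(2) s v IdlK by (auto simp: pimult)
    then obtain f where f: "f \<in> K" "?\<pi> (s * Var v) = ?\<pi> f" by blast
    have "vars (s * Var v) \<subseteq> V" using s v by (intro vars_mult_sub) auto
    then have "s * Var v - f \<in> I" using f poly_quot_eq_iff[OF I, of "s * Var v" f] by (simp add: K_def)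
    then have "s * Var v \<in> K" using Kadd[OF KI f(1)] by fastforce
    \<comment> \<open>rescaling removes the constant term of \<open>s\<close> from the linear part\<close>
    then have "Const (1 / lookup s 0) * (s * Var v) \<in> K" by (rule Kmult) simp
    moreover have "lin (Const (1 / lookup s 0) * (s * Var v)) u = (if u = v then 1 else 0)" for u
      using s0 by (simp add: lin_mult lookup_mult_0 lin_Var)
    ultimately show ?thesis by (simp add: K_def)
  qed
  then show ?thesis by blast
qed

text \<open>Steinitz exchange for the space of linear forms modulo the linear parts of \<open>I\<close>: if \<open>F\<close> indexes
  a spanning set, then a maximal set \<open>D\<close> of indeterminates that is linearly independent in this
  quotient is a basis and has at most \<open>card F\<close> elements.\<close>

lemma linear_parts_basis:
  fixes V :: "'v set" and I :: "('v, 'k::field) mpoly set" and y :: "'x \<Rightarrow> 'v \<Rightarrow> 'k"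
  assumes V: "finite V" and I: "ideal I (poly_ring V)" and F: "finite F"
    and span: "\<forall>v\<in>V. \<exists>c. \<exists>i\<in>I. \<forall>u\<in>V.
      (if u = v then 1 else 0) = (\<Sum>X\<in>F. c X * y X u) + lin i u"
  shows "\<exists>D. D \<subseteq> V \<and> card D \<le> card F \<and> (\<forall>v\<in>V. \<exists>e. \<exists>i\<in>I. \<forall>u\<in>V.
    lin (Var v) u = (\<Sum>x\<in>D. e x * lin (Var x) u) + lin i u)"
proof -
  \<comment> \<open>linear independence of the indeterminates in \<open>D\<close> modulo the linear parts of \<open>I\<close>\<close>
  define indep where "indep D \<longleftrightarrow> (\<forall>c. (\<exists>i\<in>I. \<forall>u\<in>V. lin i u = (if u \<in> D then c u else 0)) \<longrightarrow>
      (\<forall>u\<in>D. c u = 0))" for D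
  have "\<exists>D\<in>{D. D \<subseteq> V \<and> indep D}. \<forall>B\<in>{D. D \<subseteq> V \<and> indep D}. D \<le> B \<longrightarrow> D = B"
    by (rule finite_has_maximal) (use V in \<open>auto simp: indep_def intro: exI[of _ "{}"]\<close>)
  then obtain D where "D \<in> {D. D \<subseteq> V \<and> indep D}"
    and maxS: "\<forall>B\<in>{D. D \<subseteq> V \<and> indep D}. D \<subseteq> B \<longrightarrow> D = B"
    by (rule bexE)
  then have D: "D \<subseteq> V" "indep D" by simp_all
  have max: "D = B" if "B \<subseteq> V" "indep B" "D \<subseteq> B" for B
    using maxS that by simp
  have finD: "finite D" using D V finite_subset by blast
  have cardD: "card D \<le> card F"
  proof (rule ccontr)
    assume "\<not> card D \<le> card F"
    then have less: "card F < card D" by simp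
    let ?rel = "\<lambda>v c i. \<forall>u\<in>V. (if u = v then 1 else 0) = (\<Sum>X\<in>F. c X * y X u) + lin i u"
    have "\<forall>v\<in>V. \<exists>c. \<exists>i. i \<in> I \<and> ?rel v c i" using span by (simp add: Bex_def)
    then obtain c where "\<forall>v\<in>V. \<exists>i. i \<in> I \<and> ?rel v (c v) i" by (rule bchoice[THEN exE])
    then obtain i where rel: "\<forall>v\<in>V. i v \<in> I \<and> ?rel v (c v) (i v)" by (rule bchoice[THEN exE])
    then have ci: "i v \<in> I" "u \<in> V \<Longrightarrow>
        (if u = v then 1 else 0) = (\<Sum>X\<in>F. c v X * y X u) + lin (i v) u" if "v \<in> V" for v u
      using that by simp_all
    have "\<exists>a. (\<exists>v\<in>D. a v \<noteq> 0) \<and> (\<forall>X\<in>F. (\<Sum>v\<in>D. a v * c v X) = 0)"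
      by (rule homogeneous_system_has_solution[OF F finD less])
    then obtain a where a: "\<exists>v\<in>D. a v \<noteq> 0" "\<forall>X\<in>F. (\<Sum>v\<in>D. a v * c v X) = 0" by blast
    let ?i = "\<Sum>v\<in>D. Const (a v) * i v"
    have "?i \<in> I" using ci(1) D(1) by (intro poly_ideal_sum[OF I] poly_ideal_mult[OF I]) auto
    moreover have "lin ?i u = (if u \<in> D then a u else 0)" if u: "u \<in> V" for u
    proof -
      have "lin (i v) u = (if u = v then 1 else 0) - (\<Sum>X\<in>F. c v X * y X u)" if "v \<in> D" for v
        using ci(2)[of v u] u that D(1) by (auto simp: algebra_simps)
      then have "lin ?i u = (\<Sum>v\<in>D. a v * (if u = v then 1 else 0)) -
          (\<Sum>v\<in>D. \<Sum>X\<in>F. a v * c v X * y X u)"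
        by (simp add: lin_sum lin_Const_mult right_diff_distrib sum_subtractf sum_distrib_left mult.assoc)
      also have "(\<Sum>v\<in>D. \<Sum>X\<in>F. a v * c v X * y X u) = (\<Sum>X\<in>F. (\<Sum>v\<in>D. a v * c v X) * y X u)"
        by (subst sum.swap) (simp add: sum_distrib_right)
      also have "\<dots> = 0" using a(2) by simp
      finally show ?thesis using finD by (simp add: if_distrib cong: if_cong)
    qed
    ultimately have "\<forall>u\<in>D. a u = 0" using D(2) unfolding indep_def by blast
    then show False using a(1) by blast
  qed
  have lincomb: "\<exists>e. \<exists>i\<in>I. \<forall>u\<in>V. lin (Var v) u = (\<Sum>x\<in>D. e x * lin (Var x) u) + lin i u"
    if v: "v \<in> V" for v
  proof (cases "v \<in> D")
    case True
    have "\<forall>u\<in>V. lin (Var v :: ('v, 'k) mpoly) u = (\<Sum>x\<in>D. (if x = v then 1 else 0) * lin (Var x) u) + lin (0 :: ('v, 'k) mpoly) u"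
      using finD True by (simp add: if_distrib[of "\<lambda>c. c * _"] cong: if_cong)
    then show ?thesis
      using poly_ideal_0[OF I] by (intro exI[of _ "\<lambda>x. if x = v then 1 else 0"] bexI[of _ 0])
  next
    case False
    then have "\<not> indep (insert v D)" using max[of "insert v D"] v D(1) by blast
    then obtain c i where i: "i \<in> I" "\<And>u. u \<in> V \<Longrightarrow> lin i u = (if u \<in> insert v D then c u else 0)"
      and nz: "\<exists>u\<in>insert v D. c u \<noteq> 0"
      unfolding indep_def by blast
    \<comment> \<open>otherwise the relation would only involve \<open>D\<close>\<close>
    have cv: "c v \<noteq> 0"
    proof
      assume "c v = 0"
      then have "\<forall>u\<in>V. lin i u = (if u \<in> D then c u else 0)" using i(2) by auto
      then have "\<forall>u\<in>D. c u = 0" using D(2) i(1) unfolding indep_def by blast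
      then show False using nz \<open>c v = 0\<close> by auto
    qed
    have sum: "(\<Sum>x\<in>D. e x * lin (Var x) u) = (if u \<in> D then e u else 0)" for e :: "'v \<Rightarrow> 'k" and u
      using finD by (simp add: lin_Var if_distrib cong: if_cong)
    have "\<forall>u\<in>V. lin (Var v) u = (\<Sum>x\<in>D. (- c x / c v) * lin (Var x) u) + lin (Const (1 / c v) * i) u"
      unfolding sum using i(2) cv False by (auto simp: lin_Var lin_Const_mult)
    moreover have "Const (1 / c v) * i \<in> I" using i(1) by (intro poly_ideal_mult[OF I]) auto
    ultimately show ?thesis by (intro exI[of _ "\<lambda>x. - c x / c v"] bexI[of _ "Const (1 / c v) * i"])
  qed
  show ?thesis using D(1) cardD lincomb by blast
qed

text \<open>A graded form of Nakayama's lemma. By assumption \<open>Var v\<close> is, modulo \<open>I\<close>, a linear combination of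
  \<open>D\<close> plus a remainder \<open>r\<close> without constant and linear terms. Homogeneity of \<open>I\<close> allows to
  keep only the part of degree \<open>w v\<close>. An indeterminate \<open>u\<close> in a monomial of this part of \<open>r\<close> is accompanied
  by further indeterminates, so \<open>w v - w u\<close> is positive. On the finite set \<open>V\<close> this is a
  well-founded relation between \<open>u\<close> and \<open>v\<close>, along which one shows that every indeterminate is congruent to a
  polynomial in \<open>D\<close>.\<close>

lemma graded_generation:
  fixes V :: "'v set" and w :: "'v \<Rightarrow> 'g::ab_group_add" and I :: "('v, 'k::field) mpoly set"
  assumes V: "finite V" and I: "ideal I (poly_ring V)" and I0: "\<And>f. f \<in> I \<Longrightarrow> lookup f 0 = 0"
    and pos: "\<And>v. v \<in> V \<Longrightarrow> w v \<in> Pos" "\<And>a b. a \<in> Pos \<Longrightarrow> b \<in> Pos \<Longrightarrow> a + b \<in> Pos" "0 \<notin> Pos"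
    and graded: "\<And>f g. f \<in> I \<Longrightarrow> hom_part w g f \<in> I"
    and D: "D \<subseteq> V"
    and lincomb: "\<forall>v\<in>V. \<exists>e. \<exists>i\<in>I. \<forall>u\<in>V.
      lin (Var v) u = (\<Sum>x\<in>D. e x * lin (Var x) u) + lin i u"
    and f: "vars f \<subseteq> V"
  shows "\<exists>g. vars g \<subseteq> D \<and> f - g \<in> I"
proof -
  \<comment> \<open>the sum of \<open>I\<close> and the polynomials in \<open>D\<close>, which is a subalgebra\<close>
  let ?S = "{f. vars f \<subseteq> V \<and> (\<exists>g. vars g \<subseteq> D \<and> f - g \<in> I)}"
  have Smem: "f \<in> ?S" if "vars f \<subseteq> V" "vars g \<subseteq> D" "f - g \<in> I" for f g
    by (intro CollectI conjI exI[of _ g] that)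
  have Sadd: "f + f' \<in> ?S" if ff: "f \<in> ?S" "f' \<in> ?S" for f f'
  proof -
    obtain g g' where g: "vars g \<subseteq> D" "f - g \<in> I" "vars g' \<subseteq> D" "f' - g' \<in> I" using ff by blast
    have "(f + f') - (g + g') \<in> I" using poly_ideal_add[OF I g(2,4)] by (simp add: algebra_simps)
    moreover have "vars (g + g') \<subseteq> D" using g by (intro vars_add_sub)
    moreover have "vars (f + f') \<subseteq> V" using ff by (intro vars_add_sub) simp_all
    ultimately show ?thesis using Smem by blast
  qed
  have Smult: "f * f' \<in> ?S" if ff: "f \<in> ?S" "f' \<in> ?S" for f f'
  proof -
    obtain g g' where g: "vars g \<subseteq> D" "f - g \<in> I" "vars g' \<subseteq> D" "f' - g' \<in> I" using ff by blast
    have vg: "vars g \<subseteq> V" using g(1) D by blast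
    have vf: "vars f' \<subseteq> V" using ff by simp
    have "f' * (f - g) + g * (f' - g') \<in> I"
      using g vg vf by (intro poly_ideal_add[OF I] poly_ideal_mult[OF I])
    then have "f * f' - g * g' \<in> I" by (simp add: algebra_simps)
    moreover have "vars (g * g') \<subseteq> D" using g by (intro vars_mult_sub)
    moreover have "vars (f * f') \<subseteq> V" using ff by (intro vars_mult_sub) simp_all
    ultimately show ?thesis using Smem by blast
  qed
  have SD: "f \<in> ?S" if "vars f \<subseteq> D" for f
    using that D poly_ideal_0[OF I] by (intro Smem[of f f]) auto
  have SI: "f \<in> ?S" if "f \<in> I" for f
    using that poly_ideal_vars[OF I that] by (intro Smem[of f 0]) auto
  have Spow: "f ^ n \<in> ?S" if "f \<in> ?S" for f n
    by (induction n) (use Smult[OF that] SD[of 1] in auto)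
  have Sprod: "(\<Prod>a\<in>B. e a) \<in> ?S" if "finite B" "\<And>a. a \<in> B \<Longrightarrow> e a \<in> ?S" for B :: "'v set" and e
    using that
  proof (induction B rule: finite_induct)
    case empty
    then show ?case using SD[of 1] by simp
  next
    case (insert a B)
    have "e a * prod e B \<in> ?S" using insert by (intro Smult) blast+
    then show ?case using insert.hyps by simp
  qed
  have Ssum: "(\<Sum>a\<in>B. e a) \<in> ?S" if "finite B" "\<And>a. a \<in> B \<Longrightarrow> e a \<in> ?S"
    for B :: "('v \<Rightarrow>\<^sub>0 nat) set" and e
    using that
  proof (induction B rule: finite_induct)
    case empty
    then show ?case using SD[of 0] by simp
  next
    case (insert a B)
    have "e a + sum e B \<in> ?S" using insert by (intro Sadd) blast+
    then show ?case using insert.hyps by simp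
  qed
  \<comment> \<open>the difference of the degrees being positive is a transitive and irreflexive relation\<close>
  define R where "R = {(u, v). u \<in> V \<and> v \<in> V \<and> w v - w u \<in> Pos}"
  have "wf R"
  proof (rule finite_acyclic_wf)
    have "R \<subseteq> V \<times> V" by (auto simp: R_def)
    then show "finite R" using V finite_subset by blast
    have "trans R"
    proof (rule transI)
      fix x y z assume "(x, y) \<in> R" "(y, z) \<in> R"
      then show "(x, z) \<in> R" using pos(2)[of "w y - w x" "w z - w y"] by (auto simp: R_def)
    qed
    then show "acyclic R" using pos(3) by (auto simp: acyclic_def trancl_id R_def)
  qed
  have wdeg_pos: "wdeg w t \<in> Pos" if "t \<noteq> 0" "keys t \<subseteq> V" for t
    using that pos(1) by (intro wdeg_in_cone[OF pos(2)]) auto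
  have VarS: "Var v \<in> ?S" if "v \<in> V" for v
    using \<open>wf R\<close> that
  proof (induction v rule: wf_induct_rule)
    case (less v)
    obtain e i where i: "i \<in> I" "\<And>u. u \<in> V \<Longrightarrow> lin (Var v) u = (\<Sum>x\<in>D. e x * lin (Var x) u) + lin i u"
      using bspec[OF lincomb less.prems] by blast
    define L where "L = (\<Sum>x\<in>D. Const (e x) * Var x)"
    define r where "r = Var v - L - i"
    have vL: "vars L \<subseteq> D" unfolding L_def by (intro vars_sum_sub vars_mult_sub) auto
    have vr: "vars r \<subseteq> V"
      unfolding r_def using vL D less.prems poly_ideal_vars[OF I i(1)] by (intro vars_diff_sub) auto
    have r0: "lookup r 0 = 0"
      unfolding r_def L_def using I0[OF i(1)] by (simp add: lookup_minus lookup_sum lookup_mult_0)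
    have r1: "lin r u = 0" if "u \<in> V" for u
      unfolding r_def L_def using i(2)[OF that] by (simp add: lin_diff lin_sum lin_Const_mult)
    have "Var v = hom_part w (w v) (Var v :: ('v, 'k) mpoly)"
      by (rule poly_mapping_eqI) (auto simp: lookup_hom_part Var_def lookup_single when_def)
    also have "\<dots> = hom_part w (w v) (L + i + r)" by (simp add: r_def)
    finally have eq: "Var v = hom_part w (w v) L + hom_part w (w v) i + hom_part w (w v) r"
      by (simp only: hom_part_add)
    have 1: "hom_part w (w v) L \<in> ?S" using vars_hom_part[of w "w v" L] vL by (intro SD) blast
    have 2: "hom_part w (w v) i \<in> ?S" by (rule SI[OF graded[OF i(1)]])
    have 3: "hom_part w (w v) r \<in> ?S"
      unfolding hom_part_def
    proof (rule Ssum)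
      fix t assume t: "t \<in> {t \<in> keys r. wdeg w t = w v}"
      have tV: "keys t \<subseteq> V" using t vr by (auto simp: vars_def)
      have "Var u \<in> ?S" if u: "u \<in> keys t" for u
      proof -
        let ?t = "t - single u 1"
        have tu: "t = ?t + single u 1"
          using u by (intro poly_mapping_eqI) (auto simp: lookup_add lookup_minus lookup_single when_def in_keys_iff)
        have "?t \<noteq> 0"
        proof
          assume "?t = 0"
          then have "t = single u 1" using tu by simp
          then have "lin r u \<noteq> 0" using t by (simp add: lin_def in_keys_iff)
          then show False using r1 u tV by blast
        qed
        moreover have "keys ?t \<subseteq> V" using tV by (auto simp: in_keys_iff lookup_minus)
        ultimately have "wdeg w ?t \<in> Pos" by (rule wdeg_pos)
        moreover have "wdeg w t = wdeg w ?t + w u" by (subst tu, subst wdeg_add) simp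
        moreover have "wdeg w t = w v" using t by simp
        ultimately have "(u, v) \<in> R" using u tV less.prems by (auto simp: R_def)
        then show ?thesis using less.IH u tV by blast
      qed
      then have "mon_eval Var t \<in> ?S" unfolding mon_eval_def by (intro Sprod Spow) auto
      moreover have "Const (lookup r t) \<in> ?S" by (rule SD) simp
      ultimately have "Const (lookup r t) * mon_eval Var t \<in> ?S" by (intro Smult)
      then show "single t (lookup r t) \<in> ?S" by (simp add: mon_eval_Var Const_def mult_single)
    qed simp
    show ?case by (subst eq) (intro Sadd 1 2 3)
  qed
  have "f \<in> ?S"
    using f
  proof (induction f rule: poly_ring_induct)
    case (Const c)
    show ?case by (rule SD) simp
  next
    case (Var v)
    then show ?case by (rule VarS)
  next
    case (add f g)
    show ?case by (rule Sadd) fact+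
  next
    case (mult f g)
    show ?case by (rule Smult) fact+
  qed
  then show ?thesis by simp
qed

text \<open>The indeterminates in \<open>D\<close> define a surjection from a polynomial ring onto the quotient. A nonzero
  kernel would allow to prolong the preimage of the chain by the zero ideal, which gives length
  \<open>d + 1 > card D\<close>.\<close>

lemma quotient_is_polynomial_ring:
  fixes V :: "'v set" and I :: "('v, 'k::field) mpoly set"
  assumes I: "ideal I (poly_ring V)" and D: "finite D" "D \<subseteq> V"
    and gen: "\<And>f. vars f \<subseteq> V \<Longrightarrow> \<exists>g. vars g \<subseteq> D \<and> f - g \<in> I"
    and chain: "prime_chain (poly_ring V Quot I) d P" and cardD: "card D \<le> d"
  shows "\<exists>k \<chi>. \<chi> \<in> ring_iso (poly_ring {..<k::nat}) (poly_ring V Quot I) \<and>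
    (\<forall>c. \<chi> (Const c) = I +>\<^bsub>poly_ring V\<^esub> Const c)"
proof -
  let ?P = "poly_ring V :: ('v, 'k) mpoly ring"
  let ?A = "poly_ring V Quot I"
  let ?\<pi> = "(+>\<^bsub>poly_ring V\<^esub>) I"
  interpret \<pi>: surj_cring_hom ?P ?A ?\<pi> by (rule surj_poly_quot[OF I])
  have pisurj: "\<exists>f. vars f \<subseteq> V \<and> X = ?\<pi> f" if "X \<in> carrier ?A" for X
    using that unfolding \<pi>.surj[symmetric] by auto
  obtain b where b: "bij_betw b {0..<card D} D" using ex_bij_betw_nat_finite[OF D(1)] by blast
  let ?B = "poly_ring {..<card D} :: (nat, 'k) mpoly ring"
  let ?\<rho> = "subst (\<lambda>i. Var (b i)) :: (nat, 'k) mpoly \<Rightarrow> ('v, 'k) mpoly"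
  define \<chi> where "\<chi> f = ?\<pi> (?\<rho> f)" for f
  have bV: "b i \<in> V" if "i < card D" for i using b D(2) that by (auto simp: bij_betw_def)
  have \<rho>hom: "?\<rho> \<in> Ring.ring_hom ?B ?P" by (rule subst_hom) (use bV in auto)
  have "?\<pi> \<circ> ?\<rho> \<in> Ring.ring_hom ?B ?A" by (rule ring_hom_trans[OF \<rho>hom \<pi>.homh])
  moreover have "\<chi> = ?\<pi> \<circ> ?\<rho>" by (simp add: \<chi>_def fun_eq_iff)
  ultimately have \<chi>hom: "\<chi> \<in> Ring.ring_hom ?B ?A" by simp
  have "\<chi> ` carrier ?B = carrier ?A"
  proof
    show "\<chi> ` carrier ?B \<subseteq> carrier ?A" using ring_hom_memE(1)[OF \<chi>hom] by blast
    show "carrier ?A \<subseteq> \<chi> ` carrier ?B"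
    proof
      fix X assume "X \<in> carrier ?A"
      then obtain f where f: "vars f \<subseteq> V" "X = ?\<pi> f" using pisurj by blast
      then obtain g where g: "vars g \<subseteq> D" "f - g \<in> I" using gen by blast
      have "?\<pi> f = ?\<pi> g" using poly_quot_eq_iff[OF I, of f g] f g D(2) by auto
      define g' where "g' = subst (\<lambda>v. Var (inv_into {0..<card D} b v)) g"
      have inv: "inv_into {0..<card D} b v < card D" "b (inv_into {0..<card D} b v) = v" if "v \<in> D" for v
        using b that inv_into_into[of v b "{0..<card D}"] by (auto simp: bij_betw_def f_inv_into_f)
      have "vars g' \<subseteq> {..<card D}" unfolding g'_def using inv g(1) by (intro vars_subst) auto
      moreover have "?\<rho> g' = g"
      proof -
        have "?\<rho> g' = subst Var g" unfolding g'_def subst_subst using inv g(1) by (intro subst_cong) auto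
        then show ?thesis by (simp add: subst_Var_id)
      qed
      ultimately show "X \<in> \<chi> ` carrier ?B"
        using f(2) \<open>?\<pi> f = ?\<pi> g\<close> by (intro image_eqI[of _ _ g']) (auto simp: \<chi>_def)
    qed
  qed
  then interpret \<chi>: surj_cring_hom ?B ?A \<chi>
    using \<chi>hom by (intro surj_cring_hom.intro ring_hom_cring.intro cring_poly_ring cring_poly_quot[OF I]
        ring_hom_cring_axioms.intro surj_cring_hom_axioms.intro)
  have ker: "f = 0" if f: "vars f \<subseteq> {..<card D}" "\<chi> f = \<zero>\<^bsub>?A\<^esub>" for f
  proof (rule ccontr)
    assume "f \<noteq> 0"
    let ?Q = "\<lambda>i. {r \<in> carrier ?B. \<chi> r \<in> P i}"
    have Q: "prime_chain ?B d ?Q" by (rule \<chi>.prime_chain_vimage[OF chain])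
    have zero: "\<zero>\<^bsub>?A\<^esub> \<in> P 0"
      using chain by (simp add: prime_chain_def primeideal_def ideal_def additive_subgroup.zero_closed)
    interpret B: "domain" ?B by (rule domain_poly_ring)
    \<comment> \<open>the preimage of the chain, prolonged by the zero ideal\<close>
    let ?Q' = "\<lambda>i. case i of 0 \<Rightarrow> {0} | Suc j \<Rightarrow> ?Q j"
    have "f \<in> ?Q 0" "0 \<in> ?Q 0" using f zero \<chi>.hom_zero by auto
    then have "{0} \<subset> ?Q 0" using \<open>f \<noteq> 0\<close> by blast
    then have "prime_chain ?B (Suc d) ?Q'"
      using Q B.zeroprimeideal unfolding prime_chain_def by (auto split: nat.splits simp: less_Suc_eq_0_disj)
    then have "Suc d \<le> card D" by (rule prime_chain_poly_ring_le)
    then show False using cardD by simp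
  qed
  have "inj_on \<chi> (carrier ?B)"
  proof
    fix f g assume fg: "f \<in> carrier ?B" "g \<in> carrier ?B" "\<chi> f = \<chi> g"
    then have v: "vars f \<subseteq> {..<card D}" "vars g \<subseteq> {..<card D}" by auto
    have "?\<rho> f - ?\<rho> g \<in> I"
      using fg(3) poly_quot_eq_iff[OF I, of "?\<rho> f" "?\<rho> g"] ring_hom_memE(1)[OF \<rho>hom fg(1)]
        ring_hom_memE(1)[OF \<rho>hom fg(2)] by (simp add: \<chi>_def)
    then have "?\<rho> (f - g) \<in> I" by (simp add: subst_diff)
    then have "\<chi> (f - g) = ?\<pi> 0"
      using poly_quot_eq_iff[OF I, of "?\<rho> (f - g)" 0] poly_ideal_vars[OF I, of "?\<rho> (f - g)"]
      by (simp add: \<chi>_def)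
    then have "\<chi> (f - g) = \<zero>\<^bsub>?A\<^esub>" using \<pi>.hom_zero by simp
    then show "f = g" using ker[of "f - g"] vars_diff_sub[OF v] by simp
  qed
  then have "\<chi> \<in> ring_iso ?B ?A" using \<chi>hom \<chi>.surj by (simp add: ring_iso_def bij_betw_def)
  moreover have "\<chi> (Const c) = ?\<pi> (Const c)" for c by (simp add: \<chi>_def)
  ultimately show ?thesis by blast
qed

theorem regular_at_origin_imp_polynomial_ring:
  fixes V :: "'v set" and w :: "'v \<Rightarrow> 'g::ab_group_add" and I :: "('v, 'k::field) mpoly set"
  assumes V: "finite V" and I: "ideal I (poly_ring V)" and I0: "\<And>f. f \<in> I \<Longrightarrow> lookup f 0 = 0"
    and pos: "\<And>v. v \<in> V \<Longrightarrow> w v \<in> Pos" "\<And>a b. a \<in> Pos \<Longrightarrow> b \<in> Pos \<Longrightarrow> a + b \<in> Pos" "0 \<notin> Pos"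
    and graded: "\<And>f g. f \<in> I \<Longrightarrow> hom_part w g f \<in> I"
    and q: "primeideal q (poly_ring V Quot I)"
      "\<And>f. vars f \<subseteq> V \<Longrightarrow> I +>\<^bsub>poly_ring V\<^esub> f \<in> q \<longleftrightarrow> lookup f 0 = 0"
    and reg: "regular_local_ring (localization (poly_ring V Quot I) q)"
  shows "\<exists>k \<chi>. \<chi> \<in> ring_iso (poly_ring {..<k::nat}) (poly_ring V Quot I) \<and>
    (\<forall>c. \<chi> (Const c) = I +>\<^bsub>poly_ring V\<^esub> Const c)"
proof -
  interpret q: primeideal q "poly_ring V Quot I" by fact
  obtain d F P where F: "F \<subseteq> q" "finite F" "card F \<le> d"
    and gen: "\<And>x. x \<in> q \<Longrightarrow> \<exists>s \<in> carrier (poly_ring V Quot I) - q.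
      s \<otimes>\<^bsub>poly_ring V Quot I\<^esub> x \<in> Idl\<^bsub>poly_ring V Quot I\<^esub> F"
    and chain: "prime_chain (poly_ring V Quot I) d P"
    using q.regular_localizationD[OF reg] by metis
  obtain lift where span: "\<forall>v\<in>V. \<exists>c. \<exists>i\<in>I. \<forall>u\<in>V.
      (if u = v then 1 else 0) = (\<Sum>X\<in>F. c X * lin (lift X) u) + lin i u"
    using cotangent_space_spanned[OF I I0 q F(1,2) gen] by (rule exE)
  obtain D where D: "D \<subseteq> V" "card D \<le> card F"
    and lincomb: "\<forall>v\<in>V. \<exists>e. \<exists>i\<in>I. \<forall>u\<in>V. lin (Var v) u = (\<Sum>x\<in>D. e x * lin (Var x) u) + lin i u"
    using linear_parts_basis[OF V I F(2) span] by (elim exE conjE) (rule that)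
  have "\<exists>g. vars g \<subseteq> D \<and> f - g \<in> I" if "vars f \<subseteq> V" for f
    using graded_generation[OF V I I0 pos graded D(1) lincomb that] .
  moreover have "finite D" using D(1) V by (rule finite_subset)
  ultimately show ?thesis
    by (intro quotient_is_polynomial_ring[OF I _ D(1) _ chain le_trans[OF D(2) F(3)]])
qed

section \<open>The ideal of the Groebner basis scheme\<close>

definition homogeneous :: "('v \<Rightarrow> 'g::comm_monoid_add) \<Rightarrow> 'g \<Rightarrow> ('v, 'k::zero) mpoly \<Rightarrow> bool" where
  "homogeneous w g f \<longleftrightarrow> (\<forall>t\<in>keys f. wdeg w t = g)"

lemma homogeneous_0: "homogeneous w g 0"
  and homogeneous_1: "homogeneous w 0 (1 :: ('v, 'k::comm_ring_1) mpoly)"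
  and homogeneous_Var: "homogeneous w (w v) (Var v :: ('v, 'k::comm_ring_1) mpoly)"
  by (simp_all add: homogeneous_def Var_def)

lemma homogeneous_add: "homogeneous w g f \<Longrightarrow> homogeneous w g f' \<Longrightarrow> homogeneous w g (f + f')"
  using Poly_Mapping.keys_add[of f f'] unfolding homogeneous_def by blast

lemma homogeneous_diff:
  "homogeneous w g f \<Longrightarrow> homogeneous w g f' \<Longrightarrow> homogeneous w g (f - f' :: ('v, 'k::comm_ring_1) mpoly)"
  using homogeneous_add[of w g f "- f'"] by (simp add: homogeneous_def keys_uminus)

lemma homogeneous_mult:
  "homogeneous w g f \<Longrightarrow> homogeneous w g' f' \<Longrightarrow> homogeneous w (g + g') (f * f' :: ('v, 'k::comm_ring_1) mpoly)"
  using keys_mult[of f f'] unfolding homogeneous_def by (fastforce simp: wdeg_add)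

lemma homogeneous_sum: "(\<And>a. a \<in> A \<Longrightarrow> homogeneous w g (f a)) \<Longrightarrow> homogeneous w g (sum f A)"
  by (induction A rule: infinite_finite_induct) (auto simp: homogeneous_0 intro: homogeneous_add)

lemma hom_part_homogeneous: "homogeneous w g f \<Longrightarrow> hom_part w g' f = (if g = g' then f else 0)"
  by (rule poly_mapping_eqI) (auto simp: lookup_hom_part homogeneous_def in_keys_iff)

text \<open>Multiplication by a term of degree \<open>wdeg w s\<close> shifts homogeneous parts; subtracting degrees is
  the reason for requiring a group here.\<close>

lemma hom_part_single_mult:
  fixes w :: "'v \<Rightarrow> 'g::ab_group_add" and f :: "('v, 'k::comm_ring_1) mpoly"
  shows "hom_part w g (single s c * f) = single s c * hom_part w (g - wdeg w s) f"
proof -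
  let ?s = "single"
  have single: "hom_part w g (?s u a) = (if wdeg w u = g then ?s u a else 0)" for u and a :: 'k and g
    by (rule poly_mapping_eqI) (auto simp: lookup_hom_part lookup_single when_def)
  have "?s s c * f = (\<Sum>t\<in>keys f. ?s (s + t) (c * lookup f t))"
    by (subst (1) poly_mapping_expand[of f]) (simp add: sum_distrib_left mult_single)
  then have "hom_part w g (?s s c * f) =
      (\<Sum>t\<in>keys f. if wdeg w t = g - wdeg w s then ?s (s + t) (c * lookup f t) else 0)"
    by (simp add: hom_part_sum single wdeg_add eq_diff_eq add.commute[of "wdeg w s"])
  also have "\<dots> = ?s s c * (\<Sum>t\<in>keys f. if wdeg w t = g - wdeg w s then ?s t (lookup f t) else 0)"
    unfolding sum_distrib_left by (intro sum.cong) (simp_all add: mult_single)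
  also have "(\<Sum>t\<in>keys f. if wdeg w t = g - wdeg w s then ?s t (lookup f t) else 0) =
      hom_part w (g - wdeg w s) (\<Sum>t\<in>keys f. ?s t (lookup f t))"
    by (simp add: hom_part_sum single)
  also have "\<dots> = hom_part w (g - wdeg w s) f"
    by (rule arg_cong[OF poly_mapping_expand[symmetric]])
  finally show ?thesis .
qed

definition graded_set :: "('v \<Rightarrow> 'g::comm_monoid_add) \<Rightarrow> ('v, 'k::comm_monoid_add) mpoly set \<Rightarrow> bool" where
  "graded_set w I \<longleftrightarrow> (\<forall>f\<in>I. \<forall>g. hom_part w g f \<in> I)"

text \<open>The elements of the generated ideal all of whose homogeneous parts belong to it form an ideal that
  contains the generators.\<close>

lemma graded_genideal:
  fixes w :: "'v \<Rightarrow> 'g::ab_group_add" and X :: "('v, 'k::field) mpoly set"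
  assumes X: "\<And>x. x \<in> X \<Longrightarrow> vars x \<subseteq> C" "\<And>x. x \<in> X \<Longrightarrow> \<exists>g. homogeneous w g x"
  shows "graded_set w (Idl\<^bsub>poly_ring C\<^esub> X)"
proof -
  interpret P: cring "poly_ring C :: ('v, 'k) mpoly ring" by (rule cring_poly_ring)
  have Xc: "X \<subseteq> carrier (poly_ring C)" using X(1) by auto
  let ?I = "Idl\<^bsub>poly_ring C\<^esub> X"
  have I: "ideal ?I (poly_ring C)" by (rule P.genideal_ideal[OF Xc])
  have 0: "hom_part w g 0 = 0" for g :: 'g by (rule poly_mapping_eqI) (simp add: lookup_hom_part)
  let ?J = "{f \<in> ?I. \<forall>g. hom_part w g f \<in> ?I}"
  have "ideal ?J (poly_ring C)"
  proof (rule poly_idealI)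
    show "0 \<in> ?J" using poly_ideal_0[OF I] by (simp add: 0)
    show "vars f \<subseteq> C" if "f \<in> ?J" for f using poly_ideal_vars[OF I] that by simp
    show "f + f' \<in> ?J" if "f \<in> ?J" "f' \<in> ?J" for f f'
      using poly_ideal_add[OF I] that by (simp add: hom_part_add)
    fix h f :: "('v, 'k) mpoly" assume h: "vars h \<subseteq> C" and f: "f \<in> ?J"
    have "hom_part w g (h * f) \<in> ?I" for g
    proof -
      have "hom_part w g (h * f) = (\<Sum>s\<in>keys h.
          single s (lookup h s) * hom_part w (g - wdeg w s) f)"
        by (subst (1) poly_mapping_expand[of h]) (simp add: sum_distrib_right hom_part_sum hom_part_single_mult)
      also have "\<dots> \<in> ?I"
      proof (intro poly_ideal_sum[OF I] poly_ideal_mult[OF I])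
        fix s assume "s \<in> keys h"
        then have "keys s \<subseteq> C" using h by (auto simp: vars_def)
        then show "vars (single s (lookup h s)) \<subseteq> C" by (auto simp: vars_def split: if_splits)
      qed (use f in simp)
      finally show ?thesis .
    qed
    then show "h * f \<in> ?J" using poly_ideal_mult[OF I _ h, of f] f by simp
  qed
  moreover have "X \<subseteq> ?J"
  proof
    fix x assume x: "x \<in> X"
    then have "x \<in> ?I" using P.genideal_self[OF Xc] by blast
    moreover obtain g where "homogeneous w g x" using X(2)[OF x] by blast
    ultimately show "x \<in> ?J" using poly_ideal_0[OF I] by (simp add: hom_part_homogeneous)
  qed
  ultimately have "?I \<subseteq> ?J" by (rule P.genideal_minimal)
  then show ?thesis unfolding graded_set_def by blast
qed

definition int_exp :: "mon \<Rightarrow> (nat \<Rightarrow>\<^sub>0 int)" where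
  "int_exp t = Poly_Mapping.map int t"

lemma lookup_int_exp: "lookup (int_exp t) k = int (lookup t k)"
  by (simp add: int_exp_def map.rep_eq when_def)

lemma int_exp_add: "int_exp (s + t) = int_exp s + int_exp t"
  by (rule poly_mapping_eqI) (simp add: lookup_int_exp lookup_add)

lemma int_exp_eq_iff: "int_exp s = int_exp t \<longleftrightarrow> s = t"
  by (auto simp: poly_mapping_eq_iff fun_eq_iff lookup_int_exp)

text \<open>The elements of the group of integer exponent vectors that are positive with respect to \<open>\<sigma>\<close>.\<close>

definition positive_cone :: "mon rel \<Rightarrow> (nat \<Rightarrow>\<^sub>0 int) set" where
  "positive_cone \<sigma> = {int_exp t - int_exp s | s t. (s, t) \<in> \<sigma> \<and> s \<noteq> t}"

lemma positive_cone_0: "0 \<notin> positive_cone \<sigma>"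
  by (auto simp: positive_cone_def int_exp_eq_iff)

text \<open>From \<open>s < t\<close> and \<open>s' < t'\<close> follows \<open>s + s' < t + s' < t + t'\<close>; antisymmetry and cancellation keep
  the inequality strict.\<close>

lemma positive_cone_add:
  assumes \<sigma>: "term_ordering n \<sigma>" and a: "a \<in> positive_cone \<sigma>" and b: "b \<in> positive_cone \<sigma>"
  shows "a + b \<in> positive_cone \<sigma>"
proof -
  obtain s t where st: "(s, t) \<in> \<sigma>" "s \<noteq> t" "a = int_exp t - int_exp s"
    using a by (auto simp: positive_cone_def)
  obtain s' t' where st': "(s', t') \<in> \<sigma>" "s' \<noteq> t'" "b = int_exp t' - int_exp s'"
    using b by (auto simp: positive_cone_def)
  have lin: "linear_order_on (terms n) \<sigma>" using \<sigma> by (simp add: term_ordering_def)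
  have tr: "trans \<sigma>" and as: "antisym \<sigma>" and dom: "\<sigma> \<subseteq> terms n \<times> terms n"
    using lin by (auto simp: linear_order_on_def partial_order_on_def preorder_on_def refl_on_def)
  have 1: "(s + s', t + s') \<in> \<sigma>" and 2: "(s' + t, t' + t) \<in> \<sigma>"
    using \<sigma> st st' dom by (auto simp: term_ordering_def)
  have 2: "(t + s', t + t') \<in> \<sigma>" using 2 by (simp add: add.commute)
  have "(s + s', t + t') \<in> \<sigma>" using tr 1 2 by (rule transD)
  moreover have "s + s' \<noteq> t + t'"
  proof
    assume "s + s' = t + t'"
    then have "s + s' = t + s'" using antisymD[OF as 1] 2 by simp
    then show False using st(2) by simp
  qed
  moreover have "a + b = int_exp (t + t') - int_exp (s + s')"
    unfolding st(3) st'(3) int_exp_add by simp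
  ultimately show ?thesis unfolding positive_cone_def by blast
qed

definition weight :: "mon list \<Rightarrow> mon list \<Rightarrow> nat \<times> nat \<Rightarrow> (nat \<Rightarrow>\<^sub>0 int)" where
  "weight ts bs = (\<lambda>(i, j). int_exp (bs ! j) - int_exp (ts ! i))"

lemma S_corners_sub: "S_corners ts bs \<eta> \<sigma> \<subseteq> c_index ts bs"
  and finite_S_corners: "finite (S_corners ts bs \<eta> \<sigma>)"
proof -
  show "S_corners ts bs \<eta> \<sigma> \<subseteq> c_index ts bs" by (auto simp: S_corners_def S_all_def)
  then show "finite (S_corners ts bs \<eta> \<sigma>)" by (rule finite_subset) (simp add: c_index_def)
qed

lemma weight_pos: "v \<in> S_corners ts bs \<eta> \<sigma> \<Longrightarrow> weight ts bs v \<in> positive_cone \<sigma>"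
  by (auto simp: S_corners_def S_all_def positive_cone_def weight_def)

context
  fixes n \<eta> :: nat and Os :: "mon set" and \<sigma> :: "mon rel" and ts bs :: "mon list"
  assumes Os: "order_ideal n Os" and \<sigma>: "term_ordering n \<sigma>" and lab: "labelling n Os ts bs \<eta>"
begin

abbreviation mult_entry :: "nat \<Rightarrow> nat \<Rightarrow> nat \<Rightarrow> (nat \<times> nat, 'k::field) mpoly" where
  "mult_entry k i j \<equiv> generic_mult_mat ts bs k $$ (i, j)"

abbreviation (input) wt :: "nat \<times> nat \<Rightarrow> (nat \<Rightarrow>\<^sub>0 int)" where
  "wt \<equiv> weight ts bs"

lemma labelling_facts: "distinct ts" "set ts = Os" "distinct bs" "set bs = border n Os"
  using lab by (auto simp: labelling_def)

lemma mult_entry_in: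
  assumes "i < length ts" "j < length ts" "ind k + ts ! j \<in> Os"
  shows "mult_entry k i j = (if ts ! i = ind k + ts ! j then 1 else 0)"
  using assms labelling_facts by (simp add: generic_mult_mat_def Let_def)

lemma mult_entry_border:
  assumes i: "i < length ts" and j: "j < length ts" and k: "k < n" and notin: "ind k + ts ! j \<notin> Os"
  obtains m where "m < length bs" "bs ! m = ind k + ts ! j"
    "(mult_entry k i j :: (nat \<times> nat, 'k::field) mpoly) = Var (i, m)"
proof -
  have "ts ! j \<in> Os" using j labelling_facts nth_mem by blast
  then have "ind k + ts ! j \<in> set bs" using k notin labelling_facts by (auto simp: border_def)
  then obtain m where m: "m < length bs" "bs ! m = ind k + ts ! j" by (auto simp: in_set_conv_nth)
  have "(THE m. m < length bs \<and> bs ! m = ind k + ts ! j) = m"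
    using m nth_eq_iff_index_eq[OF labelling_facts(3), of _ m] by (intro the_equality) auto
  then have "(mult_entry k i j :: (nat \<times> nat, 'k) mpoly) = Var (i, m)"
    using i j notin labelling_facts by (simp add: generic_mult_mat_def Let_def)
  with m show ?thesis by (rule that)
qed

lemma vars_mult_entry:
  assumes "i < length ts" "j < length ts" "k < n"
  shows "vars (mult_entry k i j :: (nat \<times> nat, 'k::field) mpoly) \<subseteq> c_index ts bs"
proof (cases "ind k + ts ! j \<in> Os")
  case True
  then show ?thesis using assms by (simp add: mult_entry_in)
next
  case False
  with assms obtain m where "m < length bs" "(mult_entry k i j :: (nat \<times> nat, 'k) mpoly) = Var (i, m)"
    using mult_entry_border by metis
  then show ?thesis using assms by (simp add: c_index_def)
qed

text \<open>In both cases of the definition the entry has the degree of \<open>x\<^sub>k t\<^sub>j / t\<^sub>i\<close>: the degree is 0 if the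
  entry is 1, and \<open>b\<^sub>m - t\<^sub>i\<close> if it is the indeterminate with indices \<open>i\<close> and \<open>m\<close>, where \<open>b\<^sub>m = x\<^sub>k t\<^sub>j\<close>.\<close>

lemma homogeneous_mult_entry:
  assumes "i < length ts" "j < length ts" "k < n"
  shows "homogeneous wt (int_exp (ind k) + int_exp (ts ! j) - int_exp (ts ! i))
    (mult_entry k i j :: (nat \<times> nat, 'k::field) mpoly)"
proof (cases "ind k + ts ! j \<in> Os")
  case True
  show ?thesis
  proof (cases "ts ! i = ind k + ts ! j")
    case eq: True
    have "int_exp (ind k) + int_exp (ts ! j) - int_exp (ts ! i) = 0" by (simp add: eq int_exp_add)
    then show ?thesis using homogeneous_1[of wt] True eq assms by (simp add: mult_entry_in)
  next
    case False
    then show ?thesis using True assms by (simp add: mult_entry_in homogeneous_0)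
  qed
next
  case False
  with assms obtain m where m: "bs ! m = ind k + ts ! j" "(mult_entry k i j :: (nat \<times> nat, 'k) mpoly) = Var (i, m)"
    using mult_entry_border by metis
  then show ?thesis using homogeneous_Var[of wt "(i, m)"] by (simp add: weight_def int_exp_add)
qed

lemma lookup_mult_entry_0:
  assumes "i < length ts" "j < length ts" "k < n"
  shows "lookup (mult_entry k i j :: (nat \<times> nat, 'k::field) mpoly) 0 = (if ind k + ts ! j = ts ! i then 1 else 0)"
proof (cases "ind k + ts ! j \<in> Os")
  case True
  then show ?thesis using assms by (auto simp: mult_entry_in)
next
  case False
  moreover have "ts ! i \<in> Os" using assms labelling_facts nth_mem by blast
  ultimately have "ind k + ts ! j \<noteq> ts ! i" by auto
  with False assms show ?thesis using mult_entry_border[of i j k] by (metis lookup_Var_0)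
qed

text \<open>An explicit form of the entries of the commutators, free of matrices.\<close>

definition commutator_entry :: "nat \<Rightarrow> nat \<Rightarrow> nat \<Rightarrow> nat \<Rightarrow> (nat \<times> nat, 'k::field) mpoly" where
  "commutator_entry k l i j =
    (\<Sum>m<length ts. mult_entry k i m * mult_entry l m j) - (\<Sum>m<length ts. mult_entry l i m * mult_entry k m j)"

lemma commutator_entry_eq:
  assumes "i < length ts" "j < length ts"
  shows "(generic_mult_mat ts bs k * generic_mult_mat ts bs l
        - generic_mult_mat ts bs l * generic_mult_mat ts bs k) $$ (i, j) =
      (commutator_entry k l i j :: (nat \<times> nat, 'k::field) mpoly)"
proof -
  have d: "dim_row (generic_mult_mat ts bs k :: (nat \<times> nat, 'k) mpoly mat) = length ts"
    "dim_col (generic_mult_mat ts bs k :: (nat \<times> nat, 'k) mpoly mat) = length ts" for k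
    by (simp_all add: generic_mult_mat_def)
  show ?thesis
    using assms unfolding commutator_entry_def
    by (simp add: d scalar_prod_def lessThan_atLeast0)
qed

lemma vars_commutator_entry:
  assumes "i < length ts" "j < length ts" "k < n" "l < n"
  shows "vars (commutator_entry k l i j :: (nat \<times> nat, 'k::field) mpoly) \<subseteq> c_index ts bs"
  unfolding commutator_entry_def
  using assms by (intro vars_diff_sub vars_sum_sub vars_mult_sub vars_mult_entry) auto

text \<open>The contribution of the intermediate index \<open>m\<close> to the degree cancels.\<close>

lemma homogeneous_commutator_entry:
  assumes "i < length ts" "j < length ts" "k < n" "l < n"
  shows "homogeneous wt (int_exp (ind k) + int_exp (ind l) + int_exp (ts ! j) - int_exp (ts ! i))
    (commutator_entry k l i j :: (nat \<times> nat, 'k::field) mpoly)"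
proof -
  have "homogeneous wt (int_exp (ind k) + int_exp (ind l) + int_exp (ts ! j) - int_exp (ts ! i))
      (mult_entry k i m * mult_entry l m j :: (nat \<times> nat, 'k) mpoly)"
    if "m < length ts" "k < n" "l < n" for m k l
    using homogeneous_mult[OF homogeneous_mult_entry[of i m k] homogeneous_mult_entry[of m j l]] that assms
    by (simp add: algebra_simps)
  from this[of _ k l] this[of _ l k] show ?thesis
    unfolding commutator_entry_def using assms
    by (intro homogeneous_diff homogeneous_sum) (auto simp: algebra_simps)
qed

text \<open>The constant terms of the multiplication matrices describe multiplication by indeterminates modulo the
  monomials outside \<open>Os\<close>. Both products send \<open>t\<^sub>j\<close> to \<open>x\<^sub>k x\<^sub>l t\<^sub>j\<close> if this is in \<open>Os\<close>, because then the
  intermediate monomial is in the order ideal as well, and to 0 otherwise.\<close>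

lemma lookup_commutator_entry_0:
  assumes ij: "i < length ts" "j < length ts" and kl: "k < n" "l < n"
  shows "lookup (commutator_entry k l i j :: (nat \<times> nat, 'k::field) mpoly) 0 = 0"
proof -
  have prod: "(\<Sum>m<length ts. lookup (mult_entry k i m * mult_entry l m j :: (nat \<times> nat, 'k) mpoly) 0) =
      (if ind k + ind l + ts ! j = ts ! i then 1 else 0)" if kl: "k < n" "l < n" for k l
  proof -
    have e: "lookup (mult_entry k i m * mult_entry l m j :: (nat \<times> nat, 'k) mpoly) 0 =
        (if ind l + ts ! j = ts ! m then if ind k + ind l + ts ! j = ts ! i then 1 else 0 else 0)"
      if "m < length ts" for m
      using that ij kl by (simp add: lookup_mult_0 lookup_mult_entry_0 add.assoc)
    show ?thesis
    proof (cases "ind l + ts ! j \<in> Os")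
      case True
      then obtain m0 where m0: "m0 < length ts" "ts ! m0 = ind l + ts ! j"
        using labelling_facts by (metis in_set_conv_nth)
      then have "ind l + ts ! j = ts ! m \<longleftrightarrow> m = m0" if "m < length ts" for m
        using that labelling_facts(1) by (metis nth_eq_iff_index_eq)
      then show ?thesis using m0(1) by (simp add: e)
    next
      case False
      have "ind l + ts ! j \<noteq> ts ! m" if "m < length ts" for m
        using that False labelling_facts by (metis nth_mem)
      moreover have "ind k + ind l + ts ! j \<noteq> ts ! i"
      proof
        assume eq: "ind k + ind l + ts ! j = ts ! i"
        have "ts ! i \<in> Os" using ij labelling_facts nth_mem by blast
        moreover have "mon_dvd (ind l + ts ! j) (ts ! i)"
          unfolding mon_dvd_def eq[symmetric] by (intro exI[of _ "ind k"]) (simp add: add_ac)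
        ultimately show False using False Os by (auto simp: order_ideal_def)
      qed
      ultimately show ?thesis by (simp add: e)
    qed
  qed
  show ?thesis
    unfolding commutator_entry_def lookup_minus lookup_sum
    using prod[OF kl] prod[OF kl(2,1)] by (simp add: add_ac)
qed

lemma border_ideal_eq:
  "border_ideal n ts bs = (Idl\<^bsub>poly_ring (c_index ts bs)\<^esub>
    {commutator_entry k l i j | i j k l. i < length ts \<and> j < length ts \<and> k < l \<and> l < n} ::
      (nat \<times> nat, 'k::field) mpoly set)"
proof -
  have "{(generic_mult_mat ts bs k * generic_mult_mat ts bs l
        - generic_mult_mat ts bs l * generic_mult_mat ts bs k) $$ (i, j) | i j k l.
      i < length ts \<and> j < length ts \<and> k < l \<and> l < n} =
    {commutator_entry k l i j :: (nat \<times> nat, 'k) mpoly | i j k l. i < length ts \<and> j < length ts \<and> k < l \<and> l < n}"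
    by (intro Collect_cong ex_cong1 rev_conj_cong refl) (auto simp: commutator_entry_eq)
  then show ?thesis unfolding border_ideal_def by (rule arg_cong)
qed

text \<open>Both summands of the ideal are generated by homogeneous polynomials without constant term, and the
  polynomials in a subset of the indeterminates are stable under taking homogeneous parts.\<close>

lemma groebner_ideal_facts:
  fixes I :: "(nat \<times> nat, 'k::field) mpoly set"
  assumes I: "I = groebner_ideal n ts bs \<eta> \<sigma>"
  shows ideal_groebner: "ideal I (poly_ring (S_corners ts bs \<eta> \<sigma>))"
    and groebner_0: "f \<in> I \<Longrightarrow> lookup f 0 = 0"
    and groebner_graded: "f \<in> I \<Longrightarrow> hom_part wt g f \<in> I"
proof -
  let ?C = "c_index ts bs" and ?V = "S_corners ts bs \<eta> \<sigma>"
  let ?P = "poly_ring ?C :: (nat \<times> nat, 'k) mpoly ring"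
  interpret P: cring ?P by (rule cring_poly_ring)
  let ?X = "{commutator_entry k l i j :: (nat \<times> nat, 'k) mpoly | i j k l.
    i < length ts \<and> j < length ts \<and> k < l \<and> l < n}"
  let ?Y = "Var ` (?C - S_all ts bs \<sigma>) :: (nat \<times> nat, 'k) mpoly set"
  let ?B = "border_ideal n ts bs :: (nat \<times> nat, 'k) mpoly set"
  let ?L = "L_ideal ts bs \<sigma> :: (nat \<times> nat, 'k) mpoly set"
  have X: "vars x \<subseteq> ?C" "\<exists>g. homogeneous wt g x" "lookup x 0 = 0" if "x \<in> ?X" for x
  proof -
    obtain i j k l where x: "x = commutator_entry k l i j" "i < length ts" "j < length ts" "k < n" "l < n"
      using \<open>x \<in> ?X\<close> less_trans by blast
    show "vars x \<subseteq> ?C" "\<exists>g. homogeneous wt g x" "lookup x 0 = 0"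
      unfolding x(1) using vars_commutator_entry[OF x(2-5)] homogeneous_commutator_entry[OF x(2-5)]
        lookup_commutator_entry_0[OF x(2-5)] by blast+
  qed
  have Y: "vars y \<subseteq> ?C" "\<exists>g. homogeneous wt g y" "lookup y 0 = 0" if "y \<in> ?Y" for y
  proof -
    obtain v where "v \<in> ?C" "y = Var v" using \<open>y \<in> ?Y\<close> by blast
    then show "vars y \<subseteq> ?C" "\<exists>g. homogeneous wt g y" "lookup y 0 = 0"
      using homogeneous_Var[of wt v] by auto
  qed
  have Xc: "?X \<subseteq> carrier ?P" and Yc: "?Y \<subseteq> carrier ?P"
    unfolding poly_ring_simps using X(1) Y(1) by blast+
  have B: "ideal ?B ?P" unfolding border_ideal_eq by (rule P.genideal_ideal[OF Xc])
  have L: "ideal ?L ?P" unfolding L_ideal_def by (rule P.genideal_ideal[OF Yc])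
  have Bg: "graded_set wt ?B" unfolding border_ideal_eq by (rule graded_genideal) (use X in blast)+
  have Lg: "graded_set wt ?L" unfolding L_ideal_def by (rule graded_genideal) (use Y in blast)+
  have o: "ideal (origin ?C :: (nat \<times> nat, 'k) mpoly set) ?P"
    unfolding origin_def by (rule P.genideal_ideal) auto
  have Bo: "?B \<subseteq> origin ?C"
    unfolding border_ideal_eq
    by (rule P.genideal_minimal[OF o]) (unfold origin_eq, use X(1,3) in blast)
  have Lo: "?L \<subseteq> origin ?C"
    unfolding L_ideal_def by (rule P.genideal_minimal[OF o]) (use Y in \<open>auto simp: origin_eq\<close>)
  have mem: "f \<in> I \<longleftrightarrow> vars f \<subseteq> ?V \<and> (\<exists>a\<in>?L. \<exists>b\<in>?B. f = a + b)" for f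
    unfolding I groebner_ideal_def set_add_def set_mult_def by auto
  have LB: "ideal (?L <+>\<^bsub>?P\<^esub> ?B) ?P" by (rule P.add_ideals[OF L B])
  have I': "I = (?L <+>\<^bsub>?P\<^esub> ?B) \<inter> {f. vars f \<subseteq> ?V}" unfolding I groebner_ideal_def by simp
  show "ideal I (poly_ring ?V)"
  proof (rule poly_idealI)
    show "vars f \<subseteq> ?V" if "f \<in> I" for f using that I' by blast
    show "0 \<in> I" unfolding I' using poly_ideal_0[OF LB] by simp
    show "f + g \<in> I" if "f \<in> I" "g \<in> I" for f g
      using that poly_ideal_add[OF LB, of f g] vars_add_sub[of f ?V g] unfolding I' by simp
    show "h * g \<in> I" if "vars h \<subseteq> ?V" "g \<in> I" for h g
      using that poly_ideal_mult[OF LB, of g h] vars_mult_sub[of h ?V g]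
        subset_trans[OF that(1) S_corners_sub] unfolding I' by simp
  qed
  show "lookup f 0 = 0" if "f \<in> I" for f
  proof -
    obtain a b where ab: "a \<in> ?L" "b \<in> ?B" "f = a + b" using \<open>f \<in> I\<close> mem by blast
    have "a \<in> origin ?C" "b \<in> origin ?C" using ab Lo Bo by blast+
    then show ?thesis unfolding ab(3) by (simp add: origin_eq lookup_add)
  qed
  show "hom_part wt g f \<in> I" if "f \<in> I" for f g
  proof -
    obtain a b where ab: "a \<in> ?L" "b \<in> ?B" "f = a + b" using \<open>f \<in> I\<close> mem by blast
    have "hom_part wt g a \<in> ?L" "hom_part wt g b \<in> ?B"
      using ab Lg Bg by (simp_all add: graded_set_def)
    moreover have "vars (hom_part wt g f) \<subseteq> ?V"
      using vars_hom_part[of wt g f] \<open>f \<in> I\<close> I' by blast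
    ultimately show ?thesis unfolding mem ab(3) hom_part_add by blast
  qed
qed

end

section \<open>Smoothness at the origin\<close>

text \<open>As \<open>I\<close> is contained in the ideal of the origin, the constant term of a polynomial only depends on its
  class modulo \<open>I\<close>.\<close>

lemma origin_of_quotient:
  fixes I :: "('v, 'k::field) mpoly set"
  assumes I: "ideal I (poly_ring V)" and I0: "\<And>f. f \<in> I \<Longrightarrow> lookup f 0 = 0"
  defines "q \<equiv> (+>\<^bsub>poly_ring V\<^esub>) I ` origin V"
  shows origin_of_quotient_prime: "primeideal q (poly_ring V Quot I)"
    and origin_of_quotient_mem: "\<And>f. vars f \<subseteq> V \<Longrightarrow> I +>\<^bsub>poly_ring V\<^esub> f \<in> q \<longleftrightarrow> lookup f 0 = 0"
proof -
  let ?A = "poly_ring V Quot I"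
  let ?\<pi> = "(+>\<^bsub>poly_ring V\<^esub>) I"
  interpret \<pi>: surj_cring_hom "poly_ring V" ?A ?\<pi> by (rule surj_poly_quot[OF I])
  have piadd: "?\<pi> f \<oplus>\<^bsub>?A\<^esub> ?\<pi> g = ?\<pi> (f + g)" and pimult: "?\<pi> f \<otimes>\<^bsub>?A\<^esub> ?\<pi> g = ?\<pi> (f * g)"
    if "vars f \<subseteq> V" "vars g \<subseteq> V" for f g
    using \<pi>.hom_add[of f g] \<pi>.hom_mult[of f g] that by simp_all
  have surj: "\<exists>f. vars f \<subseteq> V \<and> X = ?\<pi> f" if "X \<in> carrier ?A" for X
    using that unfolding \<pi>.surj[symmetric] by auto
  have q: "q = ?\<pi> ` {f. vars f \<subseteq> V \<and> lookup f 0 = 0}" by (simp add: q_def origin_eq)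
  show mem: "?\<pi> f \<in> q \<longleftrightarrow> lookup f 0 = 0" if f: "vars f \<subseteq> V" for f
  proof
    assume "?\<pi> f \<in> q"
    then obtain g where g: "vars g \<subseteq> V" "lookup g 0 = 0" "?\<pi> f = ?\<pi> g" unfolding q by blast
    then have "f - g \<in> I" using poly_quot_eq_iff[OF I f g(1)] by blast
    then have "lookup (f - g) 0 = 0" by (rule I0)
    then show "lookup f 0 = 0" using g(2) by (simp add: lookup_minus)
  qed (use f q in blast)
  have mem_ex: "\<exists>f. vars f \<subseteq> V \<and> lookup f 0 = 0 \<and> X = ?\<pi> f" if "X \<in> q" for X using that q by blast
  have id: "ideal q ?A"
  proof (rule \<pi>.S.cring_idealI)
    show "q \<subseteq> carrier ?A" unfolding q using \<pi>.hom_closed by auto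
    show "\<zero>\<^bsub>?A\<^esub> \<in> q" using mem[of 0] \<pi>.hom_zero by simp
    fix X Y assume "X \<in> q" "Y \<in> q"
    then obtain f g where f: "vars f \<subseteq> V" "lookup f 0 = 0" "X = ?\<pi> f" and
      g: "vars g \<subseteq> V" "lookup g 0 = 0" "Y = ?\<pi> g" using mem_ex by metis
    have "vars (f + g) \<subseteq> V" using f(1) g(1) by (rule vars_add_sub)
    then show "X \<oplus>\<^bsub>?A\<^esub> Y \<in> q" unfolding f(3) g(3) piadd[OF f(1) g(1)]
      using f(2) g(2) by (subst mem) (simp_all add: lookup_add)
  next
    fix X Y assume "X \<in> carrier ?A" "Y \<in> q"
    then obtain f g where f: "vars f \<subseteq> V" "X = ?\<pi> f" and
      g: "vars g \<subseteq> V" "lookup g 0 = 0" "Y = ?\<pi> g" using mem_ex surj by metis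
    have "vars (f * g) \<subseteq> V" using f(1) g(1) by (rule vars_mult_sub)
    then show "X \<otimes>\<^bsub>?A\<^esub> Y \<in> q" unfolding f(2) g(3) pimult[OF f(1) g(1)]
      using g(2) by (subst mem) (simp_all add: lookup_mult_0)
  qed
  show "primeideal q ?A"
  proof (rule primeidealI[OF id \<pi>.S.is_cring])
    have "?\<pi> 1 \<notin> q" using mem[of 1] by simp
    moreover have "?\<pi> 1 \<in> carrier ?A" using \<pi>.hom_closed[of 1] by simp
    ultimately show "carrier ?A \<noteq> q" by blast
    fix X Y assume "X \<in> carrier ?A" "Y \<in> carrier ?A" and XY: "X \<otimes>\<^bsub>?A\<^esub> Y \<in> q"
    then obtain f g where f: "vars f \<subseteq> V" "X = ?\<pi> f" and g: "vars g \<subseteq> V" "Y = ?\<pi> g"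
      using surj by metis
    have "vars (f * g) \<subseteq> V" using f(1) g(1) by (rule vars_mult_sub)
    then have "lookup (f * g) 0 = 0"
      using XY mem[of "f * g"] unfolding f(2) g(2) pimult[OF f(1) g(1)] by blast
    then show "X \<in> q \<or> Y \<in> q" using mem[OF f(1)] mem[OF g(1)] f(2) g(2) by (auto simp: lookup_mult_0)
  qed
qed

text \<open>The general statement behind the theorem: for a homogeneous ideal in a positively graded polynomial
  ring, the scheme that it defines is an affine space if and only if it is regular at the origin.\<close>

theorem graded_quotient_affine_iff_regular:
  fixes V :: "'v set" and w :: "'v \<Rightarrow> 'g::ab_group_add" and I :: "('v, 'k::field) mpoly set"
  assumes V: "finite V" and I: "ideal I (poly_ring V)" and I0: "\<And>f. f \<in> I \<Longrightarrow> lookup f 0 = 0"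
    and pos: "\<And>v. v \<in> V \<Longrightarrow> w v \<in> Pos" "\<And>a b. a \<in> Pos \<Longrightarrow> b \<in> Pos \<Longrightarrow> a + b \<in> Pos" "0 \<notin> Pos"
    and graded: "\<And>f g. f \<in> I \<Longrightarrow> hom_part w g f \<in> I"
  defines "A \<equiv> poly_ring V Quot I"
    and "X \<equiv> Spec (\<lambda>a. I +>\<^bsub>poly_ring V\<^esub> Const a) (poly_ring V Quot I)"
  shows "origin V \<in> closed_immersion (poly_ring V) I ` topspace (space X) \<and>
    ((\<exists>d. isomorphic_over X (affine_space {..<d::nat})) \<longleftrightarrow>
     (\<exists>q \<in> topspace (space X). closed_immersion (poly_ring V) I q = origin V \<and> smooth_point A q))"
proof -
  let ?\<pi> = "(+>\<^bsub>poly_ring V\<^esub>) I"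
  interpret \<pi>: surj_cring_hom "poly_ring V" A ?\<pi> unfolding A_def by (rule surj_poly_quot[OF I])
  have A: "cring A" by (rule \<pi>.S.is_cring)
  have Const: "?\<pi> (Const a) \<in> carrier A" for a using \<pi>.hom_closed[of "Const a"] by simp
  have top: "topspace (space X) = prime_spectrum A" by (simp add: X_def A_def Spec_def topspace_zariski)
  have X: "X = Spec (\<lambda>a. ?\<pi> (Const a)) A" by (simp add: X_def A_def)
  let ?q = "?\<pi> ` origin V"
  have prime: "primeideal ?q A" unfolding A_def by (rule origin_of_quotient_prime[OF I I0])
  have mem: "?\<pi> f \<in> ?q \<longleftrightarrow> lookup f 0 = 0" if "vars f \<subseteq> V" for f
    by (rule origin_of_quotient_mem[OF I I0 that])
  have imm: "closed_immersion (poly_ring V) I ?q = origin V"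
    using mem by (auto simp: closed_immersion_def origin_eq)
  have a: "?q \<in> topspace (space X)" unfolding top prime_spectrum_def using prime by simp
  have 1: "smooth_point A ?q" if "isomorphic_over X (affine_space {..<d::nat})" for d
  proof -
    let ?B = "poly_ring {..<d} :: (nat, 'k) mpoly ring"
    have iso: "isomorphic_over (Spec (\<lambda>a. ?\<pi> (Const a)) A) (Spec Const ?B)"
      using that by (simp add: X affine_space_def)
    have ConstB: "Const a \<in> carrier ?B" for a by simp
    obtain h where h: "h \<in> ring_iso ?B A" "\<And>c. h (Const c) = ?\<pi> (Const c)"
      by (rule isomorphic_Spec_imp_ring_iso[OF A cring_poly_ring Const ConstB iso]) (rule that, assumption+)
    have "\<exists>c. x \<ominus>\<^bsub>A\<^esub> h (Const c) \<in> ?q" if x: "x \<in> carrier A" for x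
    proof -
      obtain f where f: "vars f \<subseteq> V" "x = ?\<pi> f" using x unfolding \<pi>.surj[symmetric] by auto
      let ?c = "Const (lookup f 0)"
      have "\<ominus>\<^bsub>A\<^esub> ?\<pi> ?c = ?\<pi> (- ?c)" using \<pi>.hom_a_inv[of ?c] by (simp add: poly_ring_uminus)
      then have "x \<ominus>\<^bsub>A\<^esub> h ?c = ?\<pi> (f + - ?c)"
        using \<pi>.hom_add[of f "- ?c"] f by (simp add: a_minus_def h(2) vars_uminus)
      moreover have "?\<pi> (f + - ?c) \<in> ?q"
        using f(1) by (subst mem) (simp_all add: vars_diff_sub lookup_minus)
      ultimately have "x \<ominus>\<^bsub>A\<^esub> h ?c \<in> ?q" by simp
      then show ?thesis by blast
    qed
    then have "regular_local_ring (localization A ?q)"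
      by (rule regular_at_rational_point[OF A h(1) prime])
    then show ?thesis using prime by (simp add: smooth_point_def prime_spectrum_def)
  qed
  have 2: "\<exists>d. isomorphic_over X (affine_space {..<d::nat})"
    if q: "closed_immersion (poly_ring V) I q = origin V" "smooth_point A q" for q
  proof -
    have pq: "primeideal q (poly_ring V Quot I)" using q(2) by (simp add: smooth_point_def prime_spectrum_def A_def)
    have "?\<pi> f \<in> q \<longleftrightarrow> lookup f 0 = 0" if f: "vars f \<subseteq> V" for f
    proof -
      have "?\<pi> f \<in> q \<longleftrightarrow> f \<in> closed_immersion (poly_ring V) I q" using f by (simp add: closed_immersion_def)
      then show ?thesis unfolding q(1) origin_eq using f by simp
    qed
    moreover have "regular_local_ring (localization (poly_ring V Quot I) q)"
      using q(2) by (simp add: smooth_point_def A_def)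
    ultimately obtain k \<chi> where \<chi>: "\<chi> \<in> ring_iso (poly_ring {..<k::nat}) A"
      "\<And>c. \<chi> (Const c) = ?\<pi> (Const c)"
      using regular_at_origin_imp_polynomial_ring[OF V I I0 pos graded pq] unfolding A_def by blast
    interpret \<chi>: cring_iso A "poly_ring {..<k}" \<chi>
      using A cring_poly_ring \<chi>(1) by (simp add: cring_iso_def)
    have "isomorphic_over (Spec (\<lambda>a. ?\<pi> (Const a)) A) (Spec Const (poly_ring {..<k}))"
      by (rule \<chi>.isomorphic_Spec) (simp_all add: \<chi>(2))
    then show ?thesis unfolding X affine_space_def by blast
  qed
  show ?thesis
  proof (intro conjI iffI)
    show "origin V \<in> closed_immersion (poly_ring V) I ` topspace (space X)"
      using imageI[OF a, of "closed_immersion (poly_ring V) I"] unfolding imm .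
  next
    assume "\<exists>d. isomorphic_over X (affine_space {..<d::nat})"
    then show "\<exists>q \<in> topspace (space X). closed_immersion (poly_ring V) I q = origin V \<and> smooth_point A q"
      using a imm 1 by (intro bexI[of _ ?q] conjI) auto
  next
    assume "\<exists>q \<in> topspace (space X). closed_immersion (poly_ring V) I q = origin V \<and> smooth_point A q"
    then show "\<exists>d. isomorphic_over X (affine_space {..<d::nat})" using 2 by blast
  qed
qed

theorem corollary3p7:
  fixes n \<eta> :: nat and Os :: "mon set" and \<sigma> :: "mon rel" and ts bs :: "mon list"
    and G :: "((nat \<times> nat, 'k::field) mpoly set set,
       (nat \<times> nat, 'k) mpoly set set \<Rightarrow> ((nat \<times> nat, 'k) mpoly set \<times> (nat \<times> nat, 'k) mpoly set) set,
       'k) k_scheme"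
    and \<iota> :: "(nat \<times> nat, 'k) mpoly set set \<Rightarrow> (nat \<times> nat, 'k) mpoly set"
    and \<oo> :: "(nat \<times> nat, 'k) mpoly set"
  assumes "order_ideal n Os"
    and "term_ordering n \<sigma>"
    and "labelling n Os ts bs \<eta>"
    and "G = groebner_scheme n ts bs \<eta> \<sigma>"
    and "\<iota> = groebner_immersion n ts bs \<eta> \<sigma>"
    and "\<oo> = origin (S_corners ts bs \<eta> \<sigma>)"
  shows "\<oo> \<in> \<iota> ` topspace (space G) \<and>
    ((\<exists>d. isomorphic_over G (affine_space {..<d::nat})) \<longleftrightarrow>
     (\<exists>q \<in> topspace (space G). \<iota> q = \<oo> \<and> smooth_point (groebner_ring n ts bs \<eta> \<sigma>) q))"
  unfolding assms(4-6) groebner_scheme_def groebner_immersion_def groebner_ring_def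
proof (rule graded_quotient_affine_iff_regular[where w = "weight ts bs" and Pos = "positive_cone \<sigma>"])
  note facts = groebner_ideal_facts[OF assms(1-3) refl]
  show "finite (S_corners ts bs \<eta> \<sigma>)" by (rule finite_S_corners)
  show "ideal (groebner_ideal n ts bs \<eta> \<sigma>) (poly_ring (S_corners ts bs \<eta> \<sigma>))" by (rule facts(1))
  show "lookup f 0 = 0" if "f \<in> groebner_ideal n ts bs \<eta> \<sigma>" for f using that by (rule facts(2))
  show "hom_part (weight ts bs) g f \<in> groebner_ideal n ts bs \<eta> \<sigma>"
    if "f \<in> groebner_ideal n ts bs \<eta> \<sigma>" for f g using that by (rule facts(3))
  show "weight ts bs v \<in> positive_cone \<sigma>" if "v \<in> S_corners ts bs \<eta> \<sigma>" for v using that by (rule weight_pos)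
  show "a + b \<in> positive_cone \<sigma>" if "a \<in> positive_cone \<sigma>" "b \<in> positive_cone \<sigma>" for a b
    using assms(2) that by (rule positive_cone_add)
  show "0 \<notin> positive_cone \<sigma>" by (rule positive_cone_0)
qed

end
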